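(* Let $d \ge 1$ be an integer. Suppose that independent $d$-variate observations, each uniformly distributed in the unit hypercube $(0,1)^d$, arrive at times $1, 2, \dots$, and consider record-small values. Let $K_n = -1$ if the $n$th observation is not a new record, and otherwise let $K_n$ denote the number of remaining records killed by the $n$th observation. Then, as $n \to \infty$, the conditional distribution of $K_n$ given $K_n \ge 0$ converges weakly to the law of the random variable $\mathcal K \equiv \mathcal K(d)$, where $\mathcal L(\mathcal K)$ is the mixture $\mathbb E\, \mathcal L(\mathcal K'_W)$, i.e. $\mathbb P(\mathcal K = k) = \int_0^\infty \mathbb P(\mathcal K'_w = k)\, e^{-w}\,dw$ for $k = 0,1,2,\dots$. Here $W$ has the Exponential$(1)$ distribution and, for $w>0$, $\mathcal K'_w$ is the number of minima that dominate $\mathbf x' \equiv \mathbf x'(w) := (w^{1/d}, \dots, w^{1/d})$ in a homogeneous unit-rate Poisson point process in the set $\{\mathbf z \in (0,\infty)^d : \mathbf z \not\prec \mathbf x'\}$.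
   Context: For $\mathbf x, \mathbf y \in \mathbb R^d$, $\mathbf x \prec \mathbf y$ (equivalently $\mathbf y \succ \mathbf x$; "$\mathbf y$ dominates $\mathbf x$") means $x_j < y_j$ for every $j=1,\dots,d$. $\mathcal L(Y)$ denotes the law of $Y$. Record-small values: with observations $\mathbf U^{(1)}, \mathbf U^{(2)}, \dots$, the $n$th observation is a new record if $\mathbf U^{(n)} \not\succ \mathbf U^{(i)}$ for all $1 \le i < n$. For $1 \le j \le n$, $\mathbf U^{(j)}$ is a remaining record at time $n$ if $\mathbf U^{(j)} \not\succ \mathbf U^{(i)}$ for all $1 \le i \le n$. If the $n$th observation is a new record, the number of remaining records it kills is the number of $j$ with $1 \le j < n$ such that $\mathbf U^{(j)}$ is a remaining record at time $n-1$ but not at time $n$. Minima: a point $\mathbf y$ of a point process (or set) $S$ is a minimum of $S$ if $\mathbf y \not\succ \mathbf z$ for all $\mathbf z \in S$. *)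

theory Defs
  imports "HOL-Probability.Probability"
begin

text \<open>
  Strict coordinatewise order. The library order \<open>x < y\<close> on vectors only means
  \<open>x \<le> y \<and> x \<noteq> y\<close>, hence the separate definition.
\<close>

definition sdom :: "real ^ 'd \<Rightarrow> real ^ 'd \<Rightarrow> bool"  (infix "\<prec>" 50)
  where "x \<prec> y \<longleftrightarrow> (\<forall>j. x $ j < y $ j)"

definition unit_cube :: "(real ^ 'd) set"
  where "unit_cube = {x. \<forall>j. 0 < x $ j \<and> x $ j < 1}"

text \<open>Observations are indexed by the times \<open>1, 2, \<dots>\<close>; the value at index 0 is never used.\<close>

definition new_record :: "(nat \<Rightarrow> real ^ 'd) \<Rightarrow> nat \<Rightarrow> bool"
  where "new_record u n \<longleftrightarrow> (\<forall>i. 1 \<le> i \<and> i < n \<longrightarrow> \<not> u i \<prec> u n)"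

definition remaining_record :: "(nat \<Rightarrow> real ^ 'd) \<Rightarrow> nat \<Rightarrow> nat \<Rightarrow> bool"
  where "remaining_record u n j \<longleftrightarrow>
    1 \<le> j \<and> j \<le> n \<and> (\<forall>i. 1 \<le> i \<and> i \<le> n \<longrightarrow> \<not> u i \<prec> u j)"

definition killed_records :: "(nat \<Rightarrow> real ^ 'd) \<Rightarrow> nat \<Rightarrow> nat set"
  where "killed_records u n =
    {j. 1 \<le> j \<and> j < n \<and> remaining_record u (n - 1) j \<and> \<not> remaining_record u n j}"

definition kill_count :: "(nat \<Rightarrow> real ^ 'd) \<Rightarrow> nat \<Rightarrow> int"
  where "kill_count u n = (if new_record u n then int (card (killed_records u n)) else -1)"

definition minima :: "(real ^ 'd) set \<Rightarrow> (real ^ 'd) set"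
  where "minima S = {y \<in> S. \<forall>z \<in> S. \<not> z \<prec> y}"

text \<open>
  A homogeneous unit-rate Poisson point process in \<open>D\<close>, as a random locally finite subset of
  \<open>D\<close> (such a process has almost surely no multiple points). The counts of
  bounded Borel sets, which have finite volume, determine its law. The Poisson probabilities
  are written out because the library's \<open>poisson_pmf\<close> excludes the rate \<open>0\<close>, which
  occurs for null sets.
\<close>

definition unit_poisson_process ::
    "'b measure \<Rightarrow> 'a::euclidean_space set \<Rightarrow> ('b \<Rightarrow> 'a set) \<Rightarrow> bool"
  where "unit_poisson_process M D S \<longleftrightarrow>
    prob_space M \<and>
    (\<forall>\<omega>\<in>space M. S \<omega> \<subseteq> D \<and> (\<forall>B. bounded B \<longrightarrow> finite (S \<omega> \<inter> B))) \<and>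
    (\<forall>B\<in>sets borel. bounded B \<and> B \<subseteq> D \<longrightarrow>
       (\<lambda>\<omega>. card (S \<omega> \<inter> B)) \<in> measurable M (count_space UNIV) \<and>
       (\<forall>k. measure M {\<omega>\<in>space M. card (S \<omega> \<inter> B) = k} =
          measure lborel B ^ k / fact k * exp (- measure lborel B))) \<and>
    (\<forall>(B :: nat \<Rightarrow> 'a set) m.
       (\<forall>i<m. B i \<in> sets borel \<and> bounded (B i) \<and> B i \<subseteq> D) \<and> disjoint_family_on B {..<m} \<longrightarrow>
       prob_space.indep_vars M (\<lambda>_. count_space UNIV) (\<lambda>i \<omega>. card (S \<omega> \<inter> B i)) {..<m})"

definition corner :: "real \<Rightarrow> real ^ 'd"
  where "corner w = (\<chi> j. w powr (1 / real CARD('d)))"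

definition corner_region :: "real \<Rightarrow> (real ^ 'd) set"
  where "corner_region w = {z. (\<forall>j. 0 < z $ j) \<and> \<not> z \<prec> corner w}"

text \<open>
  The value is extended because the set of minima of an arbitrary point configuration may be
  infinite, where \<open>card\<close> would return 0.
\<close>

definition dominating_minima_count :: "real \<Rightarrow> (real ^ 'd) set \<Rightarrow> enat"
  where "dominating_minima_count w S =
    (let A = {y \<in> minima S. corner w \<prec> y} in if finite A then enat (card A) else \<infinity>)"

end

theory Submission
  imports Defs
begin

text \<open>
  Scale coordinates so that the newest observation \<open>u\<close> becomes the corner, and put
  \<open>p = \<Prod>j. u $ j\<close>, \<open>w = n * p\<close>. The other \<open>n - 1\<close> points then avoid a region of scaled volume
  \<open>v\<close> with probability \<open>(1 - w * v / n) ^ (n - 1)\<close>, which tends to the Poisson void probability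
  \<open>exp (- w * v)\<close>. The number of dominating minima is read off, up to small errors, from the
  set of occupied cells of a finite grid, and the law of that set is a finite combination of void
  probabilities (Moebius inversion). Hence, uniformly for \<open>w\<close> in a compact interval and \<open>u\<close> near
  \<open>0\<close>, the probability that \<open>u\<close> is a record killing \<open>k\<close> remaining records is close to
  \<open>exp (- w)\<close> times the probability of \<open>k\<close> dominating minima in the Poisson process. The errors come
  from minima outside a large box (union bound over unit cells) and from two points sharing a
  coordinate slab of width \<open>1 / L\<close>.

  Since \<open>- ln p\<close> has an Erlang law, \<open>n * fact (d - 1) / ln n ^ (d - 1)\<close> times the law of \<open>w\<close>
  converges vaguely to Lebesgue measure, while \<open>max u\<close> tends to \<open>0\<close>. So the scaled probability of
  killing \<open>k\<close> records tends to the integral of the Poisson probability against \<open>exp (- w)\<close>; the same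
  argument for all \<open>k\<close> together gives the limit \<open>1\<close> for the record probability, and the grid
  bounds the count, which gives tightness.
\<close>

section \<open>Grid cells and minima\<close>

text \<open>The processes for different \<open>w\<close> live on unrelated probability spaces, so
  nothing is known beforehand about how their probabilities depend on \<open>w\<close>; even
  measurability of the mixture integrand has to be proved. It follows from writing the integrand as
  an iterated limit, in \<open>L\<close> and then in \<open>M\<close>, of explicit finite sums of
  exponentials.

  The parameters are fixed in the order \<open>[a, b]\<close>, \<open>M\<close>, \<open>L\<close>,
  \<open>n\<close>. The box factor \<open>M\<close> must be large in terms of \<open>a\<close> and
  \<open>b\<close>, since far minima are rare only when \<open>w\<close> stays away from
  \<open>0\<close>. The mesh \<open>1 / L\<close> must be small in terms of \<open>M\<close>, since
  a slab has \<open>d - 1\<close> sides of scaled length \<open>M\<close>. The sample size comes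
  last, since the number of Moebius terms grows with the number of cells.

  Limits of the scaled probabilities for single \<open>k\<close> do not exclude that mass escapes to
  infinity, so they do not show that the mixture has total mass \<open>1\<close>. Tightness is taken
  from the sample at one fixed grid, up to the approximation error. The normalising factor is the
  reciprocal of the asymptotic record probability and cancels in the conditional law.\<close>

definition idx :: "nat \<Rightarrow> real ^ 'd \<Rightarrow> real ^ 'd \<Rightarrow> 'd \<Rightarrow> nat"
  where "idx L u x j = nat \<lfloor>real L * (x $ j / u $ j)\<rfloor>"

text \<open>The positivity clause matters: \<open>nat\<close> sends negative values to \<open>0\<close>.\<close>

definition cell :: "nat \<Rightarrow> real ^ 'd \<Rightarrow> ('d \<Rightarrow> nat) \<Rightarrow> (real ^ 'd) set"
  where "cell L u m = {x. (\<forall>j. 0 < x $ j) \<and> idx L u x = m}"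

definition grid :: "nat \<Rightarrow> ('d \<Rightarrow> nat) set"
  where "grid N = {m. \<forall>j. m j < N}"

text \<open>The corner itself has index \<open>L\<close> in every coordinate, hence the strict \<open>L < m j\<close>.\<close>

definition grid_count :: "nat \<Rightarrow> ('d \<Rightarrow> nat) set \<Rightarrow> nat"
  where "grid_count L A = card {m \<in> A. (\<forall>j. L < m j) \<and> (\<forall>m'\<in>A. \<not> (\<forall>j. m' j < m j))}"

definition occupied :: "nat \<Rightarrow> real ^ 'd \<Rightarrow> nat \<Rightarrow> (real ^ 'd) set \<Rightarrow> ('d \<Rightarrow> nat) set"
  where "occupied L u N X = {m \<in> grid N. X \<inter> cell L u m \<noteq> {}}"

lemma finite_grid [simp]: "finite (grid N :: ('d::finite \<Rightarrow> nat) set)"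
proof -
  have "grid N = (PiE UNIV (\<lambda>_. {..<N}) :: ('d \<Rightarrow> nat) set)"
    by (auto simp: grid_def PiE_def Pi_def)
  then show ?thesis by (simp add: finite_PiE)
qed

lemma card_grid: "card (grid N :: ('d::finite \<Rightarrow> nat) set) = N ^ CARD('d)"
proof -
  have "grid N = (PiE UNIV (\<lambda>_. {..<N}) :: ('d \<Rightarrow> nat) set)"
    by (auto simp: grid_def PiE_def Pi_def)
  then show ?thesis by (simp add: card_PiE)
qed

lemma grid_mono: "N \<le> N' \<Longrightarrow> grid N \<subseteq> grid N'"
  by (auto simp: grid_def intro: less_le_trans)

lemma idx_mono: "\<lbrakk>x $ j \<le> y $ j; 0 < u $ j\<rbrakk> \<Longrightarrow> idx L u x j \<le> idx L u y j"
  unfolding idx_def by (intro nat_mono floor_mono mult_left_mono divide_right_mono) auto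

lemma idx_less_imp_less: "\<lbrakk>idx L u x j < idx L u y j; 0 < u $ j\<rbrakk> \<Longrightarrow> x $ j < y $ j"
  using idx_mono[of y j x u L] by force

lemma idx_eq_iff:
  assumes "0 < u $ j" "0 < x $ j" "0 < L"
  shows "idx L u x j = k \<longleftrightarrow> real k * u $ j / real L \<le> x $ j \<and> x $ j < (real k + 1) * u $ j / real L"
proof -
  have "idx L u x j = k \<longleftrightarrow> \<lfloor>real L * (x $ j / u $ j)\<rfloor> = int k"
    using assms by (auto simp: idx_def nat_eq_iff)
  also have "\<dots> \<longleftrightarrow> real k \<le> real L * (x $ j / u $ j) \<and> real L * (x $ j / u $ j) < real k + 1"
    by (simp add: floor_eq_iff)
  also have "\<dots> \<longleftrightarrow> real k * u $ j / real L \<le> x $ j \<and> x $ j < (real k + 1) * u $ j / real L"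
    using assms by (auto simp: field_simps)
  finally show ?thesis .
qed

lemma idx_less_iff:
  assumes "0 < u $ j" "0 < x $ j"
  shows "idx L u x j < k \<longleftrightarrow> real L * x $ j < real k * u $ j"
proof -
  have "idx L u x j < k \<longleftrightarrow> \<lfloor>real L * (x $ j / u $ j)\<rfloor> < int k"
    using assms by (auto simp: idx_def nat_less_iff)
  also have "\<dots> \<longleftrightarrow> real L * (x $ j / u $ j) < real k"
    by (simp add: floor_less_iff)
  also have "\<dots> \<longleftrightarrow> real L * x $ j < real k * u $ j"
    using assms by (auto simp: field_simps)
  finally show ?thesis .
qed

lemma idx_in_grid_iff:
  assumes "\<And>j. 0 < u $ j" "\<And>j. 0 < x $ j" "0 < L"
  shows "idx L u x \<in> grid (M * L) \<longleftrightarrow> (\<forall>j. x $ j < real M * u $ j)"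
  using assms by (simp add: grid_def idx_less_iff algebra_simps)

text \<open>The corner lies on a cell boundary, so the box below it is exactly a union of cells: the
  record condition is read off the grid without discretisation error.\<close>

lemma sdom_iff_idx:
  assumes "\<And>j. 0 < u $ j" "\<And>j. 0 < x $ j" "0 < L"
  shows "x \<prec> u \<longleftrightarrow> idx L u x \<in> grid L"
  using assms idx_in_grid_iff[of u x L 1] by (simp add: sdom_def)

text \<open>The index map always reflects strict inequalities; under \<open>sep\<close> and
  \<open>corner\<close> it also preserves them, so domination can be read from cells. Cutting off at
  \<open>grid (M * L)\<close> does not change minimality, because the window is closed downwards.
  Only strict inequalities have to survive: points may tie in a coordinate, as domination is strict
  in every coordinate.\<close>

lemma grid_count_eq_card:
  fixes x :: "'i \<Rightarrow> real ^ 'd" and u :: "real ^ 'd" and J :: "'i set" and L M :: nat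
  defines "occ \<equiv> occupied L u (M * L) (x ` J)"
  assumes upos: "\<And>j. 0 < u $ j" and xpos: "\<And>i j. i \<in> J \<Longrightarrow> 0 < x i $ j" and L: "0 < L"
    and sep: "\<And>i i' j. \<lbrakk>i \<in> J; i' \<in> J; idx L u (x i) \<in> grid (M * L); idx L u (x i') \<in> grid (M * L);
        x i' $ j < x i $ j\<rbrakk> \<Longrightarrow> idx L u (x i') j < idx L u (x i) j"
    and inj: "inj_on (\<lambda>i. idx L u (x i)) {i \<in> J. idx L u (x i) \<in> grid (M * L)}"
    and corner: "\<And>i j. \<lbrakk>i \<in> J; idx L u (x i) \<in> grid (M * L); u $ j < x i $ j\<rbrakk> \<Longrightarrow> L < idx L u (x i) j"
  shows "grid_count L occ =
    card {i \<in> J. idx L u (x i) \<in> grid (M * L) \<and> u \<prec> x i \<and> (\<forall>i'\<in>J. \<not> x i' \<prec> x i)}"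
proof -
  define f where "f i = idx L u (x i)" for i
  let ?R = "{i \<in> J. f i \<in> grid (M * L) \<and> u \<prec> x i \<and> (\<forall>i'\<in>J. \<not> x i' \<prec> x i)}"
  have occ: "occ = f ` J \<inter> grid (M * L)"
    using xpos by (auto simp: occ_def occupied_def cell_def f_def)
  have corner_iff: "u \<prec> x i \<longleftrightarrow> (\<forall>j. L < f i j)" if "i \<in> J" "f i \<in> grid (M * L)" for i
  proof
    show "u \<prec> x i \<Longrightarrow> \<forall>j. L < f i j"
      using corner that by (auto simp: sdom_def f_def)
    assume *: "\<forall>j. L < f i j"
    have "u $ j < x i $ j" for j
    proof -
      have "idx L u u j = L"
        using upos[of j] by (simp add: idx_def)
      then show ?thesis
        using idx_less_imp_less[of L u u j "x i"] upos[of j] * by (simp add: f_def)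
    qed
    then show "u \<prec> x i" by (simp add: sdom_def)
  qed
  have min_iff: "(\<forall>m'\<in>occ. \<not> (\<forall>j. m' j < f i j)) \<longleftrightarrow> (\<forall>i'\<in>J. \<not> x i' \<prec> x i)"
    if i: "i \<in> J" "f i \<in> grid (M * L)" for i
  proof -
    have "(\<forall>j. f i' j < f i j) \<and> f i' \<in> grid (M * L) \<longleftrightarrow> x i' \<prec> x i" if i': "i' \<in> J" for i'
    proof
      assume "(\<forall>j. f i' j < f i j) \<and> f i' \<in> grid (M * L)"
      then show "x i' \<prec> x i"
        using idx_less_imp_less upos by (force simp: f_def sdom_def)
    next
      assume less: "x i' \<prec> x i"
      have "f i' j \<le> f i j" for j
        using less upos[of j] unfolding f_def by (intro idx_mono) (auto simp: sdom_def less_imp_le)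
      then have "f i' \<in> grid (M * L)"
        using i by (auto simp: grid_def intro: le_less_trans)
      then show "(\<forall>j. f i' j < f i j) \<and> f i' \<in> grid (M * L)"
        using sep[of i i'] i i' less by (auto simp: f_def sdom_def)
    qed
    then show ?thesis unfolding occ by blast
  qed
  have "{m \<in> occ. (\<forall>j. L < m j) \<and> (\<forall>m'\<in>occ. \<not> (\<forall>j. m' j < m j))} = f ` ?R"
  proof (intro equalityI subsetI)
    fix m assume m: "m \<in> {m \<in> occ. (\<forall>j. L < m j) \<and> (\<forall>m'\<in>occ. \<not> (\<forall>j. m' j < m j))}"
    then obtain i where i: "i \<in> J" "m = f i" "f i \<in> grid (M * L)"
      unfolding occ by auto
    have "\<forall>m'\<in>occ. \<not> (\<forall>j. m' j < f i j)" "\<forall>j. L < f i j" using m i(2) by simp_all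
    then have "i \<in> ?R" using corner_iff[OF i(1,3)] min_iff[OF i(1,3)] i by simp
    then show "m \<in> f ` ?R" using i(2) by blast
  next
    fix m assume "m \<in> f ` ?R"
    then obtain i where i: "i \<in> J" "f i \<in> grid (M * L)" "u \<prec> x i" "\<forall>i'\<in>J. \<not> x i' \<prec> x i" and m: "m = f i"
      by blast
    have "m \<in> occ" unfolding occ m using i by blast
    then show "m \<in> {m \<in> occ. (\<forall>j. L < m j) \<and> (\<forall>m'\<in>occ. \<not> (\<forall>j. m' j < m j))}"
      using corner_iff[OF i(1,2)] min_iff[OF i(1,2)] i m by blast
  qed
  moreover have "inj_on f ?R"
    using inj by (auto simp: inj_on_def f_def)
  ultimately show ?thesis
    unfolding grid_count_def f_def[symmetric] by (simp only: card_image)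
qed

section \<open>The Poisson process on a grid\<close>

text \<open>Cells are half open, other sets below are open, closed or mixed; the faces of a box are
  null sets, so one squeeze between the open and the closed box covers every variant.\<close>

lemma measure_eq_prod_of_box:
  fixes l r :: "real ^ 'd"
  assumes "box l r \<subseteq> X" "X \<subseteq> cbox l r" "X \<in> sets borel" "\<And>j. l $ j \<le> r $ j"
  shows "measure lborel X = (\<Prod>j\<in>UNIV. r $ j - l $ j)"
proof -
  have "measure lborel (cbox l r) = (\<Prod>j\<in>UNIV. r $ j - l $ j)"
    using assms(4) by (subst content_cbox_cart) (auto simp: interval_ne_empty_cart)
  moreover have "measure lborel (box l r) = measure lborel (cbox l r)"
    by (simp add: measure_lborel_box_eq measure_lborel_cbox_eq)
  moreover have "measure lborel (box l r) \<le> measure lborel X"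
    using assms by (intro measure_mono_fmeasurable fmeasurableI2[OF fmeasurable_cbox[of l r]]) auto
  moreover have "measure lborel X \<le> measure lborel (cbox l r)"
    using assms by (intro measure_mono_fmeasurable) auto
  ultimately show ?thesis by simp
qed

lemma idx_measurable [measurable]: "(\<lambda>x. idx L u x j) \<in> measurable borel (count_space UNIV)"
  unfolding idx_def by measurable

lemma sets_cell [measurable, simp]: "cell L u m \<in> sets borel"
proof -
  have "cell L u m = {x \<in> space borel. (\<forall>j. 0 < x $ j) \<and> (\<forall>j. idx L u x j = m j)}"
    by (auto simp: cell_def)
  then show ?thesis by simp
qed

context
  fixes L :: nat and u :: "real ^ 'd" and m :: "'d \<Rightarrow> nat"
  assumes L: "0 < L" and upos: "\<And>j. 0 < u $ j"
begin

lemma cell_subset_cbox: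
  "cell L u m \<subseteq> cbox (\<chi> j. real (m j) * u $ j / real L) (\<chi> j. (real (m j) + 1) * u $ j / real L)"
  using idx_eq_iff[OF upos _ L] by (force simp: cell_def mem_box_cart intro: less_imp_le)

lemma box_subset_cell:
  "box (\<chi> j. real (m j) * u $ j / real L) (\<chi> j. (real (m j) + 1) * u $ j / real L) \<subseteq> cell L u m"
proof
  fix x assume x: "x \<in> box (\<chi> j. real (m j) * u $ j / real L) (\<chi> j. (real (m j) + 1) * u $ j / real L)"
  have "0 < x $ j" for j
  proof -
    have "0 \<le> real (m j) * u $ j / real L" using L upos[of j] by simp
    also have "\<dots> < x $ j" using x by (simp add: mem_box_cart)
    finally show ?thesis .
  qed
  then show "x \<in> cell L u m"
    using x idx_eq_iff[OF upos _ L] by (auto simp: cell_def mem_box_cart fun_eq_iff less_imp_le)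
qed

lemma bounded_cell: "bounded (cell L u m)"
  using cell_subset_cbox bounded_cbox bounded_subset by blast

lemma prod_cell_sides:
  "(\<Prod>j\<in>UNIV. (\<chi> j. (real (m j) + 1) * u $ j / real L) $ j - (\<chi> j. real (m j) * u $ j / real L) $ j)
    = (\<Prod>j\<in>UNIV. u $ j) / real L ^ CARD('d)"
  by (simp add: prod_dividef flip: diff_divide_distrib left_diff_distrib)

lemma measure_cell: "measure lborel (cell L u m) = (\<Prod>j\<in>UNIV. u $ j) / real L ^ CARD('d)"
proof -
  have "(\<chi> j. real (m j) * u $ j / real L) $ j \<le> (\<chi> j. (real (m j) + 1) * u $ j / real L) $ j" for j
    using L upos[of j] by (simp add: divide_right_mono)
  from measure_eq_prod_of_box[OF box_subset_cell cell_subset_cbox sets_cell this]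
  show ?thesis by (simp only: prod_cell_sides)
qed

end

lemma disjoint_cells: "disjoint_family_on (cell L u) T"
  by (auto simp: disjoint_family_on_def cell_def)

lemma measure_Union_cells:
  fixes u :: "real ^ 'd"
  assumes "0 < L" "\<And>j. 0 < u $ j" "finite T"
  shows "measure lborel (\<Union>m\<in>T. cell L u m) = real (card T) * ((\<Prod>j\<in>UNIV. u $ j) / real L ^ CARD('d))"
proof -
  have "cell L u m \<in> fmeasurable lborel" for m
    using fmeasurableI2[OF fmeasurable_cbox cell_subset_cbox[OF assms(1,2)]] by simp
  then have "measure lborel (\<Union>m\<in>T. cell L u m) = (\<Sum>m\<in>T. measure lborel (cell L u m))"
    using assms disjoint_cells[of L u T]
    by (intro measure_UNION') (auto simp: disjoint_family_on_def pairwise_def disjnt_def)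
  also have "\<dots> = real (card T) * ((\<Prod>j\<in>UNIV. u $ j) / real L ^ CARD('d))"
    using assms by (simp add: measure_cell)
  finally show ?thesis .
qed

text \<open>Moebius inversion on the subsets of \<open>G\<close>. If \<open>v C\<close> is the
  probability that a random subset of \<open>G\<close> misses \<open>C\<close>, then
  \<open>v (G - T)\<close> is the probability that it is contained in \<open>T\<close>, the inner
  sum is the probability that it equals \<open>C\<close>, and the total is the probability that it
  belongs to \<open>F\<close>. With \<open>v\<close> left abstract, the same formula serves the
  Poisson process and the sample.\<close>

definition void_sum :: "'i set \<Rightarrow> 'i set set \<Rightarrow> ('i set \<Rightarrow> real) \<Rightarrow> real"
  where "void_sum G F v = (\<Sum>C\<in>F. \<Sum>T\<in>Pow C. (- 1) ^ (card C - card T) * v (G - T))"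

lemma (in finite_measure) measure_random_subset:
  assumes "finite G" "F \<subseteq> Pow G"
    and occ: "\<And>\<omega>. \<omega> \<in> space M \<Longrightarrow> occ \<omega> \<subseteq> G"
    and meas: "\<And>m. m \<in> G \<Longrightarrow> {\<omega> \<in> space M. m \<in> occ \<omega>} \<in> sets M"
  shows "measure M {\<omega> \<in> space M. occ \<omega> \<in> F} =
    void_sum G F (\<lambda>C. measure M {\<omega> \<in> space M. occ \<omega> \<inter> C = {}})"
proof -
  have meas_eq: "{\<omega> \<in> space M. occ \<omega> = C} \<in> sets M" if "C \<subseteq> G" for C
  proof -
    have "{\<omega> \<in> space M. occ \<omega> = C} = {\<omega> \<in> space M. \<forall>m\<in>G. (\<omega> \<in> {\<omega> \<in> space M. m \<in> occ \<omega>}) = (m \<in> C)}"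
      using occ that by blast
    also have "\<dots> \<in> sets M"
      using assms(1) meas by (intro sets.sets_Collect_finite_All) (auto intro!: sets.sets_Collect)
    finally show ?thesis .
  qed
  \<comment> \<open>The value \<open>0\<close> outside \<open>Pow G\<close> makes \<open>g C\<close>
    the sum of \<open>f\<close> over \<open>Pow C\<close> for every finite \<open>C\<close>, as the
    inversion theorem demands, and not only for subsets of \<open>G\<close>.\<close>
  define f where "f C = (if C \<subseteq> G then measure M {\<omega> \<in> space M. occ \<omega> = C} else 0)" for C
  define g where "g C = measure M {\<omega> \<in> space M. occ \<omega> \<subseteq> C}" for C
  have decomp: "measure M {\<omega> \<in> space M. occ \<omega> \<in> F'} = (\<Sum>C\<in>F'. measure M {\<omega> \<in> space M. occ \<omega> = C})"
    if "F' \<subseteq> Pow G" for F'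
  proof -
    have "measure M {\<omega> \<in> space M. occ \<omega> \<in> F'} = measure M (\<Union>C\<in>F'. {\<omega> \<in> space M. occ \<omega> = C})"
      by (rule arg_cong[where f="measure M"]) auto
    also have "\<dots> = (\<Sum>C\<in>F'. measure M {\<omega> \<in> space M. occ \<omega> = C})"
      using that meas_eq finite_subset[OF that] assms(1)
      by (intro finite_measure_finite_Union) (auto simp: disjoint_family_on_def)
    finally show ?thesis .
  qed
  have "g C = sum f (Pow C)" if "finite C" for C
  proof -
    have "g C = measure M {\<omega> \<in> space M. occ \<omega> \<in> Pow (C \<inter> G)}"
      unfolding g_def using occ by (intro arg_cong[where f="measure M"]) auto
    also have "\<dots> = (\<Sum>C\<in>Pow (C \<inter> G). f C)"
      by (subst decomp) (auto simp: f_def intro!: sum.cong)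
    also have "\<dots> = sum f (Pow C)"
      using that by (intro sum.mono_neutral_left) (auto simp: f_def)
    finally show ?thesis .
  qed
  from inclusion_exclusion_mobius[of g f, OF this]
  have mob: "f C = (\<Sum>T\<in>Pow C. (- 1) ^ (card C - card T) * g T)" if "finite C" for C
    using that by simp
  have "measure M {\<omega> \<in> space M. occ \<omega> \<in> F} = (\<Sum>C\<in>F. f C)"
    using assms(2) by (subst decomp) (auto simp: f_def intro!: sum.cong)
  also have "\<dots> = (\<Sum>C\<in>F. \<Sum>T\<in>Pow C. (- 1) ^ (card C - card T) *
      measure M {\<omega> \<in> space M. occ \<omega> \<inter> (G - T) = {}})"
  proof (intro sum.cong refl)
    fix C assume "C \<in> F"
    then have C: "C \<subseteq> G" using assms by blast
    then have fin: "finite C" using assms(1) finite_subset by blast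
    have "g T = measure M {\<omega> \<in> space M. occ \<omega> \<inter> (G - T) = {}}" if "T \<in> Pow C" for T
      unfolding g_def using occ by (intro arg_cong[where f="measure M"]) blast
    then show "f C = (\<Sum>T\<in>Pow C. (- 1) ^ (card C - card T) *
        measure M {\<omega> \<in> space M. occ \<omega> \<inter> (G - T) = {}})"
      by (subst mob[OF fin]) (auto intro!: sum.cong)
  qed
  finally show ?thesis by (simp add: void_sum_def)
qed

text \<open>The events need not be monotone in \<open>n\<close>; since each point settles its
  membership from some time on, \<open>E0\<close> is their lower limit, and dominated convergence
  applies to the indicators. Measurability of \<open>E0\<close> is part of the result: events about
  minima acquire it only as limits of grid events.\<close>

lemma (in finite_measure) measure_tendsto_eventually:
  assumes E: "\<And>n. E n \<in> sets M" and "E0 \<subseteq> space M"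
    and ev: "\<And>\<omega>. \<omega> \<in> space M \<Longrightarrow> eventually (\<lambda>n. \<omega> \<in> E n \<longleftrightarrow> \<omega> \<in> E0) sequentially"
  shows "E0 \<in> sets M" and "(\<lambda>n. measure M (E n)) \<longlonglongrightarrow> measure M E0"
proof -
  have "E0 = (\<Union>N. \<Inter>n\<in>{N..}. E n)"
  proof (intro equalityI subsetI)
    fix \<omega> assume "\<omega> \<in> E0"
    then show "\<omega> \<in> (\<Union>N. \<Inter>n\<in>{N..}. E n)"
      using ev[of \<omega>] assms(2) by (auto simp: eventually_sequentially)
  next
    fix \<omega> assume "\<omega> \<in> (\<Union>N. \<Inter>n\<in>{N..}. E n)"
    then obtain N where N: "\<And>n. n \<ge> N \<Longrightarrow> \<omega> \<in> E n" by auto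
    then have "\<omega> \<in> space M" using sets.sets_into_space[OF E] by blast
    from ev[OF this] obtain N' where "\<And>n. n \<ge> N' \<Longrightarrow> \<omega> \<in> E n \<longleftrightarrow> \<omega> \<in> E0"
      by (auto simp: eventually_sequentially)
    then show "\<omega> \<in> E0" using N[of "max N N'"] by simp
  qed
  also have "\<dots> \<in> sets M"
    using E by (intro sets.countable_UN sets.countable_INT image_subsetI) auto
  finally show E0: "E0 \<in> sets M" .
  have "(\<lambda>n. integral\<^sup>L M (\<lambda>\<omega>. indicator (E n) \<omega> :: real)) \<longlonglongrightarrow> integral\<^sup>L M (\<lambda>\<omega>. indicator E0 \<omega>)"
  proof (rule integral_dominated_convergence[where w="\<lambda>_. 1"])
    show "AE \<omega> in M. (\<lambda>n. indicator (E n) \<omega> :: real) \<longlonglongrightarrow> indicator E0 \<omega>"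
    proof (rule AE_I2)
      fix \<omega> assume "\<omega> \<in> space M"
      from ev[OF this] show "(\<lambda>n. indicator (E n) \<omega> :: real) \<longlonglongrightarrow> indicator E0 \<omega>"
        by (intro tendsto_eventually) (auto elim!: eventually_mono simp: indicator_def)
    qed
  qed (use E E0 in \<open>auto simp: indicator_def\<close>)
  then show "(\<lambda>n. measure M (E n)) \<longlonglongrightarrow> measure M E0"
    using E E0 sets.sets_into_space[OF E] sets.sets_into_space[OF E0]
    by (simp add: Int_absorb2)
qed

section \<open>Meshes fine enough for a given configuration\<close>

lemma eventually_idx_less:
  assumes "z $ j < y $ j" "0 < u $ j" "0 < z $ j"
  shows "eventually (\<lambda>L. idx L u z j < idx L u y j) sequentially"
proof -
  have "eventually (\<lambda>L. u $ j / (y $ j - z $ j) \<le> real L) sequentially"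
    using filterlim_real_sequentially filterlim_at_top by blast
  then show ?thesis
  proof eventually_elim
    case (elim L)
    then have "u $ j \<le> real L * (y $ j - z $ j)"
      using assms by (simp add: field_simps)
    then have "1 \<le> real L * (y $ j - z $ j) / u $ j"
      using assms by simp
    then have "1 + real L * (z $ j / u $ j) \<le> real L * (y $ j / u $ j)"
      by (simp add: algebra_simps diff_divide_distrib)
    then have "1 + \<lfloor>real L * (z $ j / u $ j)\<rfloor> \<le> \<lfloor>real L * (y $ j / u $ j)\<rfloor>"
      by linarith
    \<comment> \<open>With the lower floor nonnegative, \<open>nat\<close> does not merge the two
      indices.\<close>
    moreover have "0 \<le> \<lfloor>real L * (z $ j / u $ j)\<rfloor>"
      using assms by simp
    ultimately show ?case unfolding idx_def by linarith
  qed
qed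

text \<open>The window contains finitely many points, so only finitely many gaps between unequal
  coordinates have to exceed the mesh. The corner takes part in the comparison as a lower point;
  this gives every coordinate above it an index above \<open>L\<close>.\<close>

lemma eventually_grid_count:
  fixes X :: "(real ^ 'd) set" and u :: "real ^ 'd"
  assumes upos: "\<And>j. 0 < u $ j" and X: "\<And>x j. x \<in> X \<Longrightarrow> 0 < x $ j"
    and fin: "finite {x \<in> X. \<forall>j. x $ j < real M * u $ j}"
  shows "eventually (\<lambda>L. grid_count L (occupied L u (M * L) X) =
    card {y \<in> X. (\<forall>j. y $ j < real M * u $ j) \<and> u \<prec> y \<and> (\<forall>z\<in>X. \<not> z \<prec> y)}) sequentially"
proof -
  define Y where "Y = {x \<in> X. \<forall>j. x $ j < real M * u $ j}"
  have "eventually (\<lambda>L. \<forall>y\<in>Y. \<forall>z\<in>insert u Y. \<forall>j. z $ j < y $ j \<longrightarrow> idx L u z j < idx L u y j) sequentially"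
  proof (intro eventually_ball_finite ballI eventually_all_finite)
    fix y z j assume *: "y \<in> Y" "z \<in> insert u Y"
    show "eventually (\<lambda>L. z $ j < y $ j \<longrightarrow> idx L u z j < idx L u y j) sequentially"
    proof (cases "z $ j < y $ j")
      case True
      moreover have "0 < z $ j" using * X upos by (auto simp: Y_def)
      ultimately show ?thesis using eventually_idx_less[OF True upos] by simp
    qed simp
  qed (use fin in \<open>simp_all add: Y_def\<close>)
  then show ?thesis using eventually_gt_at_top[of 0]
  proof eventually_elim
    case (elim L)
    have inY: "idx L u x \<in> grid (M * L) \<longleftrightarrow> x \<in> Y" if "x \<in> X" for x
      using idx_in_grid_iff[of u x L M] upos X that elim by (simp add: Y_def)
    have "grid_count L (occupied L u (M * L) ((\<lambda>x. x) ` X)) =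
      card {i \<in> X. idx L u i \<in> grid (M * L) \<and> u \<prec> i \<and> (\<forall>i'\<in>X. \<not> i' \<prec> i)}"
    proof (rule grid_count_eq_card)
      show "inj_on (\<lambda>i. idx L u i) {i \<in> X. idx L u i \<in> grid (M * L)}"
      proof (rule inj_onI)
        fix x y assume "x \<in> {i \<in> X. idx L u i \<in> grid (M * L)}" "y \<in> {i \<in> X. idx L u i \<in> grid (M * L)}"
          and eq: "idx L u x = idx L u y"
        then have "x \<in> Y" "y \<in> Y" using inY[of x] inY[of y] by simp_all
        then have "\<not> x $ j < y $ j" "\<not> y $ j < x $ j" for j
          using elim(1) eq by (metis insertCI less_irrefl)+
        then show "x = y" by (simp add: vec_eq_iff antisym_conv3)
      qed
    next
      fix i j assume "i \<in> X" "idx L u i \<in> grid (M * L)" "u $ j < i $ j"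
      then have "idx L u u j < idx L u i j" using elim(1) inY by blast
      moreover have "idx L u u j = L" using upos[of j] by (simp add: idx_def)
      ultimately show "L < idx L u i j" by simp
    qed (use elim upos X inY in auto)
    also have "{i \<in> X. idx L u i \<in> grid (M * L) \<and> u \<prec> i \<and> (\<forall>i'\<in>X. \<not> i' \<prec> i)} =
      {y \<in> X. (\<forall>j. y $ j < real M * u $ j) \<and> u \<prec> y \<and> (\<forall>z\<in>X. \<not> z \<prec> y)}"
      using inY by (auto simp: Y_def)
    finally show ?case by simp
  qed
qed

text \<open>Removing \<open>grid L\<close> encodes the record condition: those cells make up the box below the corner.\<close>

definition pattern :: "nat \<Rightarrow> nat \<Rightarrow> nat set \<Rightarrow> ('d \<Rightarrow> nat) set set"
  where "pattern M L A = {C. C \<subseteq> grid (M * L) - grid L \<and> grid_count L C \<in> A}"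

text \<open>\<open>exp (- w)\<close> times a probability for the Poisson process, but written as a formula in which \<open>w\<close>
  is just a parameter: this gives continuity in \<open>w\<close> and the comparison with finite samples.\<close>

definition grid_law :: "('d::finite) itself \<Rightarrow> nat \<Rightarrow> nat \<Rightarrow> nat set \<Rightarrow> real \<Rightarrow> real"
  where "grid_law _ M L A w = void_sum (grid (M * L)) (pattern M L A :: ('d \<Rightarrow> nat) set set)
    (\<lambda>C. exp (- (real (card C) * (w / real L ^ CARD('d)))))"

text \<open>Minimality refers to the whole of \<open>X\<close>; the box only restricts which minima
  are counted.\<close>

definition truncated_minima :: "nat \<Rightarrow> real \<Rightarrow> (real ^ 'd) set \<Rightarrow> (real ^ 'd) set"
  where "truncated_minima M w X =
    {y \<in> minima X. corner w \<prec> y \<and> (\<forall>j. y $ j < real M * corner w $ j)}"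

lemma corner_pos: "0 < w \<Longrightarrow> 0 < corner w $ j"
  by (simp add: corner_def)

lemma prod_corner: "0 < w \<Longrightarrow> (\<Prod>j\<in>UNIV. (corner w :: real ^ 'd) $ j) = w"
  by (simp add: corner_def powr_powr flip: powr_realpow)

text \<open>The boxes exhaust space, so every finite set of dominating minima is eventually
  captured. If there are infinitely many, some \<open>k + 1\<close> of them are captured and the
  truncated count stays above \<open>k\<close>, in agreement with the value
  \<open>\<infinity>\<close>.\<close>

lemma eventually_truncated_minima:
  fixes X :: "(real ^ 'd) set"
  assumes w: "0 < w" and fin: "\<And>B. bounded B \<Longrightarrow> finite (X \<inter> B)"
    and pos: "\<And>x j. x \<in> X \<Longrightarrow> 0 < x $ j"
  shows "eventually (\<lambda>M. card (truncated_minima M w X) = k \<longleftrightarrow> dominating_minima_count w X = enat k) sequentially"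
proof -
  define A where "A = {y \<in> minima X. corner w \<prec> y}"
  have fin_trunc: "finite (truncated_minima M w X)" for M
  proof (rule finite_subset[OF _ fin[OF bounded_cbox[of 0 "\<chi> j. real M * corner w $ j"]]])
    show "truncated_minima M w X \<subseteq> X \<inter> cbox 0 (\<chi> j. real M * corner w $ j)"
      using pos by (auto simp: truncated_minima_def minima_def mem_box_cart less_imp_le)
  qed
  have ev: "eventually (\<lambda>M. B \<subseteq> truncated_minima M w X) sequentially" if B: "finite B" "B \<subseteq> A" for B
  proof -
    have "eventually (\<lambda>M. \<forall>y\<in>B. \<forall>j. y $ j / corner w $ j < real M) sequentially"
    proof (intro eventually_ball_finite B ballI eventually_all_finite)
      fix y :: "real ^ 'd" and j
      show "eventually (\<lambda>M. y $ j / corner w $ j < real M) sequentially"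
        using filterlim_real_sequentially filterlim_at_top_dense by blast
    qed
    then show ?thesis
    proof eventually_elim
      case (elim M)
      then have "y $ j < real M * corner w $ j" if "y \<in> B" for y j
      proof -
        have "y $ j / corner w $ j < real M" using elim that by blast
        then show ?thesis using corner_pos[OF w, of j] by (subst (asm) pos_divide_less_eq)
      qed
      then show ?case using B by (auto simp: truncated_minima_def A_def)
    qed
  qed
  have sub: "truncated_minima M w X \<subseteq> A" for M
    by (auto simp: truncated_minima_def A_def)
  show ?thesis
  proof (cases "finite A")
    case True
    from ev[OF True order_refl] show ?thesis
    proof eventually_elim
      case (elim M)
      then have "truncated_minima M w X = A" using sub by blast
      then show ?case using True by (simp add: dominating_minima_count_def Let_def flip: A_def)
    qed
  next
    case False
    then obtain B where B: "B \<subseteq> A" "finite B" "card B = Suc k"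
      using infinite_arbitrarily_large by blast
    from ev[OF B(2,1)] show ?thesis
    proof eventually_elim
      case (elim M)
      then have "Suc k \<le> card (truncated_minima M w X)"
        using card_mono[OF fin_trunc] B(3) by metis
      then show ?case using False by (simp add: dominating_minima_count_def Let_def flip: A_def)
    qed
  qed
qed

section \<open>The Poisson process for a fixed \<open>w\<close>\<close>

context
  fixes Q :: "'b measure" and S :: "'b \<Rightarrow> (real ^ 'd) set" and w :: real
  assumes w: "0 < w" and pp: "unit_poisson_process Q (corner_region w) S"
begin

interpretation Q: prob_space Q
  using pp by (simp add: unit_poisson_process_def)

lemma pp_subset: "\<omega> \<in> space Q \<Longrightarrow> S \<omega> \<subseteq> corner_region w"
  using pp by (simp add: unit_poisson_process_def)

lemma pp_pos: "\<lbrakk>\<omega> \<in> space Q; x \<in> S \<omega>\<rbrakk> \<Longrightarrow> 0 < x $ j"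
  using pp_subset by (auto simp: corner_region_def)

lemma pp_finite: "\<lbrakk>\<omega> \<in> space Q; bounded B\<rbrakk> \<Longrightarrow> finite (S \<omega> \<inter> B)"
  using pp by (simp add: unit_poisson_process_def)

lemma pp_void:
  assumes "B \<in> sets borel" "bounded B" "B \<subseteq> corner_region w"
  shows "{\<omega> \<in> space Q. S \<omega> \<inter> B = {}} \<in> sets Q"
    and "measure Q {\<omega> \<in> space Q. S \<omega> \<inter> B = {}} = exp (- measure lborel B)"
proof -
  \<comment> \<open>Local finiteness matters here: \<open>card\<close> would also be
    \<open>0\<close> on an infinite intersection.\<close>
  have eq: "{\<omega> \<in> space Q. S \<omega> \<inter> B = {}} = {\<omega> \<in> space Q. card (S \<omega> \<inter> B) = 0}"
    using pp_finite assms by auto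
  have meas: "(\<lambda>\<omega>. card (S \<omega> \<inter> B)) \<in> measurable Q (count_space UNIV)"
    and law: "measure Q {\<omega>\<in>space Q. card (S \<omega> \<inter> B) = 0} =
          measure lborel B ^ 0 / fact 0 * exp (- measure lborel B)"
    using pp assms unfolding unit_poisson_process_def by blast+
  show "{\<omega> \<in> space Q. S \<omega> \<inter> B = {}} \<in> sets Q"
    unfolding eq using meas by measurable
  show "measure Q {\<omega> \<in> space Q. S \<omega> \<inter> B = {}} = exp (- measure lborel B)"
    unfolding eq using law by simp
qed

lemma pp_cell_subset:
  assumes "0 < L" "m \<notin> grid L"
  shows "cell L (corner w) m \<subseteq> corner_region w"
  using assms sdom_iff_idx[OF corner_pos[OF w] _ assms(1)] by (auto simp: cell_def corner_region_def)

lemma pp_occupied_low: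
  assumes "0 < L" "\<omega> \<in> space Q"
  shows "occupied L (corner w) N (S \<omega>) \<inter> grid L = {}"
  using assms sdom_iff_idx[OF corner_pos[OF w] _ assms(1)] pp_subset[OF assms(2)]
  by (fastforce simp: occupied_def cell_def corner_region_def)

lemma pp_occupied_void:
  assumes "0 < L" "T \<subseteq> grid N - grid L"
  shows "{\<omega> \<in> space Q. occupied L (corner w) N (S \<omega>) \<inter> T = {}} \<in> sets Q"
    and "measure Q {\<omega> \<in> space Q. occupied L (corner w) N (S \<omega>) \<inter> T = {}} =
      exp (- (real (card T) * (w / real L ^ CARD('d))))"
proof -
  have fin: "finite T" using finite_subset[OF assms(2)] by simp
  have eq: "{\<omega> \<in> space Q. occupied L (corner w) N (S \<omega>) \<inter> T = {}} =
      {\<omega> \<in> space Q. S \<omega> \<inter> (\<Union>m\<in>T. cell L (corner w) m) = {}}"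
    using assms(2) by (auto simp: occupied_def)
  have B: "(\<Union>m\<in>T. cell L (corner w) m) \<in> sets borel" "bounded (\<Union>m\<in>T. cell L (corner w) m)"
      "(\<Union>m\<in>T. cell L (corner w) m) \<subseteq> corner_region w"
    using fin assms pp_cell_subset bounded_cell[OF assms(1) corner_pos[OF w]] by (auto intro!: bounded_UN)
  show "{\<omega> \<in> space Q. occupied L (corner w) N (S \<omega>) \<inter> T = {}} \<in> sets Q"
    unfolding eq by (rule pp_void[OF B])
  show "measure Q {\<omega> \<in> space Q. occupied L (corner w) N (S \<omega>) \<inter> T = {}} =
      exp (- (real (card T) * (w / real L ^ CARD('d))))"
    unfolding eq pp_void[OF B] measure_Union_cells[OF assms(1) corner_pos[OF w] fin] prod_corner[OF w] by simp
qed

lemma pp_occupied_measurable: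
  assumes "0 < L"
  shows "{\<omega> \<in> space Q. m \<in> occupied L (corner w) N (S \<omega>)} \<in> sets Q"
proof (cases "m \<in> grid N - grid L")
  case True
  then have "{\<omega> \<in> space Q. m \<in> occupied L (corner w) N (S \<omega>)} =
      space Q - {\<omega> \<in> space Q. occupied L (corner w) N (S \<omega>) \<inter> {m} = {}}" by auto
  then show ?thesis using pp_occupied_void(1)[OF assms, of "{m}" N] True by simp
next
  case False
  then have "{\<omega> \<in> space Q. m \<in> occupied L (corner w) N (S \<omega>)} = {}"
    using pp_occupied_low[OF assms] by (auto simp: occupied_def)
  then show ?thesis by (metis sets.empty_sets)
qed

text \<open>The factor \<open>exp (- w)\<close> is the void probability of the box below the corner,
  where the process is not defined. Multiplying by it turns the void probabilities outside the box
  into those of a process on the whole orthant that is required to leave the box empty, and this is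
  what the formula \<open>grid_law\<close> expresses.\<close>

lemma pp_grid_law:
  assumes L: "0 < L" and M: "0 < M"
  shows "exp (- w) * measure Q {\<omega> \<in> space Q. grid_count L (occupied L (corner w) (M * L) (S \<omega>)) \<in> A} =
      grid_law TYPE('d) M L A w"
    and "{\<omega> \<in> space Q. grid_count L (occupied L (corner w) (M * L) (S \<omega>)) \<in> A} \<in> sets Q"
proof -
  let ?G = "grid (M * L) :: ('d \<Rightarrow> nat) set"
  let ?occ = "\<lambda>\<omega>. occupied L (corner w) (M * L) (S \<omega>)"
  have sub: "grid L \<subseteq> ?G" using M by (intro grid_mono) simp
  have occ: "?occ \<omega> \<subseteq> ?G - grid L" if "\<omega> \<in> space Q" for \<omega>
    using pp_occupied_low[OF L that, of "M * L"] by (auto simp: occupied_def)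
  have eq: "{\<omega> \<in> space Q. grid_count L (?occ \<omega>) \<in> A} = {\<omega> \<in> space Q. ?occ \<omega> \<in> pattern M L A}"
    using occ by (auto simp: pattern_def)
  have "{\<omega> \<in> space Q. ?occ \<omega> = C} \<in> sets Q" for C
  proof (cases "C \<subseteq> ?G")
    case True
    have "{\<omega> \<in> space Q. ?occ \<omega> = C} =
      {\<omega> \<in> space Q. \<forall>m\<in>?G. (\<omega> \<in> {\<omega> \<in> space Q. m \<in> ?occ \<omega>}) = (m \<in> C)}"
      using occ True by blast
    also have "\<dots> \<in> sets Q"
      using pp_occupied_measurable[OF L]
      by (intro sets.sets_Collect_finite_All) (auto intro!: sets.sets_Collect)
    finally show ?thesis .
  next
    case False
    then have "{\<omega> \<in> space Q. ?occ \<omega> = C} = {}" using occ by blast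
    then show ?thesis by (metis sets.empty_sets)
  qed
  moreover have "finite (pattern M L A :: ('d \<Rightarrow> nat) set set)"
    by (rule finite_subset[of _ "Pow ?G"]) (auto simp: pattern_def)
  ultimately have "(\<Union>C\<in>pattern M L A. {\<omega> \<in> space Q. ?occ \<omega> = C}) \<in> sets Q"
    by (intro sets.finite_UN) auto
  also have "(\<Union>C\<in>pattern M L A. {\<omega> \<in> space Q. ?occ \<omega> = C}) = {\<omega> \<in> space Q. grid_count L (?occ \<omega>) \<in> A}"
    unfolding eq by auto
  finally show "{\<omega> \<in> space Q. grid_count L (?occ \<omega>) \<in> A} \<in> sets Q" .
  have "measure Q {\<omega> \<in> space Q. ?occ \<omega> \<in> pattern M L A} =
      void_sum ?G (pattern M L A) (\<lambda>C. measure Q {\<omega> \<in> space Q. ?occ \<omega> \<inter> C = {}})"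
    using pp_occupied_measurable[OF L] occ
    by (intro Q.measure_random_subset) (auto simp: pattern_def)
  also have "exp (- w) * \<dots> = grid_law TYPE('d) M L A w"
    unfolding grid_law_def void_sum_def sum_distrib_left
  proof (intro sum.cong refl)
    fix C T :: "('d \<Rightarrow> nat) set" assume C: "C \<in> pattern M L A" "T \<in> Pow C"
    have "{\<omega> \<in> space Q. ?occ \<omega> \<inter> (?G - T) = {}} = {\<omega> \<in> space Q. ?occ \<omega> \<inter> (?G - grid L - T) = {}}"
      using occ by blast
    then have meas: "measure Q {\<omega> \<in> space Q. ?occ \<omega> \<inter> (?G - T) = {}} =
        exp (- (real (card (?G - grid L - T)) * (w / real L ^ CARD('d))))"
      using pp_occupied_void(2)[OF L, of "?G - grid L - T" "M * L"] by auto
    \<comment> \<open>A pattern contains no cell of \<open>grid L\<close>, hence neither does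
      \<open>T\<close>, and \<open>?G - T\<close> contains all of \<open>grid L\<close>. These
      \<open>L ^ d\<close> cells have total volume \<open>w\<close>, which supplies the factor
      \<open>exp (- w)\<close>.\<close>
    have "?G - T = (?G - grid L - T) \<union> grid L"
      using C sub by (auto simp: pattern_def)
    then have "card (?G - T) = card ((?G - grid L - T) \<union> grid L)"
      by (rule arg_cong)
    also have "\<dots> = card (?G - grid L - T) + L ^ CARD('d)"
      by (subst card_Un_disjoint) (auto simp: card_grid)
    finally have "card (?G - T) = card (?G - grid L - T) + L ^ CARD('d)" .
    then have "- w + - (real (card (?G - grid L - T)) * (w / real L ^ CARD('d))) =
        - (real (card (?G - T)) * (w / real L ^ CARD('d)))"
      using L by (simp add: field_simps)
    then show "exp (- w) * ((- 1) ^ (card C - card T) * measure Q {\<omega> \<in> space Q. ?occ \<omega> \<inter> (?G - T) = {}}) =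
        (- 1) ^ (card C - card T) * exp (- (real (card (?G - T)) * (w / real L ^ CARD('d))))"
      unfolding meas by (simp add: exp_add mult_ac flip: exp_add)
  qed
  finally show "exp (- w) * measure Q {\<omega> \<in> space Q. grid_count L (?occ \<omega>) \<in> A} =
      grid_law TYPE('d) M L A w" unfolding eq .
qed

text \<open>How fine the mesh has to be depends on \<open>\<omega>\<close>, so grid count and
  truncated count agree only eventually at each point; the probabilities converge by bounded
  convergence. The events are indexed by \<open>Suc L\<close> because a mesh parameter must be
  positive.\<close>

lemma pp_truncated:
  assumes M: "0 < M"
  shows "{\<omega> \<in> space Q. card (truncated_minima M w (S \<omega>)) = k} \<in> sets Q"
    and "(\<lambda>L. grid_law TYPE('d) M L {k} w) \<longlonglongrightarrow>
      exp (- w) * measure Q {\<omega> \<in> space Q. card (truncated_minima M w (S \<omega>)) = k}"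
proof -
  define E where "E L = {\<omega> \<in> space Q. grid_count (Suc L) (occupied (Suc L) (corner w) (M * Suc L) (S \<omega>)) \<in> {k}}" for L
  let ?E0 = "{\<omega> \<in> space Q. card (truncated_minima M w (S \<omega>)) = k}"
  have ev: "eventually (\<lambda>L. \<omega> \<in> E L \<longleftrightarrow> \<omega> \<in> ?E0) sequentially" if \<omega>: "\<omega> \<in> space Q" for \<omega>
  proof -
    have "finite (S \<omega> \<inter> cbox 0 (\<chi> j. real M * corner w $ j))"
      by (intro pp_finite \<omega> bounded_cbox)
    then have "finite {x \<in> S \<omega>. \<forall>j. x $ j < real M * corner w $ j}"
      using pp_pos[OF \<omega>] by (elim finite_subset[rotated]) (auto simp: mem_box_cart less_imp_le)
    from eventually_grid_count[OF corner_pos[OF w] pp_pos[OF \<omega>] this]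
    have "eventually (\<lambda>L. grid_count L (occupied L (corner w) (M * L) (S \<omega>)) = card (truncated_minima M w (S \<omega>))) sequentially"
      by (rule eventually_mono) (auto simp: truncated_minima_def minima_def intro!: arg_cong[where f=card])
    then have "eventually (\<lambda>L. grid_count (Suc L) (occupied (Suc L) (corner w) (M * Suc L) (S \<omega>)) = card (truncated_minima M w (S \<omega>))) sequentially"
      by (rule eventually_compose_filterlim[OF _ filterlim_Suc])
    then show ?thesis
      by eventually_elim (use \<omega> in \<open>auto simp: E_def\<close>)
  qed
  have E: "E L \<in> sets Q" for L unfolding E_def by (intro pp_grid_law M) simp
  show "?E0 \<in> sets Q"
    by (rule Q.measure_tendsto_eventually[OF E _ ev]) auto
  have "(\<lambda>L. exp (- w) * measure Q (E L)) \<longlonglongrightarrow> exp (- w) * measure Q ?E0"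
    by (intro tendsto_mult tendsto_const Q.measure_tendsto_eventually[OF E _ ev]) auto
  then have "(\<lambda>L. grid_law TYPE('d) M (Suc L) {k} w) \<longlonglongrightarrow> exp (- w) * measure Q ?E0"
    unfolding E_def pp_grid_law(1)[OF zero_less_Suc M] .
  then show "(\<lambda>L. grid_law TYPE('d) M L {k} w) \<longlonglongrightarrow> exp (- w) * measure Q ?E0"
    by (rule LIMSEQ_imp_Suc)
qed

lemma pp_dominating_minima:
  shows "(\<lambda>M. measure Q {\<omega> \<in> space Q. card (truncated_minima (Suc M) w (S \<omega>)) = k}) \<longlonglongrightarrow>
      measure Q {\<omega> \<in> space Q. dominating_minima_count w (S \<omega>) = enat k}"
proof (rule Q.measure_tendsto_eventually(2))
  fix \<omega> assume \<omega>: "\<omega> \<in> space Q"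
  from eventually_truncated_minima[OF w pp_finite[OF \<omega>] pp_pos[OF \<omega>]]
  have "eventually (\<lambda>M. card (truncated_minima (Suc M) w (S \<omega>)) = k \<longleftrightarrow>
      dominating_minima_count w (S \<omega>) = enat k) sequentially"
    by (rule eventually_compose_filterlim[OF _ filterlim_Suc])
  then show "eventually (\<lambda>M. \<omega> \<in> {\<omega> \<in> space Q. card (truncated_minima (Suc M) w (S \<omega>)) = k} \<longleftrightarrow>
      \<omega> \<in> {\<omega> \<in> space Q. dominating_minima_count w (S \<omega>) = enat k}) sequentially"
    by eventually_elim (use \<omega> in auto)
qed (auto intro: pp_truncated(1))

lemma pp_grid_law_UNIV:
  assumes "0 < L" "0 < M"
  shows "grid_law TYPE('d) M L UNIV w = exp (- w)"
  using pp_grid_law(1)[OF assms, of UNIV] by (simp add: Q.prob_space)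

end

section \<open>A uniform sample seen from a fixed corner\<close>

text \<open>A factor \<open>c + 1\<close> adds at least \<open>c\<close> to a product that is at
  least \<open>1\<close>. The point is to trade a product in an exponent for a sum, after which the
  exponential factorises over the coordinates.\<close>

lemma prod_nat_ge_sum:
  fixes m :: "'i \<Rightarrow> nat"
  assumes "finite I" "\<And>i. i \<in> I \<Longrightarrow> 1 \<le> m i"
  shows "(\<Sum>i\<in>I. m i) \<le> (\<Prod>i\<in>I. m i) + card I"
  using assms
proof (induction I rule: finite_induct)
  case (insert i I)
  obtain c where c: "m i = Suc c" using insert.prems[of i] by (cases "m i") auto
  have "1 \<le> (\<Prod>i\<in>I. m i)" using insert.prems by (intro prod_ge_1) auto
  then have "c \<le> c * (\<Prod>i\<in>I. m i)" using mult_le_mono2[of 1 "\<Prod>i\<in>I. m i" c] by (simp only: mult_1_right)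
  moreover have "(\<Sum>i\<in>I. m i) \<le> (\<Prod>i\<in>I. m i) + card I" using insert by simp
  ultimately show ?case
    unfolding sum.insert[OF insert.hyps] prod.insert[OF insert.hyps] card_insert_disjoint[OF insert.hyps] c mult_Suc
    by linarith
qed simp

text \<open>Once the product is replaced by the sum \<open>s\<close> of the entries, the exponent
  \<open>2 * \<beta> * s\<close> is split in two. One half gives
  \<open>exp (- (\<beta> * M))\<close>, because some entry is at least \<open>M\<close>; the other
  half leaves a product of geometric series, so the bound does not depend on
  \<open>T\<close>.\<close>

lemma sum_exp_prod_le:
  fixes T :: "('d::finite \<Rightarrow> nat) set"
  assumes "finite T" and T: "\<And>m. m \<in> T \<Longrightarrow> (\<forall>j. 1 \<le> m j) \<and> (\<exists>j. M \<le> m j)" and \<beta>: "0 < \<beta>"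
  shows "(\<Sum>m\<in>T. exp (- (2 * \<beta> * real (\<Prod>j\<in>UNIV. m j)))) \<le>
    exp (2 * \<beta> * real CARD('d)) * exp (- (\<beta> * real M)) * (1 / (1 - exp (- \<beta>))) ^ CARD('d)"
proof -
  define q where "q = exp (- \<beta>)"
  have q: "0 < q" "q < 1" using \<beta> by (auto simp: q_def)
  \<comment> \<open>A cube around \<open>T\<close> is a product set, over which the sum of products
    factorises.\<close>
  obtain B where B: "T \<subseteq> PiE UNIV (\<lambda>_. {..<B})"
  proof
    let ?B = "Suc (\<Sum>m\<in>T. \<Sum>j\<in>UNIV. m j)"
    have "m j < ?B" if "m \<in> T" for m j
    proof -
      have "m j \<le> (\<Sum>j\<in>UNIV. m j)" by (intro member_le_sum) auto
      also have "\<dots> \<le> (\<Sum>m\<in>T. \<Sum>j\<in>UNIV. m j)"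
        using assms(1) that by (intro member_le_sum[of m T "\<lambda>m. \<Sum>j\<in>UNIV. m j"]) auto
      finally show ?thesis by simp
    qed
    then show "T \<subseteq> PiE UNIV (\<lambda>_. {..<?B})" by auto
  qed
  have summand: "exp (- (2 * \<beta> * real (\<Prod>j\<in>UNIV. m j))) \<le>
      exp (2 * \<beta> * real CARD('d)) * exp (- (\<beta> * real M)) * (\<Prod>j\<in>UNIV. q ^ m j)" if m: "m \<in> T" for m
  proof -
    define s where "s = (\<Sum>j\<in>UNIV. m j)"
    have "s \<le> (\<Prod>j\<in>UNIV. m j) + CARD('d)"
      unfolding s_def using T[OF m] by (intro prod_nat_ge_sum) auto
    then have "real s \<le> real (\<Prod>j\<in>UNIV. m j) + real CARD('d)"
      by (metis of_nat_add of_nat_le_iff)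
    then have "2 * \<beta> * real s \<le> 2 * \<beta> * (real (\<Prod>j\<in>UNIV. m j) + real CARD('d))"
      using \<beta> by (intro mult_left_mono) auto
    then have 1: "2 * \<beta> * real s \<le> 2 * \<beta> * real (\<Prod>j\<in>UNIV. m j) + 2 * \<beta> * real CARD('d)"
      by (simp only: distrib_left)
    obtain j where "M \<le> m j" using T[OF m] by blast
    also have "\<dots> \<le> s" unfolding s_def by (intro member_le_sum) auto
    finally have 2: "\<beta> * real M \<le> \<beta> * real s" using \<beta> by simp
    have "(\<Prod>j\<in>UNIV. q ^ m j) = q ^ s"
      by (simp add: s_def power_sum)
    also have "\<dots> = exp (- (\<beta> * real s))"
      by (simp add: q_def flip: exp_of_nat_mult)
    finally show ?thesis
      using 1 2 by (simp flip: exp_add)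
  qed
  have "(\<Sum>m\<in>T. \<Prod>j\<in>UNIV. q ^ m j) \<le> (\<Sum>m\<in>PiE (UNIV :: 'd set) (\<lambda>_. {..<B}). \<Prod>j\<in>UNIV. q ^ m j)"
    using B q by (intro sum_mono2 finite_PiE) (auto intro: prod_nonneg)
  also have "\<dots> = (\<Prod>j\<in>(UNIV::'d set). \<Sum>t<B. q ^ t)"
    by (subst prod_sum_PiE) auto
  also have "\<dots> \<le> (1 / (1 - q)) ^ CARD('d)"
  proof -
    have "(\<Sum>t<B. q ^ t) \<le> 1 / (1 - q)"
      using q by (simp add: sum_gp_strict divide_right_mono)
    moreover have "0 \<le> (\<Sum>t<B. q ^ t)" using q by (intro sum_nonneg) auto
    ultimately show ?thesis using power_mono[of "\<Sum>t<B. q ^ t" "1 / (1 - q)" "CARD('d)"] by simp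
  qed
  finally have geo: "(\<Sum>m\<in>T. \<Prod>j\<in>UNIV. q ^ m j) \<le> (1 / (1 - q)) ^ CARD('d)" .
  have "(\<Sum>m\<in>T. exp (- (2 * \<beta> * real (\<Prod>j\<in>UNIV. m j)))) \<le>
      (\<Sum>m\<in>T. exp (2 * \<beta> * real CARD('d)) * exp (- (\<beta> * real M)) * (\<Prod>j\<in>UNIV. q ^ m j))"
    by (intro sum_mono summand)
  also have "\<dots> = exp (2 * \<beta> * real CARD('d)) * exp (- (\<beta> * real M)) * (\<Sum>m\<in>T. \<Prod>j\<in>UNIV. q ^ m j)"
    by (simp add: sum_distrib_left)
  also have "\<dots> \<le> exp (2 * \<beta> * real CARD('d)) * exp (- (\<beta> * real M)) * (1 / (1 - q)) ^ CARD('d)"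
    by (intro mult_left_mono geo) simp
  finally show ?thesis by (simp add: q_def)
qed

text \<open>A mean value estimate for the probability that a cell is hit while the box below it is
  empty, which is a difference of two void probabilities.\<close>

lemma power_diff_le:
  fixes a b :: real
  assumes "0 \<le> b" "b \<le> a"
  shows "a ^ N - b ^ N \<le> real N * (a - b) * a ^ (N - 1)"
proof -
  have "a ^ N - b ^ N = (a - b) * (\<Sum>i<N. b ^ (N - Suc i) * a ^ i)"
    using power_diff_sumr2[of a N b] by simp
  also have "\<dots> \<le> (a - b) * (\<Sum>i<N. a ^ (N - 1))"
  proof (intro mult_left_mono sum_mono)
    fix i assume "i \<in> {..<N}"
    then have "b ^ (N - Suc i) * a ^ i \<le> a ^ (N - Suc i) * a ^ i" "(N - Suc i) + i = N - 1"
      using assms by (auto intro!: mult_right_mono power_mono)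
    then show "b ^ (N - Suc i) * a ^ i \<le> a ^ (N - 1)" by (metis power_add)
  qed (use assms in auto)
  finally show ?thesis by (simp add: mult_ac)
qed

lemma one_minus_power_le_exp:
  fixes x :: real
  assumes "x \<le> 1"
  shows "(1 - x) ^ N \<le> exp (- (x * real N))"
proof -
  have "(1 - x) ^ N \<le> exp (- x) ^ N"
    using assms exp_ge_add_one_self[of "- x"] by (intro power_mono) auto
  then show ?thesis by (simp add: mult.commute flip: exp_of_nat_mult)
qed

text \<open>With \<open>y = x / n\<close> there are two errors: replacing \<open>1 - y\<close> by
  \<open>exp (- y)\<close> costs at most \<open>y^2\<close> in each of the \<open>n - 1\<close>
  factors, and the absent \<open>n\<close>th factor \<open>exp (- y)\<close> costs at most
  \<open>y\<close>.\<close>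

lemma abs_one_minus_power_diff_exp_le:
  fixes x :: real
  assumes "0 \<le> x" "x \<le> real n" "0 < n"
  shows "\<bar>(1 - x / real n) ^ (n - 1) - exp (- x)\<bar> \<le> (x\<^sup>2 + x) / real n"
proof -
  define y where "y = x / real n"
  have y: "0 \<le> y" "y \<le> 1" "x = real n * y" using assms by (auto simp: y_def)
  have e: "0 \<le> exp (- y) - (1 - y)" "exp (- y) - (1 - y) \<le> y\<^sup>2"
  proof -
    show "0 \<le> exp (- y) - (1 - y)" using exp_ge_add_one_self[of "- y"] by simp
    have "1 \<le> exp (y) * (1 - y + y\<^sup>2)"
    proof -
      \<comment> \<open>The right-hand side equals \<open>1 + y^3\<close>.\<close>
      have "1 \<le> (1 + y) * (1 - y + y\<^sup>2)"
        using y by (simp add: algebra_simps power2_eq_square)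
      also have "\<dots> \<le> exp y * (1 - y + y\<^sup>2)"
        using y exp_ge_add_one_self[of y] by (intro mult_right_mono) auto
      finally show ?thesis .
    qed
    then show "exp (- y) - (1 - y) \<le> y\<^sup>2"
      by (simp add: exp_minus field_simps)
  qed
  have "exp (- y) ^ (n - 1) - (1 - y) ^ (n - 1) \<le> real (n - 1) * (exp (- y) - (1 - y)) * exp (- y) ^ (n - 1 - 1)"
    using y e by (intro power_diff_le) auto
  also have "\<dots> \<le> real n * y\<^sup>2 * 1"
    using y e by (intro mult_mono power_le_one) auto
  finally have 1: "exp (- y) ^ (n - 1) - (1 - y) ^ (n - 1) \<le> real n * y\<^sup>2" by simp
  have 2: "0 \<le> exp (- y) ^ (n - 1) - (1 - y) ^ (n - 1)"
    using y e by (simp add: power_mono)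
  have ex: "exp (- x) = exp (- y) ^ (n - 1) * exp (- y)"
  proof -
    have "exp (- x) = exp (- y) ^ n" by (simp add: y(3) flip: exp_of_nat_mult)
    also have "\<dots> = exp (- y) ^ (n - 1) * exp (- y)" using assms(3) by (cases n) (auto simp: mult.commute)
    finally show ?thesis .
  qed
  have 3: "0 \<le> exp (- y) ^ (n - 1) - exp (- x)"
    unfolding ex using y mult_left_le[of "exp (- y)" "exp (- y) ^ (n - 1)"] by simp
  have "exp (- y) ^ (n - 1) - exp (- x) = exp (- y) ^ (n - 1) * (1 - exp (- y))"
    by (simp add: ex algebra_simps)
  also have "\<dots> \<le> 1 * y"
    using y exp_ge_add_one_self[of "- y"] by (intro mult_mono power_le_one) auto
  finally have 4: "exp (- y) ^ (n - 1) - exp (- x) \<le> y" by simp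
  have "\<bar>(1 - y) ^ (n - 1) - exp (- x)\<bar> \<le> real n * y\<^sup>2 + y"
    using 1 2 3 4 by (auto simp: abs_le_iff)
  also have "\<dots> = (x\<^sup>2 + x) / real n"
    using assms(3) by (simp add: y(3) field_simps power2_eq_square)
  finally show ?thesis by (simp add: y_def)
qed

section \<open>The uniform law on the cube\<close>

abbreviation (input) cube_law :: "(real ^ 'd) measure"
  where "cube_law \<equiv> uniform_measure lborel unit_cube"

lemma unit_cube_eq_box: "unit_cube = box 0 1"
  by (auto simp: unit_cube_def mem_box_cart)

lemma sets_unit_cube [measurable, simp]: "unit_cube \<in> sets borel"
  by (simp add: unit_cube_eq_box)

lemma measure_unit_cube: "measure lborel (unit_cube :: (real ^ 'd) set) = 1"
  using measure_eq_prod_of_box[of 0 1 "unit_cube :: (real ^ 'd) set"] box_subset_cbox[of 0 "1 :: real ^ 'd"]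
  by (simp add: unit_cube_eq_box)

lemma emeasure_unit_cube: "emeasure lborel (unit_cube :: (real ^ 'd) set) = 1"
  using measure_unit_cube[where 'd='d] emeasure_bounded_finite[of "unit_cube :: (real ^ 'd) set"]
  by (simp add: emeasure_eq_ennreal_measure unit_cube_eq_box less_top)

interpretation cube_law: prob_space "cube_law :: (real ^ 'd) measure"
  by (intro prob_space_uniform_measure) (simp_all add: emeasure_unit_cube)

lemma measure_cube_law:
  "X \<in> sets borel \<Longrightarrow> measure cube_law (X :: (real ^ 'd) set) = measure lborel (unit_cube \<inter> X)"
  by (simp add: measure_uniform_measure emeasure_unit_cube measure_unit_cube)

lemma cube_fmeasurable: "X \<in> sets borel \<Longrightarrow> unit_cube \<inter> X \<in> fmeasurable lborel"
  by (rule fmeasurableI2[OF fmeasurable_cbox[of 0 1]])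
    (use box_subset_cbox[of 0 1] in \<open>auto simp: unit_cube_eq_box\<close>)

lemma measure_cube_law_le:
  assumes "X \<in> sets borel" "X \<subseteq> cbox l r" "\<And>j. l $ j \<le> r $ j"
  shows "measure cube_law X \<le> (\<Prod>j\<in>UNIV. r $ j - l $ j)"
proof -
  have "measure cube_law X \<le> measure lborel (cbox l r)"
    unfolding measure_cube_law[OF assms(1)]
    using assms by (intro measure_mono_fmeasurable) auto
  also have "\<dots> = (\<Prod>j\<in>UNIV. r $ j - l $ j)"
    using assms box_subset_cbox[of l r] by (intro measure_eq_prod_of_box) auto
  finally show ?thesis .
qed

lemma measure_cube_law_ge:
  assumes "X \<in> sets borel" "box l r \<subseteq> X" "\<And>j. 0 \<le> l $ j" "\<And>j. l $ j \<le> r $ j" "\<And>j. r $ j \<le> 1"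
  shows "(\<Prod>j\<in>UNIV. r $ j - l $ j) \<le> measure cube_law X"
proof -
  have "(\<Prod>j\<in>UNIV. r $ j - l $ j) = measure lborel (box l r)"
    using assms box_subset_cbox[of l r] by (intro measure_eq_prod_of_box[symmetric]) auto
  also have "\<dots> \<le> measure cube_law X"
    unfolding measure_cube_law[OF assms(1)]
  proof (intro measure_mono_fmeasurable cube_fmeasurable assms)
    have "box l r \<subseteq> unit_cube"
    proof
      fix x assume x: "x \<in> box l r"
      have "0 < x $ j \<and> x $ j < 1" for j
        using assms(3)[of j] assms(5)[of j] x by (auto simp: mem_box_cart dest!: spec[of _ j])
      then show "x \<in> unit_cube" by (simp add: unit_cube_def)
    qed
    then show "box l r \<subseteq> unit_cube \<inter> X" using assms(2) by blast
  qed auto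
  finally show ?thesis .
qed

lemma measure_cube_law_cells:
  fixes u :: "real ^ 'd"
  assumes "0 < L" "\<And>j. 0 < u $ j" "finite T"
    and sub: "\<And>m j. m \<in> T \<Longrightarrow> (real (m j) + 1) * u $ j \<le> real L"
  shows "measure cube_law (\<Union>m\<in>T. cell L u m) = real (card T) * ((\<Prod>j\<in>UNIV. u $ j) / real L ^ CARD('d))"
proof -
  have "measure cube_law (cell L u m) = (\<Prod>j\<in>UNIV. u $ j) / real L ^ CARD('d)" if "m \<in> T" for m
  proof (rule antisym)
    have le: "(\<chi> j. real (m j) * u $ j / real L) $ j \<le> (\<chi> j. (real (m j) + 1) * u $ j / real L) $ j" for j
      using assms(1) assms(2)[of j] by (simp add: divide_right_mono)
    show "measure cube_law (cell L u m) \<le> (\<Prod>j\<in>UNIV. u $ j) / real L ^ CARD('d)"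
      using measure_cube_law_le[OF sets_cell cell_subset_cbox[OF assms(1,2)] le]
      unfolding prod_cell_sides[OF assms(1,2)] .
    have "0 \<le> (\<chi> j. real (m j) * u $ j / real L) $ j" for j
      using assms(2)[of j] by simp
    moreover have "(\<chi> j. (real (m j) + 1) * u $ j / real L) $ j \<le> 1" for j
      using sub[OF that, of j] assms(1) by simp
    ultimately show "(\<Prod>j\<in>UNIV. u $ j) / real L ^ CARD('d) \<le> measure cube_law (cell L u m)"
      using measure_cube_law_ge[OF sets_cell box_subset_cell[OF assms(1,2)] _ le]
      unfolding prod_cell_sides[OF assms(1,2)] by blast
  qed
  moreover have "measure cube_law (\<Union>m\<in>T. cell L u m) = (\<Sum>m\<in>T. measure cube_law (cell L u m))"
    using assms(3) disjoint_cells by (intro cube_law.finite_measure_finite_Union) auto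
  ultimately show ?thesis by simp
qed

lemma sdom_measurable [measurable]:
  assumes "f \<in> borel_measurable N" "g \<in> borel_measurable N"
  shows "Measurable.pred N (\<lambda>x. (f x :: real ^ 'd) \<prec> g x)"
proof -
  have [measurable]: "(\<lambda>x. f x $ j) \<in> borel_measurable N" "(\<lambda>x. g x $ j) \<in> borel_measurable N" for j
    using assms by (auto intro: measurable_compose[OF _ borel_measurable_nth])
  show ?thesis unfolding sdom_def by measurable
qed

lemma pred_card_measurable:
  assumes "finite J" and "\<And>i. i \<in> J \<Longrightarrow> Measurable.pred N (\<lambda>x. R i x)"
  shows "(\<lambda>x. card {i \<in> J. R i x}) \<in> measurable N (count_space UNIV)"
proof -
  have "(\<lambda>x. card {i \<in> J. R i x}) = (\<lambda>x. \<Sum>i\<in>J. if R i x then 1 else 0)"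
    by (simp only: card_eq_sum sum.inter_filter[OF assms(1)])
  also have "\<dots> \<in> measurable N (count_space UNIV)"
    using assms(2) by (intro measurable_sum_nat measurable_If) (auto simp: pred_def)
  finally show ?thesis .
qed

text \<open>The newest observation is an argument of its own, so that it can be frozen and
  integrated out later. A set \<open>A\<close> of admissible counts treats a single count, a tail
  and the bare record event (\<open>A = UNIV\<close>) alike.\<close>

definition record_event :: "nat set \<Rightarrow> (nat \<Rightarrow> real ^ 'd) \<Rightarrow> real ^ 'd \<Rightarrow> nat set \<Rightarrow> bool"
  where "record_event J x u A \<longleftrightarrow> (\<forall>i\<in>J. \<not> x i \<prec> u) \<and>
    card {i \<in> J. u \<prec> x i \<and> (\<forall>i'\<in>J. \<not> x i' \<prec> x i)} \<in> A"

lemma record_event_measurable: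
  assumes "finite J" and [measurable]: "\<And>i. i \<in> J \<Longrightarrow> (\<lambda>\<omega>. x \<omega> i) \<in> borel_measurable N"
    "u \<in> borel_measurable N"
  shows "Measurable.pred N (\<lambda>\<omega>. record_event J (x \<omega>) (u \<omega>) A)"
proof -
  note [measurable] = pred_card_measurable[OF assms(1)]
  from assms(1) show ?thesis
    unfolding record_event_def by measurable
qed

text \<open>The purely deterministic part of the comparison: \<open>inside\<close>,
  \<open>sep\<close> and \<open>corner\<close> say that no outlying minimum, no slab shared by two
  points and no point in the slab just above the corner occurs. Each failure is bounded in
  probability below.\<close>

lemma record_event_iff_pattern:
  fixes x :: "nat \<Rightarrow> real ^ 'd"
  assumes upos: "\<And>j. 0 < u $ j" and xpos: "\<And>i j. i \<in> J \<Longrightarrow> 0 < x i $ j"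
    and L: "0 < L" and M: "0 < M"
    and inside: "\<And>i j. \<lbrakk>i \<in> J; u \<prec> x i; \<forall>i'\<in>J. \<not> x i' \<prec> x i\<rbrakk> \<Longrightarrow> x i $ j < real M * u $ j"
    and sep: "\<And>i i' j. \<lbrakk>i \<in> J; i' \<in> J; i \<noteq> i'; idx L u (x i) \<in> grid (M * L); idx L u (x i') \<in> grid (M * L)\<rbrakk>
        \<Longrightarrow> idx L u (x i) j \<noteq> idx L u (x i') j"
    and corner: "\<And>i j. \<lbrakk>i \<in> J; idx L u (x i) \<in> grid (M * L)\<rbrakk> \<Longrightarrow> idx L u (x i) j \<noteq> L"
  shows "record_event J x u A \<longleftrightarrow> occupied L u (M * L) (x ` J) \<in> pattern M L A"
proof -
  have sub: "grid L \<subseteq> (grid (M * L) :: ('d \<Rightarrow> nat) set)"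
    using M by (intro grid_mono) simp
  have occ: "occupied L u (M * L) (x ` J) = (\<lambda>i. idx L u (x i)) ` J \<inter> grid (M * L)"
    using xpos by (auto simp: occupied_def cell_def)
  have "occupied L u (M * L) (x ` J) \<subseteq> grid (M * L) - grid L \<longleftrightarrow> (\<forall>i\<in>J. idx L u (x i) \<notin> grid L)"
    using sub unfolding occ by blast
  also have "\<dots> \<longleftrightarrow> (\<forall>i\<in>J. \<not> x i \<prec> u)"
    using sdom_iff_idx[OF upos _ L] xpos by simp
  finally have 1: "occupied L u (M * L) (x ` J) \<subseteq> grid (M * L) - grid L \<longleftrightarrow> (\<forall>i\<in>J. \<not> x i \<prec> u)" .
  have idx_u: "idx L u u j = L" for j using upos[of j] by (simp add: idx_def)
  have "grid_count L (occupied L u (M * L) (x ` J)) =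
    card {i \<in> J. idx L u (x i) \<in> grid (M * L) \<and> u \<prec> x i \<and> (\<forall>i'\<in>J. \<not> x i' \<prec> x i)}"
  proof (rule grid_count_eq_card[OF upos xpos L])
    fix i i' j assume *: "i \<in> J" "i' \<in> J" "idx L u (x i) \<in> grid (M * L)" "idx L u (x i') \<in> grid (M * L)"
      "x i' $ j < x i $ j"
    then have "idx L u (x i) j \<noteq> idx L u (x i') j" by (intro sep) auto
    moreover have "idx L u (x i') j \<le> idx L u (x i) j"
      using * upos by (intro idx_mono) auto
    ultimately show "idx L u (x i') j < idx L u (x i) j" by simp
  next
    show "inj_on (\<lambda>i. idx L u (x i)) {i \<in> J. idx L u (x i) \<in> grid (M * L)}"
      using sep by (fastforce intro!: inj_onI)
  next
    fix i j assume *: "i \<in> J" "idx L u (x i) \<in> grid (M * L)" "u $ j < x i $ j"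
    have "idx L u u j \<le> idx L u (x i) j"
      using * upos by (intro idx_mono) auto
    then show "L < idx L u (x i) j" using corner[OF *(1,2), of j] idx_u[of j] by simp
  qed auto
  also have "{i \<in> J. idx L u (x i) \<in> grid (M * L) \<and> u \<prec> x i \<and> (\<forall>i'\<in>J. \<not> x i' \<prec> x i)} =
      {i \<in> J. u \<prec> x i \<and> (\<forall>i'\<in>J. \<not> x i' \<prec> x i)}"
    using inside idx_in_grid_iff[OF upos _ L] xpos by blast
  finally show ?thesis using 1 by (simp add: record_event_def pattern_def)
qed

text \<open>The restriction to the window is essential: the full strip through the cube can have
  mass as large as \<open>u $ j / L\<close>, whereas within the window the mass is at most a
  constant depending on \<open>M\<close> times the product of the coordinates of \<open>u\<close>,
  divided by \<open>L\<close>, so of order \<open>1 / (n * L)\<close> for bounded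
  \<open>w\<close>.\<close>

definition slab :: "nat \<Rightarrow> nat \<Rightarrow> real ^ 'd \<Rightarrow> 'd \<Rightarrow> nat \<Rightarrow> (real ^ 'd) set"
  where "slab M L u j s = {x. (\<forall>k. 0 < x $ k) \<and> idx L u x \<in> grid (M * L) \<and> idx L u x j = s}"

lemma sets_slab [measurable, simp]: "slab M L u j s \<in> sets borel"
proof -
  have "slab M L u j s = {x \<in> space borel. (\<forall>k. 0 < x $ k) \<and> (\<forall>k. idx L u x k < M * L) \<and> idx L u x j = s}"
    by (auto simp: slab_def grid_def)
  then show ?thesis by simp
qed

lemma measure_slab_le:
  fixes u :: "real ^ 'd"
  assumes L: "0 < L" and upos: "\<And>j. 0 < u $ j"
  shows "measure cube_law (slab M L u j s) \<le> (\<Prod>j\<in>UNIV. u $ j) * (real M ^ (CARD('d) - 1) / real L)"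
proof -
  let ?l = "\<chi> k. if k = j then real s * u $ j / real L else 0"
  let ?r = "\<chi> k. if k = j then (real s + 1) * u $ j / real L else real M * u $ k"
  have "slab M L u j s \<subseteq> cbox ?l ?r"
  proof
    fix x assume x: "x \<in> slab M L u j s"
    then have pos: "\<And>k. 0 < x $ k" and lt: "\<And>k. x $ k < real M * u $ k"
      using idx_in_grid_iff[OF upos _ L] by (auto simp: slab_def)
    have "real s * u $ j / real L \<le> x $ j \<and> x $ j < (real s + 1) * u $ j / real L"
      using x idx_eq_iff[OF upos pos L, of j s] by (auto simp: slab_def)
    then show "x \<in> cbox ?l ?r"
      using pos lt by (auto simp: mem_box_cart less_imp_le)
  qed
  moreover have "?l $ k \<le> ?r $ k" for k
    using upos[of k] upos[of j] L by (simp add: divide_right_mono)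
  ultimately have "measure cube_law (slab M L u j s) \<le> (\<Prod>k\<in>UNIV. ?r $ k - ?l $ k)"
    by (intro measure_cube_law_le) auto
  also have "\<dots> = (?r $ j - ?l $ j) * (\<Prod>k\<in>UNIV - {j}. ?r $ k - ?l $ k)"
    by (subst prod.remove[of _ j]) auto
  also have "(\<Prod>k\<in>UNIV - {j}. ?r $ k - ?l $ k) = (\<Prod>k\<in>UNIV - {j}. real M * u $ k)"
    by (intro prod.cong) auto
  also have "\<dots> = real M ^ (CARD('d) - 1) * (\<Prod>k\<in>UNIV - {j}. u $ k)"
    by (simp add: prod.distrib)
  also have "?r $ j - ?l $ j = u $ j / real L"
    by (simp add: field_simps flip: diff_divide_distrib)
  also have "u $ j / real L * (real M ^ (CARD('d) - 1) * (\<Prod>k\<in>UNIV - {j}. u $ k)) =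
      (u $ j * (\<Prod>k\<in>UNIV - {j}. u $ k)) * (real M ^ (CARD('d) - 1) / real L)"
    by simp
  also have "u $ j * (\<Prod>k\<in>UNIV - {j}. u $ k) = (\<Prod>k\<in>UNIV. u $ k)"
    by (subst (2) prod.remove[of _ j]) auto
  finally show ?thesis .
qed

text \<open>The quantity \<open>b * (M ^ (d - 1) / L)\<close> bounds the expected number of sample
  points in one slab. The first term is its square, a bound for collisions in one slab, times the
  \<open>d * M * L\<close> slabs; the second term accounts for the \<open>d\<close> slabs of index
  \<open>L\<close>. Both are of order \<open>1 / L\<close>.\<close>

definition slab_error :: "('d::finite) itself \<Rightarrow> real \<Rightarrow> nat \<Rightarrow> nat \<Rightarrow> real"
  where "slab_error _ b M L =
    real CARD('d) * (real M * real L) * (b * (real M ^ (CARD('d) - 1) / real L))\<^sup>2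
    + real CARD('d) * (b * (real M ^ (CARD('d) - 1) / real L))"

text \<open>The bound of \<open>sum_exp_prod_le\<close> at \<open>\<beta> = a / 4\<close>, times
  \<open>b\<close>, which bounds the expected number of sample points in a unit cell.\<close>

definition tail_error :: "('d::finite) itself \<Rightarrow> real \<Rightarrow> real \<Rightarrow> nat \<Rightarrow> real"
  where "tail_error _ a b M =
    b * (exp (a / 2 * real CARD('d)) * exp (- (a / 4 * real M)) * (1 / (1 - exp (- (a / 4)))) ^ CARD('d))"

section \<open>Independent uniform observations\<close>

locale cube_sample = prob_space P for P :: "'a measure" +
  fixes U :: "nat \<Rightarrow> 'a \<Rightarrow> real ^ 'd"
  assumes indep: "indep_vars (\<lambda>_. borel) U {1..}"
    and distr_U: "\<And>n. 1 \<le> n \<Longrightarrow> distr P borel (U n) = cube_law"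
begin

lemma U_measurable [measurable (raw)]: "1 \<le> n \<Longrightarrow> U n \<in> borel_measurable P"
  using indep by (auto simp: indep_vars_def)

lemma prob_U: "\<lbrakk>1 \<le> n; B \<in> sets borel\<rbrakk> \<Longrightarrow> prob (U n -` B \<inter> space P) = measure cube_law B"
  using measure_distr[OF U_measurable, of n B] distr_U by simp

lemma prob_all_in:
  assumes "finite J" "J \<subseteq> {1..}" "B \<in> sets borel"
  shows "prob {\<omega> \<in> space P. \<forall>i\<in>J. U i \<omega> \<in> B} = measure cube_law B ^ card J"
proof (cases "J = {}")
  case False
  have "{\<omega> \<in> space P. \<forall>i\<in>J. U i \<omega> \<in> B} = (\<Inter>i\<in>J. U i -` B \<inter> space P)"
    using False by auto
  also have "prob \<dots> = (\<Prod>i\<in>J. prob (U i -` B \<inter> space P))"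
    using assms False by (intro indep_varsD[OF indep]) auto
  also have "\<dots> = measure cube_law B ^ card J"
    using assms by (subst prod.cong[OF refl prob_U]) auto
  finally show ?thesis .
qed (simp add: prob_space)

lemma prob_none_in:
  assumes "finite J" "J \<subseteq> {1..}" "B \<in> sets borel"
  shows "prob {\<omega> \<in> space P. \<forall>i\<in>J. U i \<omega> \<notin> B} = (1 - measure cube_law B) ^ card J"
proof -
  have "measure cube_law (- B) = 1 - measure cube_law B"
    using cube_law.prob_compl[of B] assms by (simp add: Compl_eq_Diff_UNIV)
  then show ?thesis using prob_all_in[OF assms(1,2), of "- B"] assms(3) by simp
qed

section \<open>Estimates with the newest point frozen at \<open>u\<close>\<close>

context
  fixes n :: nat and u :: "real ^ 'd"
  assumes n: "4 \<le> n" and u: "u \<in> unit_cube"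
begin

abbreviation (input) "p \<equiv> \<Prod>j\<in>UNIV. u $ j"

lemma u_pos: "0 < u $ j" and u_less: "u $ j < 1"
  using u by (auto simp: unit_cube_def)

lemma p_pos: "0 < p" and p_le: "p \<le> 1"
  using u_pos u_less by (auto intro!: prod_pos prod_le_1 simp: less_imp_le)

text \<open>A record needs the box below \<open>u\<close>, of mass at least \<open>p\<close>, to be
  empty of earlier points; half of the exponent is given up to pass from \<open>n - 1\<close> to
  \<open>n\<close>. This is the integrable bound for large \<open>w\<close>, where the grid
  comparison is not uniform.\<close>

lemma prob_record_event_le:
  "prob {\<omega> \<in> space P. record_event {1..<n} (\<lambda>i. U i \<omega>) u A} \<le> exp (- (real n * p / 2))"
proof -
  have B: "{x. x \<prec> u} \<in> sets borel"
    using sdom_measurable[of "\<lambda>x. x" borel "\<lambda>_. u"] by (simp add: pred_def)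
  have [measurable]: "Measurable.pred P (\<lambda>\<omega>. \<forall>i\<in>{1..<n}. U i \<omega> \<notin> {x. x \<prec> u})"
    using B by measurable
  have "prob {\<omega> \<in> space P. record_event {1..<n} (\<lambda>i. U i \<omega>) u A} \<le>
      prob {\<omega> \<in> space P. \<forall>i\<in>{1..<n}. U i \<omega> \<notin> {x. x \<prec> u}}"
    by (intro finite_measure_mono) (auto simp: record_event_def)
  also have "\<dots> = (1 - measure cube_law {x. x \<prec> u}) ^ (n - 1)"
    using B by (subst prob_none_in) auto
  also have "\<dots> \<le> (1 - p) ^ (n - 1)"
  proof -
    have "p = (\<Prod>j\<in>UNIV. u $ j - 0 $ j)" by simp
    also have "\<dots> \<le> measure cube_law {x. x \<prec> u}"
      using u_pos u_less by (intro measure_cube_law_ge B) (auto simp: mem_box_cart sdom_def less_imp_le)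
    finally show ?thesis by (intro power_mono) auto
  qed
  also have "\<dots> \<le> exp (- (p * real (n - 1)))"
    using p_le by (rule one_minus_power_le_exp)
  also have "\<dots> \<le> exp (- (real n * p / 2))"
  proof -
    have "p * (real n / 2) \<le> p * real (n - 1)"
      using n p_pos by (intro mult_left_mono) auto
    then show ?thesis by (simp add: mult.commute)
  qed
  finally show ?thesis .
qed

text \<open>If a minimum lies in the unit cell \<open>C m\<close>, then the box \<open>D m\<close>
  below the lower corner of that cell is empty. Its mass is at least \<open>p\<close> times the
  product of the entries of \<open>m\<close>, so a given cell contributes at most
  \<open>n * p\<close> times an exponential in that product, and the sum over cells with a large
  entry is small.\<close>

lemma prob_outlying_minimum_le:
  assumes "0 < a" "a \<le> real n * p" "real n * p \<le> b"
  shows "prob {\<omega> \<in> space P. \<exists>i\<in>{1..<n}. U i \<omega> \<in> unit_cube \<and> u \<prec> U i \<omega> \<and>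
      (\<forall>i'\<in>{1..<n}. \<not> (U i' \<omega> \<prec> U i \<omega> \<and> U i' \<omega> \<in> unit_cube)) \<and> (\<exists>j. real M * u $ j \<le> U i \<omega> $ j)}
    \<le> tail_error TYPE('d) a b M" (is "prob ?E \<le> _")
proof -
  \<comment> \<open>Entries are at least \<open>1\<close> because the point dominates
    \<open>u\<close>. The bound \<open>m j * u $ j < 1\<close> comes from the point being in the
    cube; it makes \<open>T\<close> finite and places \<open>D m\<close> inside the cube, where its
    mass is its volume.\<close>
  define T where "T = {m. (\<forall>j. 1 \<le> m j \<and> real (m j) * u $ j < 1) \<and> (\<exists>j. M \<le> m j)}"
  define C where "C m = cell 1 u m" for m
  define D where "D m = {x. \<forall>j. 0 < x $ j \<and> x $ j < real (m j) * u $ j}" for m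
  define F where "F m = {\<omega> \<in> space P. (\<exists>i\<in>{1..<n}. U i \<omega> \<in> C m) \<and> (\<forall>i\<in>{1..<n}. U i \<omega> \<notin> D m)}" for m
  have D_box: "D m = box 0 (\<chi> j. real (m j) * u $ j)" for m
    by (auto simp: D_def mem_box_cart)
  have [measurable]: "C m \<in> sets borel" "D m \<in> sets borel" for m
    unfolding C_def D_box by auto
  have [measurable]: "F m \<in> sets P" for m unfolding F_def by measurable
  have "finite T"
  proof (rule finite_subset)
    show "T \<subseteq> grid (Suc (\<Sum>j\<in>UNIV. nat \<lceil>1 / u $ j\<rceil>))"
    proof
      fix m assume "m \<in> T"
      have "m j < Suc (\<Sum>j\<in>UNIV. nat \<lceil>1 / u $ j\<rceil>)" for j
      proof -
        have "real (m j) < 1 / u $ j"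
          using \<open>m \<in> T\<close> u_pos[of j] by (auto simp: T_def field_simps)
        then have "m j \<le> nat \<lceil>1 / u $ j\<rceil>" by linarith
        also have "\<dots> \<le> (\<Sum>j\<in>UNIV. nat \<lceil>1 / u $ j\<rceil>)" by (intro member_le_sum) auto
        finally show ?thesis by simp
      qed
      then show "m \<in> grid (Suc (\<Sum>j\<in>UNIV. nat \<lceil>1 / u $ j\<rceil>))" by (simp add: grid_def)
    qed
  qed simp
  have "?E \<subseteq> (\<Union>m\<in>T. F m)"
  proof
    fix \<omega> assume "\<omega> \<in> ?E"
    then obtain i k where \<omega>: "\<omega> \<in> space P" and i: "i \<in> {1..<n}" "U i \<omega> \<in> unit_cube" "u \<prec> U i \<omega>"
      and min: "\<And>i'. i' \<in> {1..<n} \<Longrightarrow> \<not> (U i' \<omega> \<prec> U i \<omega> \<and> U i' \<omega> \<in> unit_cube)" and k: "real M * u $ k \<le> U i \<omega> $ k"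
      by blast
    define m where "m = idx 1 u (U i \<omega>)"
    have pos: "0 < U i \<omega> $ j" for j using i(2) by (simp add: unit_cube_def)
    have lo: "real (m j) * u $ j \<le> U i \<omega> $ j" for j
      using idx_eq_iff[OF u_pos pos zero_less_one, of j "m j"] by (simp add: m_def)
    have "idx 1 u u j \<le> m j" for j
      unfolding m_def using i(3) u_pos by (intro idx_mono) (auto simp: sdom_def less_imp_le)
    moreover have "idx 1 u u j = 1" for j using u_pos[of j] by (simp add: idx_def)
    moreover have "M \<le> m k"
      using idx_less_iff[of u k "U i \<omega>" 1 M] u_pos pos k by (auto simp: m_def not_less)
    moreover have "real (m j) * u $ j < 1" for j
      using lo[of j] i(2) by (auto simp: unit_cube_def intro: le_less_trans)
    ultimately have "m \<in> T" by (auto simp: T_def)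
    moreover have "U i \<omega> \<in> C m" using pos by (simp add: C_def cell_def m_def)
    moreover have "U i' \<omega> \<notin> D m" if "i' \<in> {1..<n}" for i'
    proof
      assume *: "U i' \<omega> \<in> D m"
      then have less: "U i' \<omega> \<prec> U i \<omega>"
        using lo by (auto simp: D_def sdom_def intro: less_le_trans)
      moreover have "U i' \<omega> \<in> unit_cube"
        using * i(2) less by (auto simp: D_def sdom_def unit_cube_def intro: less_trans)
      ultimately show False using min[OF that] by blast
    qed
    ultimately show "\<omega> \<in> (\<Union>m\<in>T. F m)" unfolding F_def using \<omega> i(1) by blast
  qed
  then have "prob ?E \<le> prob (\<Union>m\<in>T. F m)"
    using \<open>finite T\<close> by (intro finite_measure_mono) auto
  also have "\<dots> \<le> (\<Sum>m\<in>T. prob (F m))"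
    using \<open>finite T\<close> by (intro finite_measure_subadditive_finite) auto
  also have "\<dots> \<le> (\<Sum>m\<in>T. b * exp (- (2 * (a / 4) * real (\<Prod>j\<in>UNIV. m j))))"
  proof (rule sum_mono)
    fix m assume m: "m \<in> T"
    define x where "x = measure cube_law (D m)"
    define z where "z = measure cube_law (D m \<union> C m)"
    have x: "real (\<Prod>j\<in>UNIV. m j) * p \<le> x"
    proof -
      have "(\<Prod>j\<in>UNIV. (\<chi> j. real (m j) * u $ j) $ j - 0 $ j) \<le> x"
        unfolding x_def D_box using m u_pos
        by (intro measure_cube_law_ge) (auto simp: T_def less_imp_le)
      then show ?thesis by (simp add: prod.distrib)
    qed
    have x1: "0 \<le> x" "x \<le> 1" "z \<le> 1" "x \<le> z"
      by (auto simp: x_def z_def intro: cube_law.finite_measure_mono)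
    have "measure cube_law (C m) \<le> p"
    proof -
      have "(\<chi> j. real (m j) * u $ j / real 1) $ j \<le> (\<chi> j. (real (m j) + 1) * u $ j / real 1) $ j" for j
        using u_pos[of j] by simp
      from measure_cube_law_le[OF sets_cell cell_subset_cbox[OF zero_less_one u_pos] this]
      show ?thesis unfolding prod_cell_sides[OF zero_less_one u_pos] by (simp add: C_def)
    qed
    then have z: "z - x \<le> p"
      using measure_Un_le[of "D m" cube_law "C m"] by (simp add: x_def z_def)
    have "prob (F m) = prob ({\<omega> \<in> space P. \<forall>i\<in>{1..<n}. U i \<omega> \<notin> D m} -
        {\<omega> \<in> space P. \<forall>i\<in>{1..<n}. U i \<omega> \<notin> D m \<union> C m})"
      by (rule arg_cong[where f=prob]) (auto simp: F_def)
    also have "\<dots> = (1 - x) ^ (n - 1) - (1 - z) ^ (n - 1)"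
    proof -
      have "prob {\<omega> \<in> space P. \<forall>i\<in>{1..<n}. U i \<omega> \<notin> D m} = (1 - x) ^ (n - 1)"
        "prob {\<omega> \<in> space P. \<forall>i\<in>{1..<n}. U i \<omega> \<notin> D m \<union> C m} = (1 - z) ^ (n - 1)"
        unfolding x_def z_def by (subst prob_none_in; auto)+
      then show ?thesis by (subst finite_measure_Diff) auto
    qed
    also have "\<dots> \<le> real (n - 1) * ((1 - x) - (1 - z)) * (1 - x) ^ (n - 1 - 1)"
      using x1 by (intro power_diff_le) auto
    \<comment> \<open>The factor \<open>n * p\<close> comes from the choice of a point and the mass
      of its cell; the exponent \<open>n - 2\<close> belongs to the other points, which avoid
      \<open>D m\<close>.\<close>
    also have "\<dots> \<le> (real n * p) * exp (- (x * real (n - 2)))"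
    proof (intro mult_mono)
      show "(1 - x) ^ (n - 1 - 1) \<le> exp (- (x * real (n - 2)))"
        using one_minus_power_le_exp[of x "n - 2"] x1 by (simp add: numeral_2_eq_2)
    qed (use x1 z p_pos in auto)
    also have "\<dots> \<le> b * exp (- (2 * (a / 4) * real (\<Prod>j\<in>UNIV. m j)))"
    proof (intro mult_mono)
      have "2 * (a / 4) * real (\<Prod>j\<in>UNIV. m j) \<le> 2 * (real n * p / 4) * real (\<Prod>j\<in>UNIV. m j)"
        using assms by (intro mult_right_mono) (auto intro: prod_nonneg)
      also have "\<dots> = (real (\<Prod>j\<in>UNIV. m j) * p) * (real n / 2)" by simp
      also have "\<dots> \<le> x * (real n / 2)"
        using x by (intro mult_right_mono) auto
      \<comment> \<open>This is where \<open>4 \<le> n\<close> enters: it gives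
        \<open>n / 2 \<le> n - 2\<close>.\<close>
      also have "\<dots> \<le> x * real (n - 2)"
        using n x1 by (intro mult_left_mono) auto
      finally show "exp (- (x * real (n - 2))) \<le> exp (- (2 * (a / 4) * real (\<Prod>j\<in>UNIV. m j)))"
        by simp
    qed (use assms p_pos in auto)
    finally show "prob (F m) \<le> b * exp (- (2 * (a / 4) * real (\<Prod>j\<in>UNIV. m j)))" .
  qed
  also have "\<dots> = b * (\<Sum>m\<in>T. exp (- (2 * (a / 4) * real (\<Prod>j\<in>UNIV. m j))))"
    by (simp add: sum_distrib_left)
  also have "\<dots> \<le> b * (exp (2 * (a / 4) * real CARD('d)) * exp (- (a / 4 * real M)) *
      (1 / (1 - exp (- (a / 4)))) ^ CARD('d))"
    using assms \<open>finite T\<close> by (intro mult_left_mono sum_exp_prod_le) (auto simp: T_def)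
  finally show ?thesis by (simp add: tail_error_def)
qed

text \<open>A union bound over ordered pairs of points, directions and slabs. A collision costs the
  square of a slab mass of order \<open>1 / L\<close>, while the number of slabs grows only linearly
  in \<open>L\<close>, so refining the mesh wins. The extra slab of index \<open>L\<close> in each
  direction lies just above the corner; a point there would exceed the corner in that coordinate
  without its index showing it.\<close>

lemma prob_slab_collision_le:
  assumes "real n * p \<le> b" and L: "0 < L"
  shows "prob ({\<omega> \<in> space P. \<exists>i\<in>{1..<n}. \<exists>i'\<in>{1..<n}. \<exists>j. \<exists>s<M * L.
        i \<noteq> i' \<and> U i \<omega> \<in> slab M L u j s \<and> U i' \<omega> \<in> slab M L u j s} \<union>
      {\<omega> \<in> space P. \<exists>i\<in>{1..<n}. \<exists>j. U i \<omega> \<in> slab M L u j L})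
    \<le> slab_error TYPE('d) b M L" (is "prob (?E1 \<union> ?E2) \<le> _")
proof -
  define \<sigma> where "\<sigma> = p * (real M ^ (CARD('d) - 1) / real L)"
  have \<sigma>: "0 \<le> \<sigma>" using p_pos by (simp add: \<sigma>_def)
  have n\<sigma>: "real n * \<sigma> \<le> b * (real M ^ (CARD('d) - 1) / real L)"
    unfolding \<sigma>_def using assms
    by (subst mult.assoc[symmetric], intro mult_right_mono) auto
  have slab: "measure cube_law (slab M L u j s) \<le> \<sigma>" for j s
    unfolding \<sigma>_def by (intro measure_slab_le L u_pos)
  let ?I = "{(i, i'). i \<in> {1..<n} \<and> i' \<in> {1..<n} \<and> i \<noteq> i'} \<times> (UNIV :: 'd set) \<times> {..<M * L}"
  have finI: "finite {(i, i'). i \<in> {1..<n} \<and> i' \<in> {1..<n} \<and> i \<noteq> i'}"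
    by (rule finite_subset[of _ "{1..<n} \<times> {1..<n}"]) auto
  have cardI: "real (card ?I) \<le> (real n)\<^sup>2 * (real CARD('d) * (real M * real L))"
  proof -
    have "card {(i, i'). i \<in> {1..<n} \<and> i' \<in> {1..<n} \<and> i \<noteq> i'} \<le> card ({1..<n} \<times> {1..<n})"
      by (intro card_mono) auto
    also have "\<dots> \<le> n\<^sup>2" by (simp add: power2_eq_square mult_le_mono)
    finally have "card ?I \<le> n\<^sup>2 * (CARD('d) * (M * L))"
      by (simp add: card_cartesian_product)
    then have "real (card ?I) \<le> real (n\<^sup>2 * (CARD('d) * (M * L)))"
      by (rule of_nat_mono)
    then show ?thesis by simp
  qed
  let ?e = "\<lambda>((i, i'), j, s). {\<omega> \<in> space P. \<forall>k\<in>{i, i'}. U k \<omega> \<in> slab M L u j s}"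
  have E1: "?E1 = (\<Union>t\<in>?I. ?e t)"
  proof (intro equalityI subsetI)
    fix \<omega> assume "\<omega> \<in> ?E1"
    then obtain i i' j s where *: "\<omega> \<in> space P" "i \<in> {1..<n}" "i' \<in> {1..<n}" "s < M * L" "i \<noteq> i'"
      "U i \<omega> \<in> slab M L u j s" "U i' \<omega> \<in> slab M L u j s" by blast
    show "\<omega> \<in> (\<Union>t\<in>?I. ?e t)"
      by (rule UN_I[of "((i, i'), j, s)"]) (use * in simp_all)
  next
    fix \<omega> assume "\<omega> \<in> (\<Union>t\<in>?I. ?e t)"
    then obtain i i' j s where *: "((i, i'), j, s) \<in> ?I" "\<omega> \<in> ?e ((i, i'), j, s)" by blast
    then have "\<omega> \<in> space P" "i \<in> {1..<n}" "i' \<in> {1..<n}" "s < M * L" "i \<noteq> i'"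
      "U i \<omega> \<in> slab M L u j s" "U i' \<omega> \<in> slab M L u j s" by simp_all
    then show "\<omega> \<in> ?E1" by blast
  qed
  have e_meas: "?e t \<in> sets P" if "t \<in> ?I" for t
    using that by auto
  have "prob ?E1 \<le> (\<Sum>t\<in>?I. prob (?e t))"
    unfolding E1 using finI e_meas by (intro finite_measure_subadditive_finite) auto
  also have "\<dots> \<le> (\<Sum>t\<in>?I. \<sigma>\<^sup>2)"
  proof (rule sum_mono)
    fix t assume "t \<in> ?I"
    then obtain i i' j s where t: "t = ((i, i'), j, s)" "1 \<le> i" "1 \<le> i'" "i \<noteq> i'" by auto
    then have "prob (?e t) = (measure cube_law (slab M L u j s))\<^sup>2"
      using prob_all_in[of "{i, i'}" "slab M L u j s"] by (simp add: power2_eq_square)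
    also have "\<dots> \<le> \<sigma>\<^sup>2" by (intro power_mono slab) simp
    finally show "prob (?e t) \<le> \<sigma>\<^sup>2" .
  qed
  also have "\<dots> = real (card ?I) * \<sigma>\<^sup>2" by simp
  also have "\<dots> \<le> (real n)\<^sup>2 * (real CARD('d) * (real M * real L)) * \<sigma>\<^sup>2"
    by (intro mult_right_mono cardI) simp
  also have "\<dots> = real CARD('d) * (real M * real L) * (real n * \<sigma>)\<^sup>2"
    by (simp add: power_mult_distrib)
  also have "\<dots> \<le> real CARD('d) * (real M * real L) * (b * (real M ^ (CARD('d) - 1) / real L))\<^sup>2"
    using n\<sigma> \<sigma> by (intro mult_left_mono power_mono) auto
  finally have 1: "prob ?E1 \<le> real CARD('d) * (real M * real L) * (b * (real M ^ (CARD('d) - 1) / real L))\<^sup>2" .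
  have E2: "?E2 = (\<Union>(i, j)\<in>{1..<n} \<times> UNIV. {\<omega> \<in> space P. U i \<omega> \<in> slab M L u j L})" by auto
  have "prob ?E2 \<le> (\<Sum>(i, j)\<in>{1..<n} \<times> (UNIV :: 'd set). prob {\<omega> \<in> space P. U i \<omega> \<in> slab M L u j L})"
    unfolding E2 case_prod_unfold by (intro finite_measure_subadditive_finite) auto
  also have "\<dots> \<le> (\<Sum>(i, j)\<in>{1..<n} \<times> (UNIV :: 'd set). \<sigma>)"
  proof (rule sum_mono, clarify)
    fix i j assume "i \<in> {1..<n}"
    then show "prob {\<omega> \<in> space P. U i \<omega> \<in> slab M L u j L} \<le> \<sigma>"
      using prob_all_in[of "{i}" "slab M L u j L"] slab[of j L] by simp
  qed
  also have "\<dots> = real (n - 1) * real CARD('d) * \<sigma>"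
    by (simp add: case_prod_unfold)
  also have "\<dots> \<le> real CARD('d) * (real n * \<sigma>)"
    using \<sigma> by (simp add: mult_left_mono mult_right_mono mult.assoc mult.left_commute)
  also have "\<dots> \<le> real CARD('d) * (b * (real M ^ (CARD('d) - 1) / real L))"
    by (intro mult_left_mono n\<sigma>) simp
  finally have 2: "prob ?E2 \<le> real CARD('d) * (b * (real M ^ (CARD('d) - 1) / real L))" .
  have "?E1 \<in> sets P" unfolding E1 using finI e_meas by (intro sets.finite_UN) auto
  moreover have "?E2 \<in> sets P" unfolding E2 by (intro sets.finite_UN) auto
  ultimately have "prob (?E1 \<union> ?E2) \<le> prob ?E1 + prob ?E2"
    by (intro measure_Un_le)
  with 1 2 show ?thesis by (simp add: slab_error_def)
qed

text \<open>An exact identity: the hypothesis on \<open>M\<close> places the window inside the cube,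
  so unions of cells have their full volume, and a void probability is the corresponding power
  \<open>n - 1\<close> by independence.\<close>

lemma prob_pattern:
  assumes L: "0 < L" and M: "\<And>j. real M * u $ j \<le> 1"
  shows "prob {\<omega> \<in> space P. occupied L u (M * L) ((\<lambda>i. U i \<omega>) ` {1..<n}) \<in> pattern M L A} =
    void_sum (grid (M * L) :: ('d \<Rightarrow> nat) set) (pattern M L A) (\<lambda>C. (1 - real (card C) * (p / real L ^ CARD('d))) ^ (n - 1))"
proof -
  let ?G = "grid (M * L) :: ('d \<Rightarrow> nat) set"
  let ?occ = "\<lambda>\<omega>. occupied L u (M * L) ((\<lambda>i. U i \<omega>) ` {1..<n})"
  have "prob {\<omega> \<in> space P. ?occ \<omega> \<in> pattern M L A} =
      void_sum ?G (pattern M L A) (\<lambda>C. prob {\<omega> \<in> space P. ?occ \<omega> \<inter> C = {}})"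
  proof (rule measure_random_subset)
    fix m :: "'d \<Rightarrow> nat" assume "m \<in> ?G"
    then have "{\<omega> \<in> space P. m \<in> ?occ \<omega>} = {\<omega> \<in> space P. \<exists>i\<in>{1..<n}. U i \<omega> \<in> cell L u m}"
      by (auto simp: occupied_def)
    then show "{\<omega> \<in> space P. m \<in> ?occ \<omega>} \<in> sets P" by simp
  qed (auto simp: pattern_def occupied_def)
  also have "\<dots> = void_sum ?G (pattern M L A) (\<lambda>C. (1 - real (card C) * (p / real L ^ CARD('d))) ^ (n - 1))"
    unfolding void_sum_def
  proof (intro sum.cong refl)
    fix C T :: "('d \<Rightarrow> nat) set"
    have "{\<omega> \<in> space P. ?occ \<omega> \<inter> (?G - T) = {}} =
        {\<omega> \<in> space P. \<forall>i\<in>{1..<n}. U i \<omega> \<notin> (\<Union>m\<in>?G - T. cell L u m)}"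
      by (auto simp: occupied_def)
    also have "prob \<dots> = (1 - measure cube_law (\<Union>m\<in>?G - T. cell L u m)) ^ (n - 1)"
      by (subst prob_none_in) auto
    also have "measure cube_law (\<Union>m\<in>?G - T. cell L u m) = real (card (?G - T)) * (p / real L ^ CARD('d))"
    proof (rule measure_cube_law_cells[OF L u_pos])
      fix m j assume "m \<in> ?G - T"
      then have "m j + 1 \<le> M * L" by (simp add: grid_def Suc_leI)
      then have "real (m j + 1) \<le> real (M * L)" by (rule of_nat_mono)
      then have "real (m j) + 1 \<le> real M * real L" by simp
      then have "(real (m j) + 1) * u $ j \<le> real M * real L * u $ j"
        using u_pos[of j] by (intro mult_right_mono) auto
      also have "\<dots> \<le> real L"
        using M[of j] mult_right_mono[OF M[of j], of "real L"] by (simp add: mult_ac)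
      finally show "(real (m j) + 1) * u $ j \<le> real L" .
    qed simp
    finally show "(- 1) ^ (card C - card T) * prob {\<omega> \<in> space P. ?occ \<omega> \<inter> (?G - T) = {}} =
        (- 1) ^ (card C - card T) * (1 - real (card (?G - T)) * (p / real L ^ CARD('d))) ^ (n - 1)"
      by simp
  qed
  finally show ?thesis .
qed

text \<open>Off the bad events the record event and the grid event coincide, so their probabilities
  differ by at most the probability of a bad event. The grid probability is then compared with
  \<open>grid_law\<close> term by term in the Moebius sum; the number of terms depends on the grid
  but not on \<open>n\<close>, so this last error vanishes as \<open>n\<close> grows.\<close>

lemma prob_record_event_approx:
  assumes "0 < a" "a \<le> real n * p" "real n * p \<le> b" and L: "0 < L" and M: "0 < M"
    and Mu: "\<And>j. real M * u $ j \<le> 1"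
  shows "\<bar>prob {\<omega> \<in> space P. record_event {1..<n} (\<lambda>i. U i \<omega>) u A} - grid_law TYPE('d) M L A (real n * p)\<bar>
    \<le> tail_error TYPE('d) a b M + slab_error TYPE('d) b M L +
      (\<Sum>C\<in>(pattern M L A :: ('d \<Rightarrow> nat) set set). \<Sum>T\<in>Pow C.
        ((real M ^ CARD('d) * b)\<^sup>2 + real M ^ CARD('d) * b) / real n)"
proof -
  let ?G = "grid (M * L) :: ('d \<Rightarrow> nat) set"
  let ?R = "{\<omega> \<in> space P. record_event {1..<n} (\<lambda>i. U i \<omega>) u A}"
  let ?O = "{\<omega> \<in> space P. occupied L u (M * L) ((\<lambda>i. U i \<omega>) ` {1..<n}) \<in> pattern M L A}"
  let ?B0 = "{\<omega> \<in> space P. \<exists>i\<in>{1..<n}. U i \<omega> \<notin> unit_cube}"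
  let ?B1 = "{\<omega> \<in> space P. \<exists>i\<in>{1..<n}. U i \<omega> \<in> unit_cube \<and> u \<prec> U i \<omega> \<and>
      (\<forall>i'\<in>{1..<n}. \<not> (U i' \<omega> \<prec> U i \<omega> \<and> U i' \<omega> \<in> unit_cube)) \<and> (\<exists>j. real M * u $ j \<le> U i \<omega> $ j)}"
  let ?B2 = "{\<omega> \<in> space P. \<exists>i\<in>{1..<n}. \<exists>i'\<in>{1..<n}. \<exists>j. \<exists>s<M * L.
        i \<noteq> i' \<and> U i \<omega> \<in> slab M L u j s \<and> U i' \<omega> \<in> slab M L u j s} \<union>
      {\<omega> \<in> space P. \<exists>i\<in>{1..<n}. \<exists>j. U i \<omega> \<in> slab M L u j L}"
  have iff: "\<omega> \<in> ?R \<longleftrightarrow> \<omega> \<in> ?O" if \<omega>: "\<omega> \<in> space P" "\<omega> \<notin> ?B0" "\<omega> \<notin> ?B1" "\<omega> \<notin> ?B2" for \<omega>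
  proof -
    have cube: "U i \<omega> \<in> unit_cube" if "i \<in> {1..<n}" for i using that \<omega> by blast
    then have pos: "0 < U i \<omega> $ j" if "i \<in> {1..<n}" for i j using that by (simp add: unit_cube_def)
    have slab_mem: "U i \<omega> \<in> slab M L u j s"
      if "i \<in> {1..<n}" "idx L u (U i \<omega>) \<in> grid (M * L)" "idx L u (U i \<omega>) j = s" for i j s
      using that pos by (simp add: slab_def)
    have "record_event {1..<n} (\<lambda>i. U i \<omega>) u A \<longleftrightarrow>
        occupied L u (M * L) ((\<lambda>i. U i \<omega>) ` {1..<n}) \<in> pattern M L A"
    proof (rule record_event_iff_pattern[OF u_pos pos L M])
      fix i j assume "i \<in> {1..<n}" "u \<prec> U i \<omega>" "\<forall>i'\<in>{1..<n}. \<not> U i' \<omega> \<prec> U i \<omega>"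
      then show "U i \<omega> $ j < real M * u $ j"
        using \<omega>(1,3) cube by (force simp: not_less)
    next
      fix i i' j assume *: "i \<in> {1..<n}" "i' \<in> {1..<n}" "i \<noteq> i'" "idx L u (U i \<omega>) \<in> grid (M * L)"
        "idx L u (U i' \<omega>) \<in> grid (M * L)"
      have s: "idx L u (U i \<omega>) j < M * L" using *(4) by (simp add: grid_def)
      show "idx L u (U i \<omega>) j \<noteq> idx L u (U i' \<omega>) j"
      proof
        assume "idx L u (U i \<omega>) j = idx L u (U i' \<omega>) j"
        then have "U i \<omega> \<in> slab M L u j (idx L u (U i \<omega>) j)" "U i' \<omega> \<in> slab M L u j (idx L u (U i \<omega>) j)"
          using slab_mem[OF *(1,4) refl, of j] slab_mem[OF *(2,5), of j] by simp_all
        then have "\<omega> \<in> ?B2" using s *(1-3) \<omega>(1) by blast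
        then show False using \<omega>(4) by blast
      qed
    next
      fix i j assume *: "i \<in> {1..<n}" "idx L u (U i \<omega>) \<in> grid (M * L)"
      show "idx L u (U i \<omega>) j \<noteq> L" using slab_mem[OF *] \<omega> * by blast
    qed
    then show ?thesis using \<omega> by blast
  qed
  have R: "?R \<in> sets P"
    using record_event_measurable[of "{1..<n}" "\<lambda>\<omega> i. U i \<omega>" P "\<lambda>_. u" A] by simp
  have occ_meas: "{\<omega> \<in> space P. occupied L u (M * L) ((\<lambda>i. U i \<omega>) ` {1..<n}) = C} \<in> sets P" if "C \<subseteq> ?G" for C
  proof -
    have "{\<omega> \<in> space P. occupied L u (M * L) ((\<lambda>i. U i \<omega>) ` {1..<n}) = C} =
        {\<omega> \<in> space P. \<forall>m\<in>?G. (\<exists>i\<in>{1..<n}. U i \<omega> \<in> cell L u m) = (m \<in> C)}"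
      using that by (auto simp: occupied_def)
    then show ?thesis by simp
  qed
  have fin_pat: "finite (pattern M L A :: ('d \<Rightarrow> nat) set set)"
    by (rule finite_subset[of _ "Pow ?G"]) (auto simp: pattern_def)
  have "?O = (\<Union>C\<in>pattern M L A. {\<omega> \<in> space P. occupied L u (M * L) ((\<lambda>i. U i \<omega>) ` {1..<n}) = C})"
    by auto
  also have "\<dots> \<in> sets P"
    using fin_pat by (intro sets.finite_UN occ_meas) (auto simp: pattern_def)
  finally have O: "?O \<in> sets P" .
  have B0: "?B0 \<in> sets P" by simp
  have B1: "?B1 \<in> sets P"
  proof -
    have [measurable]: "Measurable.pred P (\<lambda>\<omega>. U i' \<omega> \<prec> U i \<omega>)" "Measurable.pred P (\<lambda>\<omega>. u \<prec> U i \<omega>)"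
      if "i \<in> {1..<n}" "i' \<in> {1..<n}" for i i'
      using that by simp_all
    show ?thesis by measurable
  qed
  have B2: "?B2 \<in> sets P" by measurable
  have p0: "prob ?B0 = 0"
  proof -
    have "measure cube_law (unit_cube :: (real ^ 'd) set) = 1"
      by (simp add: measure_cube_law measure_unit_cube)
    then have "prob {\<omega> \<in> space P. \<forall>i\<in>{1..<n}. U i \<omega> \<in> unit_cube} = 1"
      by (subst prob_all_in) auto
    moreover have "?B0 = space P - {\<omega> \<in> space P. \<forall>i\<in>{1..<n}. U i \<omega> \<in> unit_cube}" by auto
    ultimately show ?thesis by (simp add: prob_compl)
  qed
  define Bad where "Bad = ?B0 \<union> (?B1 \<union> ?B2)"
  have Bad: "Bad \<in> sets P" unfolding Bad_def by (intro sets.Un B0 B1 B2)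
  have iff': "\<omega> \<in> ?R \<longleftrightarrow> \<omega> \<in> ?O" if "\<omega> \<in> space P" "\<omega> \<notin> Bad" for \<omega>
    using that unfolding Bad_def Un_iff de_Morgan_disj by (intro iff) blast+
  have sub: "?R \<subseteq> ?O \<union> Bad" "?O \<subseteq> ?R \<union> Bad"
    using iff' by blast+
  have "prob Bad \<le> prob ?B0 + prob (?B1 \<union> ?B2)"
    unfolding Bad_def by (intro measure_Un_le B0 sets.Un B1 B2)
  also have "prob (?B1 \<union> ?B2) \<le> prob ?B1 + prob ?B2"
    by (intro measure_Un_le B1 B2)
  finally have pBad: "prob Bad \<le> tail_error TYPE('d) a b M + slab_error TYPE('d) b M L"
    using p0 prob_outlying_minimum_le[OF assms(1-3), of M] prob_slab_collision_le[OF assms(3) L, of M] by linarith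
  have "prob ?R \<le> prob (?O \<union> Bad)"
    by (intro finite_measure_mono sub sets.Un O Bad)
  also have "\<dots> \<le> prob ?O + prob Bad"
    by (intro measure_Un_le O Bad)
  finally have 1: "prob ?R \<le> prob ?O + prob Bad" .
  have "prob ?O \<le> prob (?R \<union> Bad)"
    by (intro finite_measure_mono sub sets.Un R Bad)
  also have "\<dots> \<le> prob ?R + prob Bad"
    by (intro measure_Un_le R Bad)
  finally have 2: "prob ?O \<le> prob ?R + prob Bad" .
  have "\<bar>prob ?O - grid_law TYPE('d) M L A (real n * p)\<bar> \<le>
      (\<Sum>C\<in>(pattern M L A :: ('d \<Rightarrow> nat) set set). \<Sum>T\<in>Pow C.
        ((real M ^ CARD('d) * b)\<^sup>2 + real M ^ CARD('d) * b) / real n)"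
    unfolding prob_pattern[OF L Mu] grid_law_def void_sum_def sum_subtractf[symmetric]
  proof (intro order_trans[OF sum_abs] sum_mono)
    fix C T :: "('d \<Rightarrow> nat) set"
    define x where "x = real (card (?G - T)) * (real n * p / real L ^ CARD('d))"
    have x0: "0 \<le> x" using p_pos by (simp add: x_def)
    \<comment> \<open>The window has volume at most \<open>1\<close>; hence
      \<open>x \<le> n\<close>, the condition for comparing the power with the exponential.\<close>
    have Mp: "real M ^ CARD('d) * p \<le> 1"
    proof -
      have "real M ^ CARD('d) * p = (\<Prod>j\<in>UNIV. real M * u $ j)" by (simp add: prod.distrib)
      also have "\<dots> \<le> 1" using Mu u_pos by (intro prod_le_1) (auto simp: less_imp_le)
      finally show ?thesis .
    qed
    have "card (?G - T) \<le> (M * L) ^ CARD('d)"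
      using card_mono[OF finite_grid, of "?G - T" "M * L"] by (simp add: card_grid)
    then have "real (card (?G - T)) \<le> (real M * real L) ^ CARD('d)"
      by (metis of_nat_le_iff of_nat_mult of_nat_power)
    then have "x \<le> (real M * real L) ^ CARD('d) * (real n * p / real L ^ CARD('d))"
      unfolding x_def using p_pos by (intro mult_right_mono) auto
    also have "\<dots> = real M ^ CARD('d) * (real n * p)"
      using L by (simp add: power_mult_distrib)
    finally have x1: "x \<le> real M ^ CARD('d) * (real n * p)" .
    also have "\<dots> \<le> real n" using mult_left_mono[OF Mp, of "real n"] by (simp add: mult_ac)
    finally have xn: "x \<le> real n" .
    have xb: "x \<le> real M ^ CARD('d) * b"
      using order_trans[OF x1 mult_left_mono[OF assms(3)]] by simp
    have "real (card (?G - T)) * (p / real L ^ CARD('d)) = x / real n"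
      using n by (simp add: x_def)
    then have "\<bar>(1 - real (card (?G - T)) * (p / real L ^ CARD('d))) ^ (n - 1) - exp (- x)\<bar> \<le> (x\<^sup>2 + x) / real n"
      using abs_one_minus_power_diff_exp_le[OF x0 xn] n by simp
    also have "\<dots> \<le> ((real M ^ CARD('d) * b)\<^sup>2 + real M ^ CARD('d) * b) / real n"
      using x0 xb by (intro divide_right_mono add_mono power_mono) auto
    finally show "\<bar>(- 1) ^ (card C - card T) * (1 - real (card (?G - T)) * (p / real L ^ CARD('d))) ^ (n - 1) -
        (- 1) ^ (card C - card T) * exp (- (real (card (?G - T)) * (real n * p / real L ^ CARD('d))))\<bar>
        \<le> ((real M ^ CARD('d) * b)\<^sup>2 + real M ^ CARD('d) * b) / real n"
      by (simp add: x_def abs_mult flip: right_diff_distrib)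
  qed
  with 1 2 pBad show ?thesis by (simp add: abs_le_iff)
qed

end

end

section \<open>The product of the coordinates of a uniform point\<close>

text \<open>Each \<open>A j\<close> meets the unit interval in an initial segment of length
  \<open>s j\<close>. The inclusions leave membership of the endpoint undecided, so open and closed
  half-lines and the full line are all covered.\<close>

lemma measure_cube_law_product:
  fixes A :: "'d::finite \<Rightarrow> real set"
  assumes s: "\<And>j. 0 \<le> s j" "\<And>j. s j \<le> 1" and A: "\<And>j. A j \<in> sets borel"
    "\<And>j. {0<..<s j} \<subseteq> A j" "\<And>j. A j \<inter> {0<..<1} \<subseteq> {..s j}"
  shows "measure cube_law {x :: real ^ 'd. \<forall>j. x $ j \<in> A j} = (\<Prod>j\<in>UNIV. s j)"
proof -
  have meas: "{x :: real ^ 'd. \<forall>j. x $ j \<in> A j} \<in> sets borel"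
  proof -
    have "{x \<in> space borel. \<forall>j. (x :: real ^ 'd) $ j \<in> A j} \<in> sets borel"
      using A(1) by measurable
    then show ?thesis by simp
  qed
  have "measure lborel (unit_cube \<inter> {x :: real ^ 'd. \<forall>j. x $ j \<in> A j}) =
      (\<Prod>j\<in>UNIV. (\<chi> j. s j) $ j - 0 $ j)"
  proof (rule measure_eq_prod_of_box)
    show "box 0 (\<chi> j. s j) \<subseteq> unit_cube \<inter> {x :: real ^ 'd. \<forall>j. x $ j \<in> A j}"
    proof
      fix x :: "real ^ 'd" assume x: "x \<in> box 0 (\<chi> j. s j)"
      have "0 < x $ j \<and> x $ j < 1 \<and> x $ j \<in> A j" for j
        using x s(2)[of j] A(2)[of j] by (auto simp: mem_box_cart dest!: spec[of _ j])
      then show "x \<in> unit_cube \<inter> {x. \<forall>j. x $ j \<in> A j}" by (simp add: unit_cube_def)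
    qed
    show "unit_cube \<inter> {x :: real ^ 'd. \<forall>j. x $ j \<in> A j} \<subseteq> cbox 0 (\<chi> j. s j)"
    proof
      fix x :: "real ^ 'd" assume x: "x \<in> unit_cube \<inter> {x. \<forall>j. x $ j \<in> A j}"
      have "0 \<le> x $ j \<and> x $ j \<le> s j" for j
        using x A(3)[of j] by (auto simp: unit_cube_def less_imp_le)
      then show "x \<in> cbox 0 (\<chi> j. s j)" by (simp add: mem_box_cart)
    qed
  qed (use meas s in auto)
  then show ?thesis using meas by (simp add: measure_cube_law)
qed

lemma measure_cube_law_coordinate:
  assumes "0 \<le> s" "s \<le> 1" "A \<in> sets borel" "{0<..<s} \<subseteq> A" "A \<inter> {0<..<1} \<subseteq> {..s}"
  shows "measure cube_law {x :: real ^ 'd. x $ j \<in> A} = s"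
proof -
  have "{x :: real ^ 'd. x $ j \<in> A} = {x. \<forall>k. x $ k \<in> (if k = j then A else UNIV)}" by auto
  also have "measure cube_law \<dots> = (\<Prod>k\<in>UNIV. if k = j then s else 1)"
    using assms by (intro measure_cube_law_product) auto
  finally show ?thesis by simp
qed

text \<open>Independence is checked on closed half-lines, a generator stable under intersection; the
  full line is added because the criterion wants the whole space among the generating sets.\<close>

lemma indep_coordinates: "cube_law.indep_vars (\<lambda>_. borel) (\<lambda>j x :: real ^ 'd. x $ j) UNIV"
proof -
  let ?E = "insert UNIV (range (atMost :: real \<Rightarrow> real set))"
  have gen: "sets (borel :: real measure) = sigma_sets UNIV ?E"
  proof -
    have "sets (borel :: real measure) = sigma_sets UNIV (range atMost)"
      by (subst borel_eq_atMost) simp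
    also have "\<dots> = sigma_sets UNIV ?E"
      by (rule sigma_sets_eqI) (auto intro: sigma_sets_top)
    finally show ?thesis .
  qed
  have "\<forall>A\<in>(\<Pi> j\<in>UNIV. ?E). cube_law.prob (\<Inter>j\<in>UNIV. (\<lambda>x :: real ^ 'd. x $ j) -` A j \<inter> space cube_law) =
      (\<Prod>j\<in>UNIV. cube_law.prob ((\<lambda>x :: real ^ 'd. x $ j) -` A j \<inter> space cube_law))"
  proof
    fix A :: "'d \<Rightarrow> real set" assume A: "A \<in> (\<Pi> j\<in>UNIV. ?E)"
    have "\<exists>s. 0 \<le> s \<and> s \<le> 1 \<and> {0<..<s} \<subseteq> A j \<and> A j \<inter> {0<..<1} \<subseteq> {..s}" for j
    proof (cases "A j = UNIV")
      case True
      then show ?thesis by (intro exI[of _ "1 :: real"]) (simp add: subset_eq)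
    next
      case False
      moreover have "A j \<in> ?E" by (rule Pi_mem[OF A UNIV_I])
      ultimately obtain t where "A j = {..t}" by blast
      \<comment> \<open>The half-line up to \<open>t\<close> has probability \<open>t\<close>
        clamped to \<open>[0, 1]\<close>.\<close>
      then show ?thesis
        by (intro exI[of _ "max 0 (min 1 t)"] conjI subsetI) (simp_all add: less_max_iff_disj le_max_iff_disj, linarith)
    qed
    then obtain s where s: "\<And>j. 0 \<le> s j" "\<And>j. s j \<le> 1" "\<And>j. {0<..<s j} \<subseteq> A j"
      "\<And>j. A j \<inter> {0<..<1} \<subseteq> {..s j}" by metis
    have borel: "A j \<in> sets borel" for j
    proof -
      have "A j \<in> ?E" by (rule Pi_mem[OF A UNIV_I])
      then show ?thesis by auto
    qed
    have "(\<Inter>j\<in>UNIV. (\<lambda>x :: real ^ 'd. x $ j) -` A j \<inter> space cube_law) = {x. \<forall>j. x $ j \<in> A j}" by auto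
    moreover have "(\<lambda>x :: real ^ 'd. x $ j) -` A j \<inter> space cube_law = {x. x $ j \<in> A j}" for j by auto
    moreover have "measure cube_law {x :: real ^ 'd. x $ j \<in> A j} = s j" for j
      using s borel by (intro measure_cube_law_coordinate) auto
    ultimately show "cube_law.prob (\<Inter>j\<in>UNIV. (\<lambda>x :: real ^ 'd. x $ j) -` A j \<inter> space cube_law) =
      (\<Prod>j\<in>UNIV. cube_law.prob ((\<lambda>x :: real ^ 'd. x $ j) -` A j \<inter> space cube_law))"
      using measure_cube_law_product[of s A] s borel
      by simp
  qed
  then show ?thesis
    by (subst cube_law.indep_vars_finite[where E="\<lambda>_. ?E"]) (auto simp: gen Int_stable_def)
qed

lemma AE_unit_cube: "AE u in cube_law. u \<in> (unit_cube :: (real ^ 'd) set)"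
  by (rule AE_uniform_measureI) auto

lemma exponential_coordinate:
  "distributed cube_law lborel (\<lambda>u :: real ^ 'd. - ln (u $ j)) (exponential_density 1)"
proof (subst cube_law.exponential_distributed_iff, simp, intro conjI allI impI)
  fix a :: real assume a: "0 \<le> a"
  have 1: "measure cube_law {u :: real ^ 'd. u $ j \<in> {y. a < - ln y}} = exp (- a)"
  proof (rule measure_cube_law_coordinate)
    have "{y \<in> space borel. a < - ln y} \<in> sets borel" by measurable
    then show "{y. a < - ln y} \<in> sets borel" by simp
    have iff: "a < - ln y \<longleftrightarrow> y < exp (- a)" if "0 < y" for y :: real
    proof -
      have "a < - ln y \<longleftrightarrow> ln y < ln (exp (- a))" by auto
      also have "\<dots> \<longleftrightarrow> y < exp (- a)" using that by (intro ln_less_cancel_iff) auto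
      finally show ?thesis .
    qed
    show "{0<..<exp (- a)} \<subseteq> {y. a < - ln y}"
      using iff by (simp add: subset_eq)
    show "{y. a < - ln y} \<inter> {0<..<1} \<subseteq> {..exp (- a)}"
    proof
      fix y assume "y \<in> {y. a < - ln y} \<inter> {0<..<1}"
      then show "y \<in> {..exp (- a)}" using iff[of y] by simp
    qed
  qed (use a in auto)
  have "{u \<in> space cube_law. - ln (u $ j) \<le> a} = space cube_law - {u :: real ^ 'd. u $ j \<in> {y. a < - ln y}}"
    by auto
  also have "measure cube_law \<dots> = 1 - measure cube_law {u :: real ^ 'd. u $ j \<in> {y. a < - ln y}}"
  proof (rule cube_law.prob_compl)
    have "{u \<in> space borel. a < - ln ((u :: real ^ 'd) $ j)} \<in> sets borel" by measurable
    then show "{u :: real ^ 'd. u $ j \<in> {y. a < - ln y}} \<in> cube_law.events" by simp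
  qed
  finally show "cube_law.prob {u \<in> space cube_law. - ln ((u :: real ^ 'd) $ j) \<le> a} = 1 - exp (- a * 1)"
    using 1 by simp
qed simp

text \<open>A sum of \<open>card I\<close> independent unit exponentials;
  \<open>erlang_density k\<close> describes \<open>k + 1\<close> summands, whence
  \<open>card I - 1\<close>. A general \<open>I\<close> is allowed because the product with one
  coordinate left out is needed as well.\<close>

lemma erlang_log_product:
  assumes "I \<noteq> {}"
  shows "distributed cube_law lborel (\<lambda>u :: real ^ 'd. \<Sum>j\<in>I. - ln (u $ j)) (erlang_density (card I - 1) 1)"
proof (rule cube_law.exponential_distributed_sum)
  have "cube_law.indep_vars (\<lambda>_. borel) (\<lambda>j u :: real ^ 'd. - ln (u $ j)) UNIV"
    by (rule cube_law.indep_vars_compose2[OF indep_coordinates, of "\<lambda>_ y. - ln y"]) measurable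
  then show "cube_law.indep_vars (\<lambda>_. borel) (\<lambda>j u :: real ^ 'd. - ln (u $ j)) I"
    by (rule cube_law.indep_vars_subset) simp
qed (use assms exponential_coordinate in auto)

lemma sum_neg_ln_eq:
  assumes "u \<in> unit_cube"
  shows "(\<Sum>j\<in>I. - ln (u $ j)) = - ln (\<Prod>j\<in>I. u $ j)"
proof -
  have "0 < u $ j" for j using assms by (simp add: unit_cube_def)
  then have "u $ j \<noteq> 0" for j by (metis less_irrefl)
  then show ?thesis by (simp add: ln_prod sum_negf)
qed

text \<open>The Erlang tail at \<open>- ln x\<close>. The highest power of the logarithm is
  \<open>card I - 1\<close>, so leaving out one coordinate costs one logarithm.\<close>

lemma measure_small_product:
  assumes "I \<noteq> {}" "0 < x" "x \<le> 1"
  shows "measure cube_law {u :: real ^ 'd. (\<Prod>j\<in>I. u $ j) < x \<and> u \<in> unit_cube} =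
    x * (\<Sum>i\<le>card I - 1. (- ln x) ^ i / fact i)"
proof -
  have [measurable]: "(\<lambda>u :: real ^ 'd. \<Prod>j\<in>I. u $ j) \<in> borel_measurable borel" by measurable
  have "{u \<in> space borel. (\<Prod>j\<in>I. (u :: real ^ 'd) $ j) < x \<and> u \<in> unit_cube} \<in> sets borel"
    by measurable
  then have meas: "{u. (\<Prod>j\<in>I. (u :: real ^ 'd) $ j) < x \<and> u \<in> unit_cube} \<in> sets borel" by simp
  have "- ln x < (\<Sum>j\<in>I. - ln (u $ j)) \<longleftrightarrow> (\<Prod>j\<in>I. u $ j) < x" if "u \<in> unit_cube" for u :: "real ^ 'd"
  proof -
    have "0 < (\<Prod>j\<in>I. u $ j)" using that by (intro prod_pos) (auto simp: unit_cube_def)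
    then show ?thesis unfolding sum_neg_ln_eq[OF that] using assms(2) by simp
  qed
  then have "measure cube_law {u :: real ^ 'd. (\<Prod>j\<in>I. u $ j) < x \<and> u \<in> unit_cube} =
      measure cube_law {u \<in> space cube_law. - ln x < (\<Sum>j\<in>I. - ln ((u :: real ^ 'd) $ j))}"
    using meas AE_unit_cube by (intro cube_law.finite_measure_eq_AE) (auto elim!: eventually_mono)
  also have "\<dots> = 1 - erlang_CDF (card I - 1) 1 (- ln x)"
    using assms by (intro cube_law.erlang_distributed_gt[OF erlang_log_product]) auto
  also have "\<dots> = x * (\<Sum>i\<le>card I - 1. (- ln x) ^ i / fact i)"
    using assms by (simp add: erlang_CDF_def sum_distrib_left mult.commute)
  finally show ?thesis .
qed

text \<open>At \<open>k = d - 1\<close> this is the reciprocal of the asymptotic probability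
  \<open>ln n ^ (d - 1) / (n * fact (d - 1))\<close> that the \<open>n\<close>th observation is a
  record.\<close>

definition record_scale :: "nat \<Rightarrow> nat \<Rightarrow> real"
  where "record_scale k n = real n * fact k / ln (real n) ^ k"

lemma record_scale_nonneg: "0 \<le> record_scale k n"
  by (cases "n = 0") (auto simp: record_scale_def)

lemma log_power_ratio_tendsto:
  assumes "0 < c" "i \<le> k"
  shows "(\<lambda>n. (- ln (c / real n)) ^ i / ln (real n) ^ k) \<longlonglongrightarrow> (if i = k then 1 else 0)"
proof -
  have ln_top: "filterlim (\<lambda>n. ln (real n)) at_top sequentially"
    by (rule filterlim_compose[OF ln_at_top filterlim_real_sequentially])
  have inv: "(\<lambda>n. inverse (ln (real n))) \<longlonglongrightarrow> 0"
    by (rule tendsto_inverse_0_at_top[OF ln_top])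
  have "(\<lambda>n. (1 - ln c * inverse (ln (real n))) ^ i * inverse (ln (real n)) ^ (k - i)) \<longlonglongrightarrow>
      (1 - ln c * 0) ^ i * 0 ^ (k - i)"
    by (intro tendsto_intros inv)
  also have "(1 - ln c * 0) ^ i * 0 ^ (k - i) = (if i = k then 1 else (0 :: real))"
    using assms by (auto simp: power_0_left)
  finally show ?thesis
  proof (rule Lim_transform_eventually)
    show "eventually (\<lambda>n. (1 - ln c * inverse (ln (real n))) ^ i * inverse (ln (real n)) ^ (k - i) =
        (- ln (c / real n)) ^ i / ln (real n) ^ k) sequentially"
      using eventually_gt_at_top[of 1]
    proof eventually_elim
      case (elim n)
      then have l: "0 < ln (real n)" by simp
      have "1 - ln c * inverse (ln (real n)) = (- ln (c / real n)) / ln (real n)"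
        using l elim assms by (simp add: ln_div field_simps)
      moreover have "ln (real n) ^ k = ln (real n) ^ i * ln (real n) ^ (k - i)"
        using assms by (simp flip: power_add)
      ultimately show ?case
        by (simp only: power_divide) (simp add: divide_inverse power_inverse mult.assoc)
    qed
  qed
qed

text \<open>Only the top power of the logarithm can survive the scaling. With all coordinates and
  \<open>k = d - 1\<close> this measures the mass of small \<open>w\<close>; with one coordinate
  left out the limit \<open>0\<close> shows that large coordinates are negligible.\<close>

lemma scaled_small_product_tendsto:
  assumes "I \<noteq> {}" "0 < c" "card I - 1 \<le> k"
  shows "(\<lambda>n. record_scale k n * measure cube_law {u :: real ^ 'd. (\<Prod>j\<in>I. u $ j) < c / real n \<and> u \<in> unit_cube})
    \<longlonglongrightarrow> (if card I - 1 = k then c else 0)"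
proof -
  have "(\<lambda>n. fact k * c * (\<Sum>i\<le>card I - 1. (- ln (c / real n)) ^ i / ln (real n) ^ k / fact i)) \<longlonglongrightarrow>
      fact k * c * (\<Sum>i\<le>card I - 1. (if i = k then 1 else 0) / fact i)"
    using assms by (intro tendsto_mult tendsto_const tendsto_sum tendsto_divide log_power_ratio_tendsto) auto
  also have "fact k * c * (\<Sum>i\<le>card I - 1. (if i = k then 1 else 0) / fact i) =
      fact k * c * (\<Sum>i\<le>card I - 1. if i = k then 1 / fact k else 0)"
    by (intro arg_cong[where f="(*) (fact k * c)"] sum.cong) auto
  also have "\<dots> = (if card I - 1 = k then c else 0)"
    using assms by (auto simp: sum.delta)
  finally show ?thesis
  proof (rule Lim_transform_eventually)
    have "eventually (\<lambda>n. c \<le> real n) sequentially"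
      using filterlim_real_sequentially filterlim_at_top by blast
    then show "eventually (\<lambda>n. fact k * c * (\<Sum>i\<le>card I - 1. (- ln (c / real n)) ^ i / ln (real n) ^ k / fact i) =
        record_scale k n * measure cube_law {u :: real ^ 'd. (\<Prod>j\<in>I. u $ j) < c / real n \<and> u \<in> unit_cube}) sequentially"
      using eventually_gt_at_top[of 0]
    proof eventually_elim
      case (elim n)
      then have "measure cube_law {u :: real ^ 'd. (\<Prod>j\<in>I. u $ j) < c / real n \<and> u \<in> unit_cube} =
          c / real n * (\<Sum>i\<le>card I - 1. (- ln (c / real n)) ^ i / fact i)"
        using assms by (intro measure_small_product) auto
      then show ?case
        using elim by (simp add: record_scale_def sum_distrib_left sum_divide_distrib mult.assoc)
    qed
  qed
qed

text \<open>The substitution \<open>t = ln n - y\<close> in the Erlang integral, so that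
  \<open>w = exp y\<close>. The scale cancels \<open>n\<close>, the factorial and the leading power
  of \<open>ln n\<close>, leaving the correction \<open>(1 - y / ln n) ^ k\<close>, which tends to
  \<open>1\<close>; and \<open>exp y\<close> is the density of \<open>w\<close> in the variable
  \<open>y\<close>.\<close>

lemma scaled_law_product:
  fixes \<phi> :: "real \<Rightarrow> real"
  assumes [measurable]: "\<phi> \<in> borel_measurable borel" and n: "2 \<le> n"
  defines "k \<equiv> CARD('d) - 1"
  shows "record_scale k n * (\<integral>u. \<phi> (real n * (\<Prod>j\<in>UNIV. (u :: real ^ 'd) $ j)) \<partial>cube_law) =
    (\<integral>y. indicator {..ln (real n)} y * (1 - y / ln (real n)) ^ k * exp y * \<phi> (exp y) \<partial>lborel)"
proof -
  have l: "0 < ln (real n)" using n by simp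
  let ?T = "\<lambda>u :: real ^ 'd. \<Sum>j\<in>UNIV. - ln (u $ j)"
  have [measurable]: "(\<lambda>u :: real ^ 'd. \<Prod>j\<in>UNIV. u $ j) \<in> borel_measurable borel" by measurable
  have "(\<integral>u. \<phi> (real n * (\<Prod>j\<in>UNIV. (u :: real ^ 'd) $ j)) \<partial>cube_law) = (\<integral>u. \<phi> (real n * exp (- ?T u)) \<partial>cube_law)"
  proof (rule integral_cong_AE)
    show "AE u :: real ^ 'd in cube_law. \<phi> (real n * (\<Prod>j\<in>UNIV. u $ j)) = \<phi> (real n * exp (- ?T u))"
      using AE_unit_cube
    proof eventually_elim
      case (elim u)
      have "0 < (\<Prod>j\<in>UNIV. u $ j)" using elim by (intro prod_pos) (auto simp: unit_cube_def)
      then show ?case unfolding sum_neg_ln_eq[OF elim] by simp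
    qed
  qed measurable
  also have "\<dots> = (\<integral>t. erlang_density k 1 t * \<phi> (real n * exp (- t)) \<partial>lborel)"
    unfolding k_def by (rule distributed_integral[OF erlang_log_product, symmetric]) auto
  also have "\<dots> = (\<integral>y. erlang_density k 1 (ln (real n) + (- 1) * y) * \<phi> (real n * exp (- (ln (real n) + (- 1) * y))) \<partial>lborel)"
    by (subst lborel_integral_real_affine[where c="- 1" and t="ln (real n)"]) auto
  finally have "record_scale k n * (\<integral>u. \<phi> (real n * (\<Prod>j\<in>UNIV. (u :: real ^ 'd) $ j)) \<partial>cube_law) =
      (\<integral>y. record_scale k n * (erlang_density k 1 (ln (real n) + (- 1) * y) * \<phi> (real n * exp (- (ln (real n) + (- 1) * y)))) \<partial>lborel)"
    by simp
  also have "\<dots> = (\<integral>y. indicator {..ln (real n)} y * (1 - y / ln (real n)) ^ k * exp y * \<phi> (exp y) \<partial>lborel)"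
  proof (intro Bochner_Integration.integral_cong refl)
    fix y :: real
    have e: "exp (- (ln (real n) + (- 1) * y)) = exp y / real n"
      using n by (simp add: exp_diff)
    have "(ln (real n) - y) ^ k = ln (real n) ^ k * (1 - y / ln (real n)) ^ k"
      using l by (simp add: field_simps flip: power_mult_distrib)
    then show "record_scale k n * (erlang_density k 1 (ln (real n) + (- 1) * y) * \<phi> (real n * exp (- (ln (real n) + (- 1) * y)))) =
        indicator {..ln (real n)} y * (1 - y / ln (real n)) ^ k * exp y * \<phi> (exp y)"
      using n l e by (auto simp: erlang_density_def record_scale_def indicator_def)
  qed
  finally show ?thesis .
qed

lemma scaled_law_product_tendsto:
  fixes \<phi> :: "real \<Rightarrow> real"
  assumes [measurable]: "\<phi> \<in> borel_measurable borel" and ab: "0 < a" "a \<le> b" and cont: "continuous_on {a..b} \<phi>"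
  defines "k \<equiv> CARD('d) - 1"
  shows "(\<lambda>n. record_scale k n * (\<integral>u. \<phi> (real n * (\<Prod>j\<in>UNIV. (u :: real ^ 'd) $ j)) *
      indicator {a..b} (real n * (\<Prod>j\<in>UNIV. (u :: real ^ 'd) $ j)) \<partial>cube_law)) \<longlonglongrightarrow> (LBINT w:{a..b}. \<phi> w)"
proof -
  have ln_top: "filterlim (\<lambda>n. ln (real n)) at_top sequentially"
    by (rule filterlim_compose[OF ln_at_top filterlim_real_sequentially])
  have inv: "(\<lambda>n. inverse (ln (real n))) \<longlonglongrightarrow> 0"
    by (rule tendsto_inverse_0_at_top[OF ln_top])
  obtain B where B: "\<And>w. w \<in> {a..b} \<Longrightarrow> \<bar>\<phi> w\<bar> \<le> B"
  proof -
    have "bounded (\<phi> ` {a..b})"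
      by (intro compact_imp_bounded compact_continuous_image cont compact_Icc)
    then obtain B where "\<forall>x\<in>\<phi> ` {a..b}. norm x \<le> B" unfolding bounded_iff by blast
    then show ?thesis by (intro that[of B]) simp
  qed
  have B0: "0 \<le> B" using B[of a] ab by auto
  define Y where "Y = max \<bar>ln a\<bar> \<bar>ln b\<bar>"
  let ?f = "\<lambda>n y. indicator {..ln (real n)} y * (1 - y / ln (real n)) ^ k * exp y * (\<phi> (exp y) * indicator {a..b} (exp y))"
  have ind: "indicator {a..b} (exp y) = (indicator {ln a..ln b} y :: real)" for y
    using ab ln_ge_iff[of a y] by (auto simp: indicator_def ln_ge_iff) (metis exp_le_cancel_iff exp_ln less_le_trans)+
  \<comment> \<open>From \<open>n = 3\<close> on \<open>ln n\<close> is at least \<open>1\<close>,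
    so the correction factor is at most \<open>(1 + \<bar>y\<bar>) ^ k\<close> in absolute value,
    uniformly in \<open>n\<close>.\<close>
  have ln1: "1 \<le> ln (real (n + 3))" for n
  proof -
    have "exp 1 \<le> real (n + 3)" using exp_le by simp
    then show ?thesis by (subst ln_ge_iff) auto
  qed
  have "(\<lambda>n. \<integral>y. ?f (n + 3) y \<partial>lborel) \<longlonglongrightarrow> (\<integral>y. exp y * (\<phi> (exp y) * indicator {a..b} (exp y)) \<partial>lborel)"
  proof (rule integral_dominated_convergence[where w="\<lambda>y. (1 + Y) ^ k * b * B * indicator {ln a..ln b} y"])
    show "AE y in lborel. (\<lambda>n. ?f (n + 3) y) \<longlonglongrightarrow> exp y * (\<phi> (exp y) * indicator {a..b} (exp y))"
    proof (rule AE_I2)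
      fix y :: real
      have "(\<lambda>n. (1 - y * inverse (ln (real n))) ^ k * exp y * (\<phi> (exp y) * indicator {a..b} (exp y))) \<longlonglongrightarrow>
          (1 - y * 0) ^ k * exp y * (\<phi> (exp y) * indicator {a..b} (exp y))"
        by (intro tendsto_intros inv)
      moreover have "eventually (\<lambda>n. y \<le> ln (real n)) sequentially"
        using ln_top unfolding filterlim_at_top by blast
      then have "eventually (\<lambda>n. (1 - y * inverse (ln (real n))) ^ k * exp y * (\<phi> (exp y) * indicator {a..b} (exp y)) = ?f n y) sequentially"
        by eventually_elim (simp add: divide_inverse)
      ultimately have "(\<lambda>n. ?f n y) \<longlonglongrightarrow> (1 - y * 0) ^ k * exp y * (\<phi> (exp y) * indicator {a..b} (exp y))"
        by (rule Lim_transform_eventually)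
      then show "(\<lambda>n. ?f (n + 3) y) \<longlonglongrightarrow> exp y * (\<phi> (exp y) * indicator {a..b} (exp y))"
        by (intro LIMSEQ_ignore_initial_segment) simp
    qed
    show "AE y in lborel. norm (?f (n + 3) y) \<le> (1 + Y) ^ k * b * B * indicator {ln a..ln b} y" for n
    proof (rule AE_I2)
      fix y :: real
      show "norm (?f (n + 3) y) \<le> (1 + Y) ^ k * b * B * indicator {ln a..ln b} y"
      proof (cases "y \<in> {ln a..ln b}")
        case True
        then have y: "\<bar>y\<bar> \<le> Y" "exp y \<le> b" "exp y \<in> {a..b}"
          using ab ind[of y] by (auto simp: Y_def indicator_def split: if_splits)
        define l where "l = ln (real (n + 3))"
        have "1 \<le> l" unfolding l_def by (rule ln1)
        then have "\<bar>1 - y / l\<bar> \<le> 1 + \<bar>y\<bar> / l" using abs_triangle_ineq4[of 1 "y / l"] by (simp add: abs_divide)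
        also have "\<bar>y\<bar> / l \<le> \<bar>y\<bar>" using ln1[of n] mult_left_mono[of 1 l "\<bar>y\<bar>"] by (simp add: l_def divide_le_eq)
        finally have 1: "\<bar>1 - y / l\<bar> \<le> 1 + Y" using y by simp
        have "norm (?f (n + 3) y) \<le> 1 * \<bar>1 - y / l\<bar> ^ k * exp y * (\<bar>\<phi> (exp y)\<bar> * 1)"
          unfolding l_def
          by (simp only: real_norm_def abs_mult power_abs abs_exp_cancel, intro mult_mono)
            (auto simp: indicator_def)
        also have "\<dots> \<le> 1 * (1 + Y) ^ k * b * (B * 1)"
          using 1 y B ab B0 by (intro mult_mono power_mono) auto
        finally show ?thesis using True by simp
      qed (simp add: ind)
    qed
    show "integrable lborel (\<lambda>y. (1 + Y) ^ k * b * B * indicator {ln a..ln b} y)"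
      by (intro integrable_mult_right integrable_real_indicator) (simp_all add: emeasure_lborel_Icc_eq)
  qed measurable
  then have "(\<lambda>n. \<integral>y. ?f n y \<partial>lborel) \<longlonglongrightarrow> (\<integral>y. exp y * (\<phi> (exp y) * indicator {a..b} (exp y)) \<partial>lborel)"
    by (rule LIMSEQ_offset)
  also have "(\<integral>y. exp y * (\<phi> (exp y) * indicator {a..b} (exp y)) \<partial>lborel) =
      (LBINT y. \<phi> (exp y) * exp y * indicator {ln a..ln b} y)"
    by (intro Bochner_Integration.integral_cong) (auto simp: ind)
  also have "\<dots> = (LBINT w. \<phi> w * indicator {exp (ln a)..exp (ln b)} w)"
  proof (rule integral_substitution(2)[symmetric])
    show "set_integrable lborel {exp (ln a)..exp (ln b)} \<phi>"
      using ab cont by (intro borel_integrable_atLeastAtMost') auto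
  qed (use ab in \<open>auto intro!: derivative_eq_intros continuous_intros\<close>)
  also have "\<dots> = (LBINT w:{a..b}. \<phi> w)"
    using ab by (simp add: set_lebesgue_integral_def mult.commute)
  finally show ?thesis
  proof (rule Lim_transform_eventually)
    show "eventually (\<lambda>n. (\<integral>y. ?f n y \<partial>lborel) = record_scale k n * (\<integral>u. \<phi> (real n * (\<Prod>j\<in>UNIV. (u :: real ^ 'd) $ j)) *
      indicator {a..b} (real n * (\<Prod>j\<in>UNIV. (u :: real ^ 'd) $ j)) \<partial>cube_law)) sequentially"
      using eventually_ge_at_top[of 2]
    proof eventually_elim
      case (elim n)
      show ?case
        unfolding k_def
        by (rule scaled_law_product[of "\<lambda>w. \<phi> w * indicator {a..b} w", OF _ elim, symmetric]) measurable
    qed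
  qed
qed

text \<open>As \<open>b \<ge> 1\<close>, only \<open>y \<ge> 0\<close> contributes, where the
  correction factor is at most \<open>1\<close>. Hence the bound, the integral of
  \<open>exp (- w / 2)\<close> from \<open>b\<close> on, is uniform in \<open>n\<close>.\<close>

lemma scaled_exp_tail_le:
  assumes b: "1 \<le> b" and n: "2 \<le> n"
  shows "record_scale (CARD('d) - 1) n * (\<integral>u. exp (- (real n * (\<Prod>j\<in>UNIV. (u :: real ^ 'd) $ j) / 2)) *
      indicator {b<..} (real n * (\<Prod>j\<in>UNIV. (u :: real ^ 'd) $ j)) \<partial>cube_law) \<le> 2 * exp (- b / 2)"
proof -
  have l: "0 < ln (real n)" using n by simp
  let ?k = "CARD('d) - 1"
  let ?g = "\<lambda>y. exp y * exp (- (exp y / 2)) * indicator {ln b..} y :: real"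
  have "(\<integral>\<^sup>+y. ennreal (exp y * exp (- (exp y / 2))) * indicator {ln b..} y \<partial>lborel) = ennreal (0 - (- 2 * exp (- (exp (ln b) / 2))))"
  proof (rule nn_integral_FTC_atLeast)
    show "((\<lambda>y. - 2 * exp (- (exp y / 2))) \<longlongrightarrow> (0 :: real)) at_top"
    proof -
      have "filterlim (\<lambda>y :: real. 1 / 2 * exp y) at_top at_top"
        by (rule filterlim_tendsto_pos_mult_at_top[OF tendsto_const _ exp_at_top]) simp
      then have "filterlim (\<lambda>y :: real. - (exp y / 2)) at_bot at_top"
        by (simp add: filterlim_uminus_at_top)
      from tendsto_mult[OF tendsto_const[of "- 2"] filterlim_compose[OF exp_at_bot this]] show ?thesis
        by simp
    qed
  qed (auto intro!: derivative_eq_intros)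
  also have "0 - (- 2 * exp (- (exp (ln b) / 2))) = 2 * exp (- b / 2)"
    using b by simp
  also have "(\<integral>\<^sup>+y. ennreal (exp y * exp (- (exp y / 2))) * indicator {ln b..} y \<partial>lborel) = (\<integral>\<^sup>+y. ennreal (?g y) \<partial>lborel)"
    by (intro nn_integral_cong) (simp add: indicator_def)
  finally have nn: "(\<integral>\<^sup>+y. ennreal (?g y) \<partial>lborel) = ennreal (2 * exp (- b / 2))" .
  have int: "integrable lborel ?g"
    by (rule integrableI_nonneg) (simp_all add: nn)
  have val: "(\<integral>y. ?g y \<partial>lborel) = 2 * exp (- b / 2)"
    by (rule integral_eq_nn_integral[THEN trans]) (simp_all add: nn)
  have "record_scale ?k n * (\<integral>u. exp (- (real n * (\<Prod>j\<in>UNIV. (u :: real ^ 'd) $ j) / 2)) *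
      indicator {b<..} (real n * (\<Prod>j\<in>UNIV. (u :: real ^ 'd) $ j)) \<partial>cube_law) =
    (\<integral>y. indicator {..ln (real n)} y * (1 - y / ln (real n)) ^ ?k * exp y * (exp (- (exp y / 2)) * indicator {b<..} (exp y)) \<partial>lborel)"
    by (rule scaled_law_product[of "\<lambda>w. exp (- (w / 2)) * indicator {b<..} w", OF _ n]) measurable
  also have "\<dots> \<le> (\<integral>y. ?g y \<partial>lborel)"
  proof (rule integral_mono_AE'[OF int])
    show "AE y in lborel. indicator {..ln (real n)} y * (1 - y / ln (real n)) ^ ?k * exp y * (exp (- (exp y / 2)) * indicator {b<..} (exp y)) \<le> ?g y"
    proof (rule AE_I2)
      fix y :: real
      show "indicator {..ln (real n)} y * (1 - y / ln (real n)) ^ ?k * exp y * (exp (- (exp y / 2)) * indicator {b<..} (exp y)) \<le> ?g y"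
      proof (cases "y \<le> ln (real n) \<and> b < exp y")
        case True
        then have "ln b \<le> y" using b by (metis ln_exp ln_le_cancel_iff exp_gt_zero less_imp_le less_le_trans zero_less_one)
        moreover have "0 \<le> ln b" using b by simp
        ultimately have "0 \<le> 1 - y / ln (real n)" "1 - y / ln (real n) \<le> 1"
          using True l by auto
        then have "(1 - y / ln (real n)) ^ ?k \<le> 1" by (rule power_le_one)
        then have "(1 - y / ln (real n)) ^ ?k * (exp y * exp (- (exp y / 2))) \<le> 1 * (exp y * exp (- (exp y / 2)))"
          by (intro mult_right_mono) auto
        then show ?thesis using True \<open>ln b \<le> y\<close> by (simp add: mult.assoc)
      qed (auto simp: indicator_def)
    qed
  qed (auto simp: indicator_def)
  finally show ?thesis using val by simp
qed

text \<open>If one coordinate exceeds \<open>\<delta>\<close>, the product of the other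
  \<open>d - 1\<close> is below \<open>b / (\<delta> * n)\<close>, an event whose probability has
  one power of \<open>ln n\<close> less than the scale removes.\<close>

lemma scaled_large_coordinate_tendsto:
  assumes "0 < \<delta>" "0 < b"
  shows "(\<lambda>n. record_scale (CARD('d) - 1) n * measure cube_law {u :: real ^ 'd.
      u \<in> unit_cube \<and> \<delta> < u $ j \<and> real n * (\<Prod>j\<in>UNIV. u $ j) \<le> b}) \<longlonglongrightarrow> 0"
proof -
  let ?E = "\<lambda>n. {u :: real ^ 'd. u \<in> unit_cube \<and> \<delta> < u $ j \<and> real n * (\<Prod>j\<in>UNIV. u $ j) \<le> b}"
  have split: "(\<Prod>j\<in>UNIV. u $ j) = u $ j * (\<Prod>i\<in>UNIV - {j}. u $ i)" for u :: "real ^ 'd"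
    by (rule prod.remove) auto
  show ?thesis
  proof (cases "UNIV - {j} = {}")
    \<comment> \<open>In dimension \<open>1\<close> no other coordinate remains; there the event
      itself is empty once \<open>n * \<delta> > b\<close>.\<close>
    case True
    have "eventually (\<lambda>n. b / \<delta> < real n) sequentially"
      using filterlim_real_sequentially filterlim_at_top_dense by blast
    then have "eventually (\<lambda>n. 0 = record_scale (CARD('d) - 1) n * measure cube_law (?E n)) sequentially"
      using eventually_gt_at_top[of 0]
    proof eventually_elim
      case (elim n)
      have "u \<notin> ?E n" for u
      proof
        assume u: "u \<in> ?E n"
        then have "real n * \<delta> < real n * u $ j" using elim by simp
        also have "\<dots> \<le> b" using u unfolding mem_Collect_eq split True by simp
        finally show False using elim assms by (simp add: field_simps)
      qed
      then have "?E n = {}" by blast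
      then show ?case by (simp only: measure_empty mult_zero_right)
    qed
    then show ?thesis by (rule Lim_transform_eventually[OF tendsto_const])
  next
    case False
    define I where "I = UNIV - {j}"
    have card: "card I = CARD('d) - 1" by (simp add: I_def)
    have "I \<noteq> {}" using False by (simp only: I_def not_False_eq_True)
    then have "card I \<noteq> 0" by (simp add: card_eq_0_iff)
    then have card': "card I - 1 \<noteq> CARD('d) - 1" "card I - 1 \<le> CARD('d) - 1" using card by auto
    have "(\<lambda>n. record_scale (CARD('d) - 1) n * measure cube_law {u :: real ^ 'd. (\<Prod>j\<in>I. u $ j) < (b / \<delta>) / real n \<and> u \<in> unit_cube}) \<longlonglongrightarrow> 0"
      using scaled_small_product_tendsto[of I "b / \<delta>" "CARD('d) - 1"] card' False assms by (simp add: I_def)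
    then show ?thesis
    proof (rule tendsto_sandwich[OF _ _ tendsto_const, rotated 2])
      show "eventually (\<lambda>n. record_scale (CARD('d) - 1) n * measure cube_law (?E n) \<le>
          record_scale (CARD('d) - 1) n * measure cube_law {u :: real ^ 'd. (\<Prod>j\<in>I. u $ j) < (b / \<delta>) / real n \<and> u \<in> unit_cube}) sequentially"
        using eventually_gt_at_top[of 0]
      proof eventually_elim
        case (elim n)
        have "?E n \<subseteq> {u. (\<Prod>j\<in>I. u $ j) < (b / \<delta>) / real n \<and> u \<in> unit_cube}"
        proof
          fix u assume u: "u \<in> ?E n"
          have "0 < (\<Prod>i\<in>I. u $ i)" using u by (intro prod_pos) (auto simp: unit_cube_def)
          then have "real n * (\<delta> * (\<Prod>i\<in>I. u $ i)) < real n * (u $ j * (\<Prod>i\<in>I. u $ i))"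
            using u elim by simp
          also have "\<dots> \<le> b" using u by (simp add: split I_def)
          finally show "u \<in> {u. (\<Prod>j\<in>I. u $ j) < (b / \<delta>) / real n \<and> u \<in> unit_cube}"
            using u elim assms by (simp add: field_simps)
        qed
        moreover have "{u \<in> space borel. (\<Prod>j\<in>I. (u :: real ^ 'd) $ j) < (b / \<delta>) / real n \<and> u \<in> unit_cube} \<in> sets borel"
          by measurable
        ultimately show ?case
          by (intro mult_left_mono cube_law.finite_measure_mono record_scale_nonneg) auto
      qed
    qed (auto intro!: always_eventually mult_nonneg_nonneg record_scale_nonneg)
  qed
qed

section \<open>Averaging over the newest observation\<close>

lemma record_event_cong:
  "(\<And>i. i \<in> J \<Longrightarrow> x i = y i) \<Longrightarrow> record_event J x u A \<longleftrightarrow> record_event J y u A"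
  unfolding record_event_def by (simp cong: conj_cong)

text \<open>A record remaining at time \<open>n - 1\<close> can stop remaining at time
  \<open>n\<close> only because the newest point itself lies below it.\<close>

lemma kill_count_eq:
  assumes "1 \<le> n"
  shows "kill_count x n = (if \<forall>i\<in>{1..<n}. \<not> x i \<prec> x n
    then int (card {i \<in> {1..<n}. x n \<prec> x i \<and> (\<forall>i'\<in>{1..<n}. \<not> x i' \<prec> x i)}) else - 1)"
proof -
  have "new_record x n \<longleftrightarrow> (\<forall>i\<in>{1..<n}. \<not> x i \<prec> x n)"
    by (auto simp: new_record_def)
  moreover have "killed_records x n = {i \<in> {1..<n}. x n \<prec> x i \<and> (\<forall>i'\<in>{1..<n}. \<not> x i' \<prec> x i)}"
  proof -
    have "i \<le> n \<longleftrightarrow> i \<le> n - 1 \<or> i = n" for i using assms by auto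
    then show ?thesis
      using assms by (auto simp: killed_records_def remaining_record_def)
  qed
  ultimately show ?thesis by (simp add: kill_count_def)
qed

text \<open>The value \<open>-1\<close> is not in the image of \<open>int\<close>, so membership
  already contains the record condition.\<close>

lemma kill_count_in_iff:
  assumes "1 \<le> n"
  shows "kill_count x n \<in> int ` A \<longleftrightarrow> record_event {1..<n} x (x n) A"
  unfolding kill_count_eq[OF assms] record_event_def by auto

lemma continuous_on_grid_law: "continuous_on X (grid_law TYPE('d::finite) M L A)"
  unfolding grid_law_def void_sum_def divide_inverse by (intro continuous_intros)

lemma borel_measurable_grid_law [measurable]: "grid_law TYPE('d::finite) M L A \<in> borel_measurable borel"
  by (intro borel_measurable_continuous_onI continuous_on_grid_law)

text \<open>A crude count of terms, obtained from the formula without any Poisson process. It is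
  applied only on the negligible set where some coordinate of \<open>u\<close> is large, so its size
  is irrelevant.\<close>

lemma grid_law_bounded:
  "\<exists>H. 0 \<le> H \<and> (\<forall>w\<ge>0. \<bar>grid_law TYPE('d::finite) M L A w\<bar> \<le> H)"
proof (intro exI conjI allI impI)
  fix w :: real assume w: "0 \<le> w"
  show "\<bar>grid_law TYPE('d) M L A w\<bar> \<le> (\<Sum>C\<in>(pattern M L A :: ('d \<Rightarrow> nat) set set). \<Sum>T\<in>Pow C. 1)"
    unfolding grid_law_def void_sum_def
    using w by (intro order_trans[OF sum_abs] sum_mono) (auto simp: abs_mult)
qed (auto intro: sum_nonneg)

text \<open>The three contributions to the scaled error: from \<open>w\<close> in
  \<open>[a, b]\<close>, an interval of limiting mass \<open>b - a\<close>; from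
  \<open>w < a\<close>, of limiting mass \<open>a\<close>; and from \<open>w > b\<close>, by the
  exponential tail.\<close>

definition approx_error :: "('d::finite) itself \<Rightarrow> real \<Rightarrow> real \<Rightarrow> nat \<Rightarrow> nat \<Rightarrow> real"
  where "approx_error T a b M L =
    (b - a) * (tail_error T a b M + slab_error T b M L) + a + 2 * exp (- b / 2)"

section \<open>Integrating out the newest observation\<close>

context cube_sample
begin

definition record_prob :: "nat \<Rightarrow> nat set \<Rightarrow> real"
  where "record_prob n A = prob {\<omega> \<in> space P. record_event {1..<n} (\<lambda>i. U i \<omega>) (U n \<omega>) A}"

lemma record_event_sets:
  "{\<omega> \<in> space P. record_event {1..<n} (\<lambda>i. U i \<omega>) u A} \<in> sets P"
  "1 \<le> n \<Longrightarrow> {\<omega> \<in> space P. record_event {1..<n} (\<lambda>i. U i \<omega>) (U n \<omega>) A} \<in> sets P"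
  using record_event_measurable[of "{1..<n}" "\<lambda>\<omega> i. U i \<omega>" P "\<lambda>_. u" A]
    record_event_measurable[of "{1..<n}" "\<lambda>\<omega> i. U i \<omega>" P "U n" A] by auto

text \<open>The blocks of indices \<open>{n}\<close> and \<open>{1..<n}\<close> are independent, so
  their joint law is a product and Fubini applies. Measurability of \<open>G\<close> comes from the
  slices of a measurable set; restricting the sample to its block is harmless because the record
  event looks at no other indices.\<close>

lemma record_prob_eq_integral:
  fixes A :: "nat set"
  assumes n: "1 \<le> n"
  defines "G \<equiv> \<lambda>u. prob {\<omega> \<in> space P. record_event {1..<n} (\<lambda>i. U i \<omega>) u A}"
  shows "G \<in> borel_measurable borel" and "record_prob n A = (\<integral>u. G u \<partial>cube_law)"
proof -
  let ?N = "PiM {1..<n} (\<lambda>_. borel :: (real ^ 'd) measure)"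
  let ?M = "PiM {n} (\<lambda>_. borel :: (real ^ 'd) measure)"
  let ?X = "\<lambda>\<omega>. restrict (\<lambda>i. U i \<omega>) {1..<n}"
  let ?Y = "\<lambda>\<omega>. restrict (\<lambda>i. U i \<omega>) {n}"
  have ind: "indep_var ?M ?Y ?N ?X"
    using n by (intro indep_var_restrict[OF indep]) auto
  have X [measurable]: "?X \<in> measurable P ?N"
    by (intro measurable_restrict U_measurable) auto
  have Y [measurable]: "?Y \<in> measurable P ?M"
    using n by (intro measurable_restrict U_measurable) auto
  have U: "U n \<in> borel_measurable P" using n by (rule U_measurable)
  interpret N: prob_space "distr P ?N ?X" by (rule prob_space_distr) measurable
  have slice: "emeasure (distr P ?N ?X) {x \<in> space ?N. record_event {1..<n} x u A} = ennreal (G u)" for u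
  proof -
    have "Measurable.pred ?N (\<lambda>x. record_event {1..<n} x u A)"
      by (intro record_event_measurable) auto
    then have "{x \<in> space ?N. record_event {1..<n} x u A} \<in> sets ?N" by measurable
    then have "emeasure (distr P ?N ?X) {x \<in> space ?N. record_event {1..<n} x u A} =
        emeasure P (?X -` {x \<in> space ?N. record_event {1..<n} x u A} \<inter> space P)"
      by (intro emeasure_distr X)
    also have "?X -` {x \<in> space ?N. record_event {1..<n} x u A} \<inter> space P = {\<omega> \<in> space P. record_event {1..<n} (\<lambda>i. U i \<omega>) u A}"
    proof -
      have "record_event {1..<n} (?X \<omega>) u A = record_event {1..<n} (\<lambda>i. U i \<omega>) u A" for \<omega>
        by (rule record_event_cong) simp
      then show ?thesis by (auto simp: space_PiM)
    qed
    finally show ?thesis unfolding G_def emeasure_eq_measure .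
  qed
  have meas1: "Measurable.pred (borel \<Otimes>\<^sub>M ?N) (\<lambda>z. record_event {1..<n} (snd z) (fst z) A)"
    by (intro record_event_measurable measurable_compose[OF measurable_snd measurable_component_singleton]) auto
  define E where "E = {z \<in> space (borel \<Otimes>\<^sub>M ?N). record_event {1..<n} (snd z) (fst z) A}"
  have "E \<in> sets (borel \<Otimes>\<^sub>M ?N)" unfolding E_def using meas1 by measurable
  then have E: "E \<in> sets (borel \<Otimes>\<^sub>M distr P ?N ?X)"
    by (simp cong: sets_pair_measure_cong)
  have E_slice: "Pair u -` E = {x \<in> space ?N. record_event {1..<n} x u A}" for u
    by (auto simp: E_def space_pair_measure)
  have "(\<lambda>u. ennreal (G u)) \<in> borel_measurable borel"
    using N.measurable_emeasure_Pair[OF E] unfolding E_slice slice .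
  then have "(\<lambda>u. enn2real (ennreal (G u))) \<in> borel_measurable borel"
    by measurable
  then show G: "G \<in> borel_measurable borel" by (simp add: G_def)
  have meas2: "Measurable.pred (?M \<Otimes>\<^sub>M ?N) (\<lambda>z. record_event {1..<n} (snd z) (fst z n) A)"
    by (intro record_event_measurable measurable_compose[OF measurable_snd measurable_component_singleton]
        measurable_compose[OF measurable_fst measurable_component_singleton]) auto
  define F where "F = {z \<in> space (?M \<Otimes>\<^sub>M ?N). record_event {1..<n} (snd z) (fst z n) A}"
  have F: "F \<in> sets (?M \<Otimes>\<^sub>M ?N)" unfolding F_def using meas2 by measurable
  then have F': "F \<in> sets (distr P ?M ?Y \<Otimes>\<^sub>M distr P ?N ?X)"
    by (simp cong: sets_pair_measure_cong)
  have pair: "(\<lambda>\<omega>. (?Y \<omega>, ?X \<omega>)) \<in> measurable P (?M \<Otimes>\<^sub>M ?N)"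
    using X Y by (rule measurable_Pair[rotated])
  have "ennreal (record_prob n A) = emeasure P ((\<lambda>\<omega>. (?Y \<omega>, ?X \<omega>)) -` F \<inter> space P)"
  proof -
    have "record_event {1..<n} (?X \<omega>) (U n \<omega>) A = record_event {1..<n} (\<lambda>i. U i \<omega>) (U n \<omega>) A" for \<omega>
      by (rule record_event_cong) simp
    then have "(\<lambda>\<omega>. (?Y \<omega>, ?X \<omega>)) -` F \<inter> space P =
        {\<omega> \<in> space P. record_event {1..<n} (\<lambda>i. U i \<omega>) (U n \<omega>) A}"
      by (auto simp: F_def space_pair_measure space_PiM)
    then show ?thesis by (simp add: record_prob_def emeasure_eq_measure)
  qed
  also have "\<dots> = emeasure (distr P (?M \<Otimes>\<^sub>M ?N) (\<lambda>\<omega>. (?Y \<omega>, ?X \<omega>))) F"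
    using F pair by (intro emeasure_distr[symmetric])
  also have "distr P (?M \<Otimes>\<^sub>M ?N) (\<lambda>\<omega>. (?Y \<omega>, ?X \<omega>)) = distr P ?M ?Y \<Otimes>\<^sub>M distr P ?N ?X"
    using ind unfolding indep_var_distribution_eq by simp
  also have "emeasure \<dots> F = (\<integral>\<^sup>+y. emeasure (distr P ?N ?X) (Pair y -` F) \<partial>distr P ?M ?Y)"
    by (rule N.emeasure_pair_measure_alt[OF F'])
  also have "\<dots> = (\<integral>\<^sup>+y. ennreal (G (y n)) \<partial>distr P ?M ?Y)"
  proof (rule nn_integral_cong)
    fix y assume "y \<in> space (distr P ?M ?Y)"
    then have "Pair y -` F = {x \<in> space ?N. record_event {1..<n} x (y n) A}"
      by (auto simp: F_def space_pair_measure)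
    then show "emeasure (distr P ?N ?X) (Pair y -` F) = ennreal (G (y n))" by (simp only: slice)
  qed
  also have "\<dots> = (\<integral>\<^sup>+\<omega>. ennreal (G (U n \<omega>)) \<partial>P)"
  proof -
    have "(\<lambda>y. G (y n)) \<in> borel_measurable ?M"
      by (rule measurable_compose[OF _ G]) (simp add: measurable_component_singleton)
    then show ?thesis by (subst nn_integral_distr[OF Y]) simp_all
  qed
  also have "\<dots> = (\<integral>\<^sup>+u. ennreal (G u) \<partial>distr P borel (U n))"
    using G by (subst nn_integral_distr[OF U]) simp_all
  also have "\<dots> = ennreal (\<integral>u. G u \<partial>cube_law)"
    unfolding distr_U[OF n]
    using G by (intro nn_integral_eq_integral cube_law.integrable_const_bound[where B=1]) (auto simp: G_def)
  finally show "record_prob n A = (\<integral>u. G u \<partial>cube_law)"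
    by (simp add: G_def record_prob_def)
qed

text \<open>Four regions for \<open>u\<close>, one for each summand: \<open>w\<close> in
  \<open>[a, b]\<close> with the window inside the cube, \<open>w\<close> in \<open>[a, b]\<close>
  with a coordinate above \<open>1 / M\<close>, then \<open>w < a\<close>, and \<open>w > b\<close>.
  A single inequality valid throughout the cube is what can be integrated.\<close>

lemma pointwise_bound:
  fixes u :: "real ^ 'd" and A :: "nat set" and b :: real
  assumes a: "0 < a" and LM: "0 < L" "0 < M" and n: "4 \<le> n" and u: "u \<in> unit_cube"
    and H: "0 \<le> H" "\<And>w. 0 \<le> w \<Longrightarrow> \<bar>grid_law TYPE('d) M L A w\<bar> \<le> H"
  defines "G \<equiv> prob {\<omega> \<in> space P. record_event {1..<n} (\<lambda>i. U i \<omega>) u A}"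
    and "K \<equiv> \<Sum>C\<in>(pattern M L A :: ('d \<Rightarrow> nat) set set). \<Sum>T\<in>Pow C. (real M ^ CARD('d) * b)\<^sup>2 + real M ^ CARD('d) * b"
    and "w \<equiv> real n * (\<Prod>j\<in>UNIV. u $ j)"
  shows "\<bar>G - grid_law TYPE('d) M L A w * indicator {a..b} w\<bar> \<le>
    (tail_error TYPE('d) a b M + slab_error TYPE('d) b M L + K / real n) * (1 * indicator {a..b} w)
    + (1 + H) * (\<Sum>j\<in>UNIV. indicator {u. u \<in> unit_cube \<and> 1 / real M < u $ j \<and> real n * (\<Prod>j\<in>UNIV. u $ j) \<le> b} u)
    + indicator {u. (\<Prod>j\<in>UNIV. u $ j) < a / real n \<and> u \<in> unit_cube} u
    + exp (- (w / 2)) * indicator {b<..} w"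
  (is "?lhs \<le> ?t1 + ?t2 + ?t3 + ?t4")
proof -
  have p: "0 < (\<Prod>j\<in>UNIV. u $ j)" using u by (intro prod_pos) (auto simp: unit_cube_def)
  then have w0: "0 < w" using n by (simp add: w_def)
  have G: "0 \<le> G" "G \<le> 1" by (simp_all add: G_def)
  have K0: "0 \<le> K" if "0 \<le> b" using that by (auto simp: K_def intro!: sum_nonneg add_nonneg_nonneg mult_nonneg_nonneg)
  have err0: "0 \<le> tail_error TYPE('d) a b M + slab_error TYPE('d) b M L + K / real n" if "0 \<le> b"
    using that K0 a n by (auto simp: tail_error_def slab_error_def intro!: add_nonneg_nonneg mult_nonneg_nonneg divide_nonneg_nonneg)
  have t2: "0 \<le> ?t2" using H by (intro mult_nonneg_nonneg sum_nonneg) auto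
  have t3: "0 \<le> ?t3" by simp
  have t4: "0 \<le> ?t4" by simp
  consider "w < a" | "b < w" | "a \<le> w" "w \<le> b" "\<And>j. real M * u $ j \<le> 1"
    | j where "a \<le> w" "w \<le> b" "1 < real M * u $ j"
    by (meson not_less)
  then show ?thesis
  proof cases
    case 1
    then have "?t3 = 1" using u n by (simp add: w_def field_simps)
    moreover have "?lhs \<le> 1" using 1 G by simp
    moreover have "0 \<le> ?t1" using 1 by simp
    ultimately show ?thesis using t2 t4 by linarith
  next
    case 2
    have "?lhs \<le> exp (- (w / 2))"
      using 2 G prob_record_event_le[OF n u, of A] by (simp add: G_def w_def)
    moreover have "?t4 = exp (- (w / 2))" "0 \<le> ?t1" using 2 by auto
    ultimately show ?thesis using t2 t3 by linarith
  next
    case 3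
    have "?lhs \<le> tail_error TYPE('d) a b M + slab_error TYPE('d) b M L + K / real n"
      using prob_record_event_approx[OF n u a _ _ LM 3(3), of b A] 3(1,2)
      by (simp add: G_def w_def K_def sum_divide_distrib)
    moreover have "?t1 = tail_error TYPE('d) a b M + slab_error TYPE('d) b M L + K / real n"
      using 3 by simp
    ultimately show ?thesis using t2 t3 t4 by linarith
  next
    case 4
    let ?e = "\<lambda>j. {u :: real ^ 'd. u \<in> unit_cube \<and> 1 / real M < u $ j \<and> real n * (\<Prod>j\<in>UNIV. u $ j) \<le> b}"
    have "?lhs \<le> 1 + H" using H(2)[of w] w0 G 4 by simp
    moreover have "1 \<le> (\<Sum>j\<in>UNIV. indicator (?e j) u :: real)"
    proof -
      have "u \<in> ?e j" using 4 u LM by (simp add: w_def field_simps)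
      then have "1 = (indicator (?e j) u :: real)" by simp
      also have "\<dots> \<le> (\<Sum>j\<in>UNIV. indicator (?e j) u)"
        by (rule member_le_sum) auto
      finally show ?thesis .
    qed
    then have "1 + H \<le> ?t2" using H(1) mult_left_mono[of 1 _ "1 + H"] by simp
    moreover have "0 \<le> ?t1" using err0 4 a by simp
    ultimately show ?thesis using t3 t4 by linarith
  qed
qed

lemma record_prob_near_grid_integral:
  assumes a: "0 < a" "a \<le> b" and b: "1 \<le> b" and LM: "0 < L" "0 < M" and \<epsilon>: "0 < \<epsilon>"
  shows "eventually (\<lambda>n. \<bar>record_scale (CARD('d) - 1) n * record_prob n A - (LBINT w:{a..b}. grid_law TYPE('d) M L A w)\<bar>
    < approx_error TYPE('d) a b M L + \<epsilon>) sequentially"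
proof -
  let ?\<phi> = "grid_law TYPE('d) M L A"
  let ?w = "\<lambda>n u :: real ^ 'd. real n * (\<Prod>j\<in>UNIV. u $ j)"
  let ?e = "\<lambda>n j. {u :: real ^ 'd. u \<in> unit_cube \<and> 1 / real M < u $ j \<and> real n * (\<Prod>j\<in>UNIV. u $ j) \<le> b}"
  let ?s = "\<lambda>n. {u :: real ^ 'd. (\<Prod>j\<in>UNIV. u $ j) < a / real n \<and> u \<in> unit_cube}"
  obtain H where H: "0 \<le> H" "\<And>w. 0 \<le> w \<Longrightarrow> \<bar>?\<phi> w\<bar> \<le> H"
    using grid_law_bounded by blast
  define K where "K = (\<Sum>C\<in>(pattern M L A :: ('d \<Rightarrow> nat) set set). \<Sum>T\<in>Pow C. (real M ^ CARD('d) * b)\<^sup>2 + real M ^ CARD('d) * b)"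
  define E where "E = tail_error TYPE('d) a b M + slab_error TYPE('d) b M L"
  define I where "I n = (\<integral>u. 1 * indicator {a..b} (?w n u) \<partial>cube_law :: real)" for n
  define V where "V n = (E + K / real n) * (record_scale (CARD('d) - 1) n * I n)
      + (1 + H) * (\<Sum>j\<in>UNIV. record_scale (CARD('d) - 1) n * measure cube_law (?e n j)) + record_scale (CARD('d) - 1) n * measure cube_law (?s n)" for n
  have prod_meas [measurable]: "(\<lambda>u :: real ^ 'd. \<Prod>j\<in>UNIV. u $ j) \<in> borel_measurable borel" by measurable
  have e_meas [measurable]: "?e n j \<in> sets borel" for n j
  proof -
    have "{u \<in> space borel. u \<in> unit_cube \<and> 1 / real M < (u :: real ^ 'd) $ j \<and> real n * (\<Prod>j\<in>UNIV. u $ j) \<le> b} \<in> sets borel"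
      by measurable
    then show ?thesis by simp
  qed
  have s_meas [measurable]: "?s n \<in> sets borel" for n
  proof -
    have "{u \<in> space borel. (\<Prod>j\<in>UNIV. (u :: real ^ 'd) $ j) < a / real n \<and> u \<in> unit_cube} \<in> sets borel"
      by measurable
    then show ?thesis by simp
  qed
  have I_lim: "(\<lambda>n. record_scale (CARD('d) - 1) n * I n) \<longlonglongrightarrow> b - a"
  proof -
    have "(\<lambda>n. record_scale (CARD('d) - 1) n * I n) \<longlonglongrightarrow> (LBINT w:{a..b}. 1)"
      unfolding I_def using a by (intro scaled_law_product_tendsto) auto
    then show ?thesis using a by (simp add: set_lebesgue_integral_def)
  qed
  \<comment> \<open>In the limit the grid error is weighted by the length of \<open>[a, b]\<close>,
    large coordinates contribute nothing, and the region \<open>w < a\<close> contributes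
    \<open>a\<close>. The region \<open>w > b\<close> is kept out of \<open>V\<close>, as its bound
    holds for each \<open>n\<close>.\<close>
  have "V \<longlonglongrightarrow> (E + 0) * (b - a) + (1 + H) * (\<Sum>j\<in>(UNIV :: 'd set). 0) + a"
    unfolding V_def
  proof (intro tendsto_add tendsto_mult tendsto_const tendsto_sum I_lim scaled_large_coordinate_tendsto)
    show "(\<lambda>n. K / real n) \<longlonglongrightarrow> 0" by (rule lim_const_over_n)
    show "(\<lambda>n. record_scale (CARD('d) - 1) n * measure cube_law (?s n)) \<longlonglongrightarrow> a"
      using scaled_small_product_tendsto[of "UNIV :: 'd set" a "CARD('d) - 1"] a by simp
  qed (use LM b in auto)
  then have V_lim: "V \<longlonglongrightarrow> E * (b - a) + a" by simp
  have bound: "\<bar>record_scale (CARD('d) - 1) n * record_prob n A - record_scale (CARD('d) - 1) n * (\<integral>u. ?\<phi> (?w n u) * indicator {a..b} (?w n u) \<partial>cube_law)\<bar>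
      \<le> V n + 2 * exp (- b / 2)" if n: "4 \<le> n" for n
  proof -
    define G where "G u = prob {\<omega> \<in> space P. record_event {1..<n} (\<lambda>i. U i \<omega>) u A}" for u
    have G [measurable]: "G \<in> borel_measurable borel" and rec: "record_prob n A = (\<integral>u. G u \<partial>cube_law)"
      using record_prob_eq_integral[of n A] n by (simp_all add: G_def[abs_def])
    let ?f = "\<lambda>u. ?\<phi> (?w n u) * indicator {a..b} (?w n u)"
    let ?t1 = "\<lambda>u. (E + K / real n) * (1 * indicator {a..b} (?w n u)) :: real"
    let ?t2 = "\<lambda>u. (1 + H) * (\<Sum>j\<in>UNIV. indicator (?e n j) u) :: real"
    let ?t3 = "\<lambda>u. indicator (?s n) u :: real"
    let ?t4 = "\<lambda>u. exp (- (?w n u / 2)) * indicator {b<..} (?w n u)"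
    have intG: "integrable cube_law G"
      by (rule cube_law.integrable_const_bound[where B=1]) (auto simp: G_def)
    have intf: "integrable cube_law ?f"
    proof (rule cube_law.integrable_const_bound[where B=H])
      have "\<bar>?\<phi> w * indicator {a..b} w\<bar> \<le> H" for w
        using H a by (cases "w \<in> {a..b}") auto
      then show "AE u in cube_law. norm (?f u) \<le> H" by simp
    qed measurable
    have int1: "integrable cube_law (\<lambda>u. 1 * indicator {a..b} (?w n u) :: real)"
      by (rule cube_law.integrable_const_bound[where B=1]) (auto simp: indicator_def)
    have int_ind: "integrable cube_law (indicator X :: real ^ 'd \<Rightarrow> real)" if "X \<in> sets borel" for X
      using that by (intro cube_law.integrable_const_bound[where B=1]) (auto simp: indicator_def)
    have int4: "integrable cube_law ?t4"
    proof (rule cube_law.integrable_const_bound[where B=1])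
      have "\<bar>exp (- (w / 2)) * indicator {b<..} w\<bar> \<le> 1" for w
        using b by (cases "b < w") auto
      then show "AE u in cube_law. norm (?t4 u) \<le> 1" by simp
    qed measurable
    have "\<bar>record_prob n A - (\<integral>u. ?f u \<partial>cube_law)\<bar> = \<bar>\<integral>u. G u - ?f u \<partial>cube_law\<bar>"
      unfolding rec using intG intf by simp
    also have "\<dots> \<le> (\<integral>u. \<bar>G u - ?f u\<bar> \<partial>cube_law)"
      by (rule integral_abs_bound)
    also have "\<dots> \<le> (\<integral>u. ?t1 u + ?t2 u + ?t3 u + ?t4 u \<partial>cube_law)"
    proof (rule integral_mono_AE)
      show "AE u in cube_law. \<bar>G u - ?f u\<bar> \<le> ?t1 u + ?t2 u + ?t3 u + ?t4 u"
        using AE_unit_cube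
      proof eventually_elim
        case (elim u)
        show ?case
          using pointwise_bound[OF a(1) LM n elim H, of b] by (simp only: G_def E_def K_def)
      qed
    qed (intro Bochner_Integration.integrable_add Bochner_Integration.integrable_diff integrable_abs integrable_mult_right
        Bochner_Integration.integrable_sum intG intf int1 int4 int_ind e_meas s_meas)+
    also have "\<dots> = (E + K / real n) * I n + (1 + H) * (\<Sum>j\<in>UNIV. measure cube_law (?e n j))
        + measure cube_law (?s n) + (\<integral>u. ?t4 u \<partial>cube_law)"
      using int1 int4 int_ind by (simp add: I_def)
    finally have "record_scale (CARD('d) - 1) n * \<bar>record_prob n A - (\<integral>u. ?f u \<partial>cube_law)\<bar> \<le>
      record_scale (CARD('d) - 1) n * ((E + K / real n) * I n + (1 + H) * (\<Sum>j\<in>UNIV. measure cube_law (?e n j))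
        + measure cube_law (?s n) + (\<integral>u. ?t4 u \<partial>cube_law))"
      by (intro mult_left_mono record_scale_nonneg)
    also have "\<dots> = V n + record_scale (CARD('d) - 1) n * (\<integral>u. ?t4 u \<partial>cube_law)"
      by (simp add: V_def sum_distrib_left algebra_simps)
    also have "\<dots> \<le> V n + 2 * exp (- b / 2)"
      using scaled_exp_tail_le[OF b, of n, where 'd='d] n by simp
    also have "record_scale (CARD('d) - 1) n * \<bar>record_prob n A - (\<integral>u. ?f u \<partial>cube_law)\<bar> =
        \<bar>record_scale (CARD('d) - 1) n * record_prob n A - record_scale (CARD('d) - 1) n * (\<integral>u. ?f u \<partial>cube_law)\<bar>"
      using record_scale_nonneg[of "CARD('d) - 1" n] by (simp add: abs_mult flip: right_diff_distrib)
    finally show ?thesis .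
  qed
  have \<phi>_lim: "(\<lambda>n. record_scale (CARD('d) - 1) n * (\<integral>u. ?\<phi> (?w n u) * indicator {a..b} (?w n u) \<partial>cube_law)) \<longlonglongrightarrow> (LBINT w:{a..b}. ?\<phi> w)"
    using a by (intro scaled_law_product_tendsto continuous_on_grid_law) auto
  have "eventually (\<lambda>n. V n < E * (b - a) + a + \<epsilon> / 2) sequentially"
    using order_tendstoD(2)[OF V_lim] \<epsilon> by simp
  moreover have "eventually (\<lambda>n. \<bar>record_scale (CARD('d) - 1) n * (\<integral>u. ?\<phi> (?w n u) * indicator {a..b} (?w n u) \<partial>cube_law) - (LBINT w:{a..b}. ?\<phi> w)\<bar> < \<epsilon> / 2) sequentially"
    using tendstoD[OF \<phi>_lim, of "\<epsilon> / 2"] \<epsilon> by (simp add: dist_real_def)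
  ultimately show ?thesis using eventually_ge_at_top[of 4]
  proof eventually_elim
    case (elim n)
    have "approx_error TYPE('d) a b M L = E * (b - a) + a + 2 * exp (- b / 2)"
      by (simp add: approx_error_def E_def mult.commute)
    then show ?case using bound[OF elim(3)] elim(1,2) by linarith
  qed
qed

lemma slab_error_tendsto: "(\<lambda>L. slab_error TYPE('d) b M L) \<longlonglongrightarrow> 0"
proof -
  have "(\<lambda>L. real CARD('d) * real M * (b * real M ^ (CARD('d) - 1))\<^sup>2 * (1 / real L) +
      real CARD('d) * (b * real M ^ (CARD('d) - 1)) * (1 / real L)) \<longlonglongrightarrow>
      real CARD('d) * real M * (b * real M ^ (CARD('d) - 1))\<^sup>2 * 0 + real CARD('d) * (b * real M ^ (CARD('d) - 1)) * 0"
    by (intro tendsto_intros lim_const_over_n)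
  moreover have "slab_error TYPE('d) b M L = real CARD('d) * real M * (b * real M ^ (CARD('d) - 1))\<^sup>2 * (1 / real L) +
      real CARD('d) * (b * real M ^ (CARD('d) - 1)) * (1 / real L)" for L
    by (cases "L = 0") (auto simp: slab_error_def power2_eq_square field_simps)
  ultimately show ?thesis by simp
qed

lemma tail_error_tendsto:
  assumes "0 < a"
  shows "(\<lambda>M. tail_error TYPE('d) a b M) \<longlonglongrightarrow> 0"
proof -
  have "(\<lambda>M. exp (- (a / 4)) ^ M) \<longlonglongrightarrow> 0"
    using assms by (intro LIMSEQ_power_zero) auto
  then have "(\<lambda>M. exp (- (a / 4 * real M))) \<longlonglongrightarrow> 0"
    by (simp add: mult.commute flip: exp_of_nat_mult)
  then have "(\<lambda>M. b * (exp (a / 2 * real CARD('d)) * exp (- (a / 4 * real M)) * (1 / (1 - exp (- (a / 4)))) ^ CARD('d))) \<longlonglongrightarrow>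
      b * (exp (a / 2 * real CARD('d)) * 0 * (1 / (1 - exp (- (a / 4)))) ^ CARD('d))"
    by (intro tendsto_intros)
  then show ?thesis by (simp add: tail_error_def)
qed

lemma boundary_error_tendsto: "(\<lambda>m. 1 / real m + 2 * exp (- real m / 2)) \<longlonglongrightarrow> 0"
proof -
  have "(\<lambda>m. exp (- (1 / 2)) ^ m) \<longlonglongrightarrow> (0 :: real)"
    by (intro LIMSEQ_power_zero) auto
  then have "(\<lambda>m. exp (- real m / 2)) \<longlonglongrightarrow> 0"
    by (simp flip: exp_of_nat_mult)
  then have "(\<lambda>m. 1 / real m + 2 * exp (- real m / 2)) \<longlonglongrightarrow> 0 + 2 * 0"
    by (intro tendsto_intros lim_const_over_n)
  then show ?thesis by simp
qed

end

section \<open>Limits of integrals under the exponential weight\<close>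

lemma integrable_exp_neg: "set_integrable lborel {0<..} (\<lambda>w :: real. exp (- w))"
    and integral_exp_neg: "(LBINT w:{0<..}. exp (- w :: real)) = 1"
proof -
  have "(\<integral>\<^sup>+w. ennreal (exp (- w)) * indicator {0..} w \<partial>lborel) = ennreal (0 - (- exp (- 0 :: real)))"
  proof (rule nn_integral_FTC_atLeast)
    show "((\<lambda>w. - exp (- w)) \<longlongrightarrow> (0 :: real)) at_top"
      using tendsto_minus[OF filterlim_compose[OF exp_at_bot filterlim_uminus_at_bot_at_top]] by simp
  qed (auto intro!: derivative_eq_intros)
  also have "(\<integral>\<^sup>+w. ennreal (exp (- w)) * indicator {0..} w \<partial>lborel) = (\<integral>\<^sup>+w. ennreal (indicator {0<..} w *\<^sub>R exp (- w :: real)) \<partial>lborel)"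
  proof (rule nn_integral_cong_AE)
    show "AE w :: real in lborel. ennreal (exp (- w)) * indicator {0..} w = ennreal (indicator {0<..} w *\<^sub>R exp (- w))"
      using AE_lborel_singleton[of "0 :: real"] by eventually_elim (simp add: indicator_def)
  qed
  finally have nn: "(\<integral>\<^sup>+w. ennreal (indicator {0<..} w *\<^sub>R exp (- w :: real)) \<partial>lborel) = ennreal 1" by simp
  show "set_integrable lborel {0<..} (\<lambda>w :: real. exp (- w))"
    unfolding set_integrable_def by (rule integrableI_nonneg) (use nn in simp_all)
  show "(LBINT w:{0<..}. exp (- w :: real)) = 1"
    unfolding set_lebesgue_integral_def by (rule integral_eq_nn_integral[THEN trans]) (use nn in simp_all)
qed

text \<open>Functions and domains may vary together, so one statement handles the limits in
  \<open>L\<close>, in \<open>M\<close> and in the interval. Measurability of the limit is a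
  conclusion, passed along from the continuous functions \<open>grid_law\<close>.\<close>

lemma set_integral_dominated_exp:
  fixes f :: "nat \<Rightarrow> real \<Rightarrow> real"
  assumes meas: "\<And>n. set_borel_measurable borel {0<..} (f n)"
    and B: "\<And>n. B n \<in> sets borel" "\<And>n. B n \<subseteq> {0<..}" and B0: "B0 \<subseteq> {0<..}"
    and evB: "\<And>w. 0 < w \<Longrightarrow> eventually (\<lambda>n. w \<in> B n \<longleftrightarrow> w \<in> B0) sequentially"
    and bound: "\<And>n w. 0 < w \<Longrightarrow> \<bar>f n w\<bar> \<le> exp (- w)"
    and lim: "\<And>w. 0 < w \<Longrightarrow> (\<lambda>n. f n w) \<longlonglongrightarrow> g w"
  shows "set_borel_measurable borel {0<..} g" and "set_integrable lborel {0<..} g"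
    and "(\<lambda>n. LBINT w:B n. f n w) \<longlonglongrightarrow> (LBINT w:B0. g w)"
proof -
  have f_meas: "(\<lambda>w. indicator {0<..} w *\<^sub>R f n w) \<in> borel_measurable borel" for n
    using meas[of n] by (simp add: set_borel_measurable_def)
  have "(\<lambda>w. indicator {0<..} w *\<^sub>R g w) \<in> borel_measurable borel"
  proof (rule borel_measurable_LIMSEQ_real[OF _ f_meas])
    fix w :: real
    show "(\<lambda>n. indicator {0<..} w *\<^sub>R f n w) \<longlonglongrightarrow> indicator {0<..} w *\<^sub>R g w"
      using lim[of w] by (cases "0 < w") auto
  qed
  then show g_meas: "set_borel_measurable borel {0<..} g" by (simp add: set_borel_measurable_def)
  have g_bound: "\<bar>g w\<bar> \<le> exp (- w)" if "0 < w" for w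
    using tendsto_upperbound[OF tendsto_rabs[OF lim[OF that]] always_eventually] bound[OF that] by simp
  have int_exp: "integrable lborel (\<lambda>w :: real. indicator {0<..} w *\<^sub>R exp (- w))"
    using integrable_exp_neg by (simp add: set_integrable_def)
  show "set_integrable lborel {0<..} g"
    unfolding set_integrable_def
  proof (rule Bochner_Integration.integrable_bound[OF int_exp])
    show "AE w in lborel. norm (indicator {0<..} w *\<^sub>R g w) \<le> norm (indicator {0<..} w *\<^sub>R exp (- w))"
      using g_bound by (intro AE_I2) (auto simp: indicator_def)
  qed (use g_meas in \<open>simp add: set_borel_measurable_def\<close>)
  have B_set: "indicator X w *\<^sub>R h w = indicator X w * (indicator {0<..} w *\<^sub>R h w)" if "X \<subseteq> {0<..}"
    for X and h :: "real \<Rightarrow> real" and w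
    using that by (auto simp: indicator_def)
  have B0_meas: "(\<lambda>w. indicator B0 w *\<^sub>R g w) \<in> borel_measurable borel"
  proof (rule borel_measurable_LIMSEQ_real)
    fix w :: real
    show "(\<lambda>n. indicator (B n) w * (indicator {0<..} w *\<^sub>R f n w)) \<longlonglongrightarrow> indicator B0 w *\<^sub>R g w"
    proof (cases "0 < w")
      case True
      have "(\<lambda>n. indicator (B n) w :: real) \<longlonglongrightarrow> indicator B0 w"
        using evB[OF True] by (intro tendsto_eventually) (auto elim!: eventually_mono simp: indicator_def)
      from tendsto_mult[OF this lim[OF True]] show ?thesis using True by simp
    next
      case False
      then show ?thesis using B0 by (auto simp: indicator_def)
    qed
  qed (use B(1) f_meas in simp)
  show "(\<lambda>n. LBINT w:B n. f n w) \<longlonglongrightarrow> (LBINT w:B0. g w)"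
    unfolding set_lebesgue_integral_def
  proof (rule integral_dominated_convergence[OF _ _ int_exp])
    show "(\<lambda>w. indicator B0 w *\<^sub>R g w) \<in> borel_measurable lborel" using B0_meas by simp
    show "(\<lambda>w. indicator (B n) w *\<^sub>R f n w) \<in> borel_measurable lborel" for n
      unfolding B_set[OF B(2)] using B(1) f_meas[of n] by simp
    show "AE w in lborel. (\<lambda>n. indicator (B n) w *\<^sub>R f n w) \<longlonglongrightarrow> indicator B0 w *\<^sub>R g w"
    proof (rule AE_I2)
      fix w :: real
      show "(\<lambda>n. indicator (B n) w *\<^sub>R f n w) \<longlonglongrightarrow> indicator B0 w *\<^sub>R g w"
      proof (cases "0 < w")
        case True
        have "(\<lambda>n. indicator (B n) w :: real) \<longlonglongrightarrow> indicator B0 w"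
          using evB[OF True] by (intro tendsto_eventually) (auto elim!: eventually_mono simp: indicator_def)
        from tendsto_scaleR[OF this lim[OF True]] show ?thesis .
      next
        case False
        then have "w \<notin> B n" "w \<notin> B0" for n using B(2)[of n] B0 by auto
        then show ?thesis by simp
      qed
    qed
    show "AE w in lborel. norm (indicator (B n) w *\<^sub>R f n w) \<le> indicator {0<..} w *\<^sub>R exp (- w)" for n
    proof (rule AE_I2)
      fix w :: real
      show "norm (indicator (B n) w *\<^sub>R f n w) \<le> indicator {0<..} w *\<^sub>R exp (- w)"
        using B(2)[of n] bound[of w n] by (cases "w \<in> B n") (auto simp: indicator_def)
    qed
  qed
qed

context cube_sample
begin

text \<open>The Poisson process enters only through these three hypotheses on
  \<open>grid_law\<close>, so the same statement serves a single count and the set of all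
  counts.\<close>

lemma scaled_record_prob_tendsto:
  fixes f :: "real \<Rightarrow> real" and g :: "nat \<Rightarrow> real \<Rightarrow> real"
  assumes bound: "\<And>w L M. \<lbrakk>0 < w; 0 < L; 0 < M\<rbrakk> \<Longrightarrow> \<bar>grid_law TYPE('d) M L A w\<bar> \<le> exp (- w)"
    and g: "\<And>w M. \<lbrakk>0 < w; 0 < M\<rbrakk> \<Longrightarrow> (\<lambda>L. grid_law TYPE('d) M L A w) \<longlonglongrightarrow> g M w"
    and f: "\<And>w. 0 < w \<Longrightarrow> (\<lambda>M. g (Suc M) w) \<longlonglongrightarrow> f w"
  shows "set_integrable lborel {0<..} f"
    and "(\<lambda>n. record_scale (CARD('d) - 1) n * record_prob n A) \<longlonglongrightarrow> (LBINT w:{0<..}. f w)"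
proof -
  have grid_meas: "set_borel_measurable borel {0<..} (grid_law TYPE('d) M L A)" for M L
    unfolding set_borel_measurable_def by measurable
  have g': "(\<lambda>L. grid_law TYPE('d) (Suc M) (Suc L) A w) \<longlonglongrightarrow> g (Suc M) w" if "0 < w" for M w
    using g[OF that, of "Suc M"] by (intro LIMSEQ_Suc) simp
  have bound': "\<bar>grid_law TYPE('d) (Suc M) (Suc L) A w\<bar> \<le> exp (- w)" if "0 < w" for w M L
    using that by (intro bound) auto
  have g_bound: "\<bar>g (Suc M) w\<bar> \<le> exp (- w)" if "0 < w" for w M
    using tendsto_upperbound[OF tendsto_rabs[OF g'[OF that]] always_eventually] bound'[OF that] by simp
  have g_meas: "set_borel_measurable borel {0<..} (g (Suc M))" for M
    by (rule set_integral_dominated_exp(1)[OF grid_meas, of "\<lambda>_. {0<..}" "{0<..}" "\<lambda>_. Suc M" Suc])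
      (use g' bound' in auto)
  have L_lim: "(\<lambda>L. LBINT w:B. grid_law TYPE('d) (Suc M) (Suc L) A w) \<longlonglongrightarrow> (LBINT w:B. g (Suc M) w)"
    if "B \<in> sets borel" "B \<subseteq> {0<..}" for B M
    by (rule set_integral_dominated_exp(3)[OF grid_meas]) (use that g' bound' in auto)
  have M_lim: "(\<lambda>M. LBINT w:B. g (Suc M) w) \<longlonglongrightarrow> (LBINT w:B. f w)"
    if "B \<in> sets borel" "B \<subseteq> {0<..}" for B
    by (rule set_integral_dominated_exp(3)[OF g_meas]) (use that f g_bound in auto)
  have f_meas: "set_borel_measurable borel {0<..} f"
    by (rule set_integral_dominated_exp(1)[OF g_meas, of "\<lambda>_. {0<..}" "{0<..}"]) (use f g_bound in auto)
  have f_bound: "\<bar>f w\<bar> \<le> exp (- w)" if "0 < w" for w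
    using tendsto_upperbound[OF tendsto_rabs[OF f[OF that]] always_eventually] g_bound[OF that] by simp
  show "set_integrable lborel {0<..} f"
    by (rule set_integral_dominated_exp(2)[OF g_meas, of "\<lambda>_. {0<..}" "{0<..}"]) (use f g_bound in auto)
  have m_lim: "(\<lambda>m. LBINT w:{1 / real (Suc m)..real (Suc m)}. f w) \<longlonglongrightarrow> (LBINT w:{0<..}. f w)"
  proof (rule set_integral_dominated_exp(3)[OF f_meas])
    fix w :: real assume w: "0 < w"
    have "eventually (\<lambda>m. max w (1 / w) \<le> real m) sequentially"
      using filterlim_real_sequentially unfolding filterlim_at_top by blast
    then show "eventually (\<lambda>m. (w \<in> {1 / real (Suc m)..real (Suc m)}) = (w \<in> {0<..})) sequentially"
    proof eventually_elim
      case (elim m)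
      then have "w \<le> real (Suc m)" "1 / w \<le> real (Suc m)" by auto
      then show ?case using w by (simp add: field_simps)
    qed
  next
    fix n show "{1 / real (Suc n)..real (Suc n)} \<subseteq> {0<..}"
      by (auto intro: less_le_trans[of _ "1 / real (Suc n)"])
  qed (use f_bound in auto)
  show "(\<lambda>n. record_scale (CARD('d) - 1) n * record_prob n A) \<longlonglongrightarrow> (LBINT w:{0<..}. f w)"
  proof (rule tendstoI)
    fix \<epsilon> :: real assume "0 < \<epsilon>"
    \<comment> \<open>Seven errors below \<open>\<delta>\<close> arise: three in
      \<open>approx_error\<close>, one from the limit in \<open>n\<close>, and one each from passing
      to the limit in \<open>L\<close>, in \<open>M\<close> and in the interval.\<close>
    define \<delta> where "\<delta> = \<epsilon> / 8"
    have \<delta>: "0 < \<delta>" using \<open>0 < \<epsilon>\<close> by (simp add: \<delta>_def)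
    have "eventually (\<lambda>m. 1 / real (Suc m) + 2 * exp (- real (Suc m) / 2) < \<delta> \<and>
        \<bar>(LBINT w:{1 / real (Suc m)..real (Suc m)}. f w) - (LBINT w:{0<..}. f w)\<bar> < \<delta>) sequentially"
      using order_tendstoD(2)[OF LIMSEQ_Suc[OF boundary_error_tendsto] \<delta>] tendstoD[OF m_lim \<delta>]
      by eventually_elim (simp add: dist_real_def)
    then obtain m where m: "1 / real (Suc m) + 2 * exp (- real (Suc m) / 2) < \<delta>"
        "\<bar>(LBINT w:{1 / real (Suc m)..real (Suc m)}. f w) - (LBINT w:{0<..}. f w)\<bar> < \<delta>"
      using eventually_happens'[OF sequentially_bot] by blast
    define a where "a = 1 / real (Suc m)"
    define b where "b = real (Suc m)"
    have ab: "0 < a" "a \<le> b" "1 \<le> b" by (auto simp: a_def b_def field_simps)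
    have B: "{a..b} \<in> sets borel" "{a..b} \<subseteq> {0<..}" using ab by auto
    have "(\<lambda>M. (b - a) * tail_error TYPE('d) a b (Suc M)) \<longlonglongrightarrow> (b - a) * 0"
      by (intro tendsto_intros LIMSEQ_Suc tail_error_tendsto ab)
    then have "(\<lambda>M. (b - a) * tail_error TYPE('d) a b (Suc M)) \<longlonglongrightarrow> 0" by simp
    from order_tendstoD(2)[OF this \<delta>] tendstoD[OF M_lim[OF B] \<delta>]
    have "eventually (\<lambda>M. (b - a) * tail_error TYPE('d) a b (Suc M) < \<delta> \<and>
        \<bar>(LBINT w:{a..b}. g (Suc M) w) - (LBINT w:{a..b}. f w)\<bar> < \<delta>) sequentially"
      by eventually_elim (simp add: dist_real_def)
    then obtain M where M: "(b - a) * tail_error TYPE('d) a b (Suc M) < \<delta>"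
        "\<bar>(LBINT w:{a..b}. g (Suc M) w) - (LBINT w:{a..b}. f w)\<bar> < \<delta>"
      using eventually_happens'[OF sequentially_bot] by blast
    have "(\<lambda>L. (b - a) * slab_error TYPE('d) b (Suc M) (Suc L)) \<longlonglongrightarrow> (b - a) * 0"
      by (intro tendsto_mult tendsto_const LIMSEQ_Suc[OF slab_error_tendsto])
    then have "(\<lambda>L. (b - a) * slab_error TYPE('d) b (Suc M) (Suc L)) \<longlonglongrightarrow> 0" by simp
    from order_tendstoD(2)[OF this \<delta>] tendstoD[OF L_lim[OF B] \<delta>]
    have "eventually (\<lambda>L. (b - a) * slab_error TYPE('d) b (Suc M) (Suc L) < \<delta> \<and>
        \<bar>(LBINT w:{a..b}. grid_law TYPE('d) (Suc M) (Suc L) A w) - (LBINT w:{a..b}. g (Suc M) w)\<bar> < \<delta>) sequentially"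
      by eventually_elim (simp add: dist_real_def)
    then obtain L where L: "(b - a) * slab_error TYPE('d) b (Suc M) (Suc L) < \<delta>"
        "\<bar>(LBINT w:{a..b}. grid_law TYPE('d) (Suc M) (Suc L) A w) - (LBINT w:{a..b}. g (Suc M) w)\<bar> < \<delta>"
      using eventually_happens'[OF sequentially_bot] by blast
    have "approx_error TYPE('d) a b (Suc M) (Suc L) =
        (b - a) * tail_error TYPE('d) a b (Suc M) + (b - a) * slab_error TYPE('d) b (Suc M) (Suc L) + (a + 2 * exp (- b / 2))"
      by (simp add: approx_error_def distrib_left)
    then have err: "approx_error TYPE('d) a b (Suc M) (Suc L) < 3 * \<delta>"
      using m(1) M(1) L(1) unfolding a_def[symmetric] unfolding b_def[symmetric] by linarith
    from record_prob_near_grid_integral[OF ab zero_less_Suc[of L] zero_less_Suc[of M] \<delta>, of A]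
    show "eventually (\<lambda>n. dist (record_scale (CARD('d) - 1) n * record_prob n A) (LBINT w:{0<..}. f w) < \<epsilon>) sequentially"
    proof eventually_elim
      case (elim n)
      have "\<epsilon> = 8 * \<delta>" by (simp add: \<delta>_def)
      then show ?case
        using elim err m(2) M(2) L(2) unfolding a_def[symmetric] unfolding b_def[symmetric] dist_real_def
        by linarith
    qed
  qed
qed

text \<open>On a fixed grid no pattern has more minimal cells than there are cells, so for large
  \<open>B\<close> the grid law vanishes identically and only the approximation error is
  left.\<close>

lemma record_prob_tight:
  assumes "0 < \<epsilon>"
  shows "\<exists>B. eventually (\<lambda>n. record_scale (CARD('d) - 1) n * record_prob n {B..} < \<epsilon>) sequentially"
proof -
  define \<delta> where "\<delta> = \<epsilon> / 4"
  have \<delta>: "0 < \<delta>" using assms by (simp add: \<delta>_def)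
  have "eventually (\<lambda>m. 1 / real (Suc m) + 2 * exp (- real (Suc m) / 2) < \<delta>) sequentially"
    using order_tendstoD(2)[OF LIMSEQ_Suc[OF boundary_error_tendsto] \<delta>] .
  then obtain m where m: "1 / real (Suc m) + 2 * exp (- real (Suc m) / 2) < \<delta>"
    using eventually_happens'[OF sequentially_bot] by blast
  define a where "a = 1 / real (Suc m)"
  define b where "b = real (Suc m)"
  have ab: "0 < a" "a \<le> b" "1 \<le> b" by (auto simp: a_def b_def field_simps)
  have "(\<lambda>M. (b - a) * tail_error TYPE('d) a b (Suc M)) \<longlonglongrightarrow> (b - a) * 0"
    by (intro tendsto_intros LIMSEQ_Suc tail_error_tendsto ab)
  then have "(\<lambda>M. (b - a) * tail_error TYPE('d) a b (Suc M)) \<longlonglongrightarrow> 0" by simp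
  from eventually_happens'[OF sequentially_bot order_tendstoD(2)[OF this \<delta>]]
  obtain M where M: "(b - a) * tail_error TYPE('d) a b (Suc M) < \<delta>" by blast
  have "(\<lambda>L. (b - a) * slab_error TYPE('d) b (Suc M) (Suc L)) \<longlonglongrightarrow> (b - a) * 0"
    by (intro tendsto_mult tendsto_const LIMSEQ_Suc[OF slab_error_tendsto])
  then have "(\<lambda>L. (b - a) * slab_error TYPE('d) b (Suc M) (Suc L)) \<longlonglongrightarrow> 0" by simp
  from eventually_happens'[OF sequentially_bot order_tendstoD(2)[OF this \<delta>]]
  obtain L where L: "(b - a) * slab_error TYPE('d) b (Suc M) (Suc L) < \<delta>" by blast
  have "approx_error TYPE('d) a b (Suc M) (Suc L) =
      (b - a) * tail_error TYPE('d) a b (Suc M) + (b - a) * slab_error TYPE('d) b (Suc M) (Suc L) + (a + 2 * exp (- b / 2))"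
    by (simp add: approx_error_def distrib_left)
  then have err: "approx_error TYPE('d) a b (Suc M) (Suc L) < 3 * \<delta>"
    using m M L unfolding a_def[symmetric] unfolding b_def[symmetric] by linarith
  define B where "B = Suc (card (grid (Suc M * Suc L) :: ('d \<Rightarrow> nat) set))"
  have "pattern (Suc M) (Suc L) {B..} = ({} :: ('d \<Rightarrow> nat) set set)"
  proof -
    have "grid_count (Suc L) C < B" if "C \<subseteq> grid (Suc M * Suc L)" for C :: "('d \<Rightarrow> nat) set"
    proof -
      have "grid_count (Suc L) C \<le> card (grid (Suc M * Suc L) :: ('d \<Rightarrow> nat) set)"
        unfolding grid_count_def using that by (intro card_mono) auto
      then show ?thesis by (simp add: B_def)
    qed
    then have "grid_count (Suc L) C \<notin> {B..}" if "C \<subseteq> grid (Suc M * Suc L) - grid (Suc L)" for C :: "('d \<Rightarrow> nat) set"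
      using that unfolding atLeast_iff not_le by blast
    then show ?thesis unfolding pattern_def by blast
  qed
  then have zero: "grid_law TYPE('d) (Suc M) (Suc L) {B..} w = 0" for w
    by (simp add: grid_law_def void_sum_def)
  from record_prob_near_grid_integral[OF ab zero_less_Suc[of L] zero_less_Suc[of M] \<delta>, of "{B..}"]
  have "eventually (\<lambda>n. record_scale (CARD('d) - 1) n * record_prob n {B..} < \<epsilon>) sequentially"
  proof eventually_elim
    case (elim n)
    then show ?case using err by (simp add: zero \<delta>_def set_lebesgue_integral_def)
  qed
  then show ?thesis by blast
qed

section \<open>From record events to the conditional law of the kill count\<close>

lemma record_prob_Un:
  assumes "1 \<le> n" "A \<inter> B = {}"
  shows "record_prob n (A \<union> B) = record_prob n A + record_prob n B"
proof -
  have "{\<omega> \<in> space P. record_event {1..<n} (\<lambda>i. U i \<omega>) (U n \<omega>) (A \<union> B)} =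
      {\<omega> \<in> space P. record_event {1..<n} (\<lambda>i. U i \<omega>) (U n \<omega>) A} \<union>
      {\<omega> \<in> space P. record_event {1..<n} (\<lambda>i. U i \<omega>) (U n \<omega>) B}"
    by (auto simp: record_event_def)
  then show ?thesis
    unfolding record_prob_def using assms record_event_sets(2)[OF assms(1)]
    by (simp only:) (intro finite_measure_Union; auto simp: record_event_def)
qed

lemma record_prob_sum:
  assumes "1 \<le> n" "finite A"
  shows "record_prob n A = (\<Sum>k\<in>A. record_prob n {k})"
  using assms(2)
proof (induction A rule: finite_induct)
  case empty
  then show ?case by (simp add: record_prob_def record_event_def)
next
  case (insert k A)
  then show ?case using record_prob_Un[OF assms(1), of "{k}" A] by simp
qed

lemma kill_count_measurable:
  assumes "1 \<le> n"
  shows "(\<lambda>\<omega>. kill_count (\<lambda>i. U i \<omega>) n) \<in> measurable P (count_space UNIV)"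
proof -
  have [measurable]: "U n \<in> borel_measurable P" using assms by (rule U_measurable)
  have "(\<lambda>\<omega>. card {i \<in> {1..<n}. U n \<omega> \<prec> U i \<omega> \<and> (\<forall>i'\<in>{1..<n}. \<not> U i' \<omega> \<prec> U i \<omega>)}) \<in> measurable P (count_space UNIV)"
    by (intro pred_card_measurable) measurable
  then have "(\<lambda>\<omega>. int (card {i \<in> {1..<n}. U n \<omega> \<prec> U i \<omega> \<and> (\<forall>i'\<in>{1..<n}. \<not> U i' \<omega> \<prec> U i \<omega>)})) \<in> measurable P (count_space UNIV)"
    by (rule measurable_compose) simp
  then show ?thesis unfolding kill_count_eq[OF assms] by (rule measurable_If) measurable
qed

end

context cube_sample
begin

lemma kill_count_distr_cdf:
  assumes n: "1 \<le> n"
  shows "cdf (distr (uniform_measure P {\<omega>\<in>space P. 0 \<le> kill_count (\<lambda>i. U i \<omega>) n}) borel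
      (\<lambda>\<omega>. real_of_int (kill_count (\<lambda>i. U i \<omega>) n))) x =
    record_prob n {k. real k \<le> x} / record_prob n UNIV"
proof -
  let ?K = "\<lambda>\<omega>. kill_count (\<lambda>i. U i \<omega>) n"
  let ?E = "{\<omega>\<in>space P. 0 \<le> ?K \<omega>}"
  have K [measurable]: "?K \<in> measurable P (count_space UNIV)" by (rule kill_count_measurable[OF n])
  have E [measurable]: "?E \<in> sets P" by measurable
  have eq: "{\<omega> \<in> space P. ?K \<omega> \<in> int ` A} = {\<omega> \<in> space P. record_event {1..<n} (\<lambda>i. U i \<omega>) (U n \<omega>) A}" for A
    using kill_count_in_iff[OF n] by auto
  have "?E = {\<omega> \<in> space P. ?K \<omega> \<in> int ` UNIV}" by (auto simp: image_def intro: nonneg_int_cases)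
  then have prob_E: "prob ?E = record_prob n UNIV" by (simp only: eq record_prob_def)
  have inter: "?E \<inter> ((\<lambda>\<omega>. real_of_int (?K \<omega>)) -` {..x} \<inter> space P) = {\<omega> \<in> space P. ?K \<omega> \<in> int ` {k. real k \<le> x}}"
  proof (intro equalityI subsetI)
    fix \<omega> assume *: "\<omega> \<in> ?E \<inter> ((\<lambda>\<omega>. real_of_int (?K \<omega>)) -` {..x} \<inter> space P)"
    then obtain k where "?K \<omega> = int k" by (auto elim: nonneg_int_cases)
    then show "\<omega> \<in> {\<omega> \<in> space P. ?K \<omega> \<in> int ` {k. real k \<le> x}}" using * by simp
  qed auto
  have meas: "(\<lambda>\<omega>. real_of_int (?K \<omega>)) \<in> measurable (uniform_measure P ?E) borel"
    by (simp add: measurable_compose[OF K])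
  have sets: "(\<lambda>\<omega>. real_of_int (?K \<omega>)) -` {..x} \<inter> space P \<in> sets P"
    by (rule measurable_sets[of _ P borel]) (use measurable_compose[OF K] in auto)
  have "cdf (distr (uniform_measure P ?E) borel (\<lambda>\<omega>. real_of_int (?K \<omega>))) x =
      measure (uniform_measure P ?E) ((\<lambda>\<omega>. real_of_int (?K \<omega>)) -` {..x} \<inter> space P)"
    unfolding cdf_def by (subst measure_distr[OF meas]) auto
  also have "\<dots> = prob (?E \<inter> ((\<lambda>\<omega>. real_of_int (?K \<omega>)) -` {..x} \<inter> space P)) / prob ?E"
  proof (cases "prob ?E = 0")
    \<comment> \<open>On a null conditioning event both sides are \<open>0\<close> by the convention
      for division by \<open>0\<close>.\<close>
    case True
    have "emeasure P (?E \<inter> ((\<lambda>\<omega>. real_of_int (?K \<omega>)) -` {..x} \<inter> space P)) \<le> emeasure P ?E"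
      by (intro emeasure_mono E) blast
    then have "emeasure P (?E \<inter> ((\<lambda>\<omega>. real_of_int (?K \<omega>)) -` {..x} \<inter> space P)) = 0"
      unfolding emeasure_eq_measure[of ?E] True by simp
    then show ?thesis
      unfolding True by (simp only: measure_def[of "uniform_measure P ?E"] emeasure_uniform_measure[OF E sets]) simp
  next
    case False
    then show ?thesis
      using sets by (intro measure_uniform_measure) (simp_all add: emeasure_eq_measure)
  qed
  also have "\<dots> = record_prob n {k. real k \<le> x} / record_prob n UNIV"
    unfolding inter eq prob_E by (simp add: record_prob_def)
  finally show ?thesis .
qed

end

theorem theorem1:
  fixes P :: "'a measure" and U :: "nat \<Rightarrow> 'a \<Rightarrow> real ^ 'd"
    and Q :: "real \<Rightarrow> 'b measure" and S :: "real \<Rightarrow> 'b \<Rightarrow> (real ^ 'd) set"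
  assumes "prob_space P"
    and "prob_space.indep_vars P (\<lambda>_. borel) U {1..}"
    and "\<And>n. 1 \<le> n \<Longrightarrow> distr P borel (U n) = uniform_measure lborel unit_cube"
    and "\<And>w. 0 < w \<Longrightarrow> unit_poisson_process (Q w) (corner_region w) (S w)"
  shows "\<exists>\<K> :: nat pmf.
    (\<forall>k. set_integrable lborel {0<..}
           (\<lambda>w. measure (Q w) {\<omega>\<in>space (Q w). dominating_minima_count w (S w \<omega>) = enat k} * exp (- w)) \<and>
         pmf \<K> k = (LBINT w:{0<..}.
           measure (Q w) {\<omega>\<in>space (Q w). dominating_minima_count w (S w \<omega>) = enat k} * exp (- w))) \<and>
    weak_conv_m
      (\<lambda>n. distr (uniform_measure P {\<omega>\<in>space P. 0 \<le> kill_count (\<lambda>i. U i \<omega>) n}) borel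
             (\<lambda>\<omega>. real_of_int (kill_count (\<lambda>i. U i \<omega>) n)))
      (distr (measure_pmf \<K>) borel real)"
proof -
  interpret cube_sample P U
    using assms(1-3) by (simp add: cube_sample_def cube_sample_axioms_def)
  define q where "q k w = measure (Q w) {\<omega>\<in>space (Q w). dominating_minima_count w (S w \<omega>) = enat k}" for k w
  define \<pi> where "\<pi> k = (LBINT w:{0<..}. q k w * exp (- w))" for k
  let ?c = "record_scale (CARD('d) - 1)"
  \<comment> \<open>The alternating sum gives no such bound directly; it is seen from the Poisson
    reading of the formula as \<open>exp (- w)\<close> times a probability.\<close>
  have grid_bound: "\<bar>grid_law TYPE('d) M L A w\<bar> \<le> exp (- w)" if "0 < w" "0 < L" "0 < M" for w L M A
  proof -
    interpret Q: prob_space "Q w" using assms(4)[OF that(1)] by (simp add: unit_poisson_process_def)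
    show ?thesis
      unfolding pp_grid_law(1)[OF that(1) assms(4)[OF that(1)] that(2,3), symmetric]
      by (simp add: abs_mult mult_left_le)
  qed
  have q_lim: "set_integrable lborel {0<..} (\<lambda>w. q k w * exp (- w))"
    "(\<lambda>n. ?c n * record_prob n {k}) \<longlonglongrightarrow> \<pi> k" for k
  proof -
    let ?g = "\<lambda>M w. exp (- w) * measure (Q w) {\<omega> \<in> space (Q w). card (truncated_minima M w (S w \<omega>)) = k}"
    have f: "(\<lambda>M. ?g (Suc M) w) \<longlonglongrightarrow> q k w * exp (- w)" if "0 < w" for w
      unfolding q_def mult.commute[of _ "exp (- w)"]
      by (intro tendsto_mult tendsto_const pp_dominating_minima[OF that assms(4)[OF that]])
    note lim = scaled_record_prob_tendsto[of "{k}" ?g, OF grid_bound pp_truncated(2)[OF _ assms(4)] f]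
    show "set_integrable lborel {0<..} (\<lambda>w. q k w * exp (- w))" by (rule lim(1)) auto
    show "(\<lambda>n. ?c n * record_prob n {k}) \<longlonglongrightarrow> \<pi> k" unfolding \<pi>_def by (rule lim(2)) auto
  qed
  have UNIV_lim: "(\<lambda>n. ?c n * record_prob n UNIV) \<longlonglongrightarrow> 1"
  proof -
    have "(\<lambda>L. grid_law TYPE('d) M L UNIV w) \<longlonglongrightarrow> exp (- w)" if "0 < w" "0 < M" for w M
    proof (rule tendsto_eventually)
      show "eventually (\<lambda>L. grid_law TYPE('d) M L UNIV w = exp (- w)) sequentially"
        using eventually_gt_at_top[of 0]
        by eventually_elim (rule pp_grid_law_UNIV[OF that(1) assms(4)[OF that(1)] _ that(2)])
    qed
    from scaled_record_prob_tendsto(2)[of UNIV "\<lambda>_ w. exp (- w)" "\<lambda>w. exp (- w)", OF grid_bound this]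
    show ?thesis by (simp add: integral_exp_neg)
  qed
  have finite_lim: "(\<lambda>n. ?c n * record_prob n A) \<longlonglongrightarrow> (\<Sum>k\<in>A. \<pi> k)" if "finite A" for A
  proof -
    have "(\<lambda>n. \<Sum>k\<in>A. ?c n * record_prob n {k}) \<longlonglongrightarrow> (\<Sum>k\<in>A. \<pi> k)"
      by (intro tendsto_sum q_lim)
    then show ?thesis
    proof (rule Lim_transform_eventually)
      show "eventually (\<lambda>n. (\<Sum>k\<in>A. ?c n * record_prob n {k}) = ?c n * record_prob n A) sequentially"
        using eventually_ge_at_top[of 1]
        by eventually_elim (simp add: record_prob_sum[OF _ that] sum_distrib_left)
    qed
  qed
  have rec_nonneg: "0 \<le> ?c n * record_prob n A" for n A
    by (simp add: record_scale_nonneg record_prob_def)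
  have \<pi>_nonneg: "0 \<le> \<pi> k" for k
    using rec_nonneg by (intro tendsto_lowerbound[OF q_lim(2)]) auto
  have tail: "(\<lambda>n. ?c n * record_prob n {B..}) \<longlonglongrightarrow> 1 - (\<Sum>k<B. \<pi> k)" for B
  proof -
    have "(\<lambda>n. ?c n * record_prob n UNIV - ?c n * record_prob n {..<B}) \<longlonglongrightarrow> 1 - (\<Sum>k<B. \<pi> k)"
      by (intro tendsto_diff UNIV_lim finite_lim) simp
    then show ?thesis
    proof (rule Lim_transform_eventually)
      show "eventually (\<lambda>n. ?c n * record_prob n UNIV - ?c n * record_prob n {..<B} = ?c n * record_prob n {B..}) sequentially"
        using eventually_ge_at_top[of 1]
      proof eventually_elim
        case (elim n)
        have "{..<B} \<union> {B..} = (UNIV :: nat set)" "{..<B} \<inter> {B..} = {}" by auto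
        then show ?case using record_prob_Un[OF elim, of "{..<B}" "{B..}"] by (simp add: algebra_simps)
      qed
    qed
  qed
  \<comment> \<open>The partial sums stay at most \<open>1\<close> because tails are nonnegative;
    tightness provides a \<open>B\<close> that works for all large \<open>n\<close>, so the limiting
    tail beyond \<open>B\<close> is small.\<close>
  have "\<pi> sums 1"
    unfolding sums_def
  proof (rule LIMSEQ_I)
    fix \<epsilon> :: real assume "0 < \<epsilon>"
    then obtain B where B: "eventually (\<lambda>n. ?c n * record_prob n {B..} < \<epsilon> / 2) sequentially"
      using record_prob_tight[of "\<epsilon> / 2"] by auto
    have lower: "0 \<le> 1 - (\<Sum>k<C. \<pi> k)" for C
      using rec_nonneg by (intro tendsto_lowerbound[OF tail]) auto
    have upper: "1 - (\<Sum>k<B. \<pi> k) \<le> \<epsilon> / 2"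
      using B by (intro tendsto_upperbound[OF tail]) (auto elim: eventually_mono)
    have "norm ((\<Sum>k<C. \<pi> k) - 1) < \<epsilon>" if "B \<le> C" for C
    proof -
      have "(\<Sum>k<B. \<pi> k) \<le> (\<Sum>k<C. \<pi> k)"
        using that \<pi>_nonneg by (intro sum_mono2) auto
      then show ?thesis using lower[of C] upper \<open>0 < \<epsilon>\<close> by simp
    qed
    then show "\<exists>B. \<forall>C\<ge>B. norm ((\<Sum>k<C. \<pi> k) - 1) < \<epsilon>" by blast
  qed
  then have "(\<integral>\<^sup>+k. ennreal (\<pi> k) \<partial>count_space UNIV) = 1"
    using suminf_ennreal_eq[OF \<pi>_nonneg] by (simp only: nn_integral_count_space_nat ennreal_1)
  then have pmf_\<pi>: "pmf (embed_pmf \<pi>) k = \<pi> k" for k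
    by (intro pmf_embed_pmf \<pi>_nonneg)
  have weak: "weak_conv_m
      (\<lambda>n. distr (uniform_measure P {\<omega>\<in>space P. 0 \<le> kill_count (\<lambda>i. U i \<omega>) n}) borel
             (\<lambda>\<omega>. real_of_int (kill_count (\<lambda>i. U i \<omega>) n)))
      (distr (measure_pmf (embed_pmf \<pi>)) borel real)"
    unfolding weak_conv_m_def weak_conv_def
  proof (intro allI impI)
    \<comment> \<open>Convergence holds at every \<open>x\<close>, a continuity point or not,
      because only finitely many counts lie below \<open>x\<close>.\<close>
    fix x :: real
    have fin: "finite {k. real k \<le> x}"
      by (rule finite_subset[of _ "{..nat \<lfloor>x\<rfloor>}"]) (auto simp: le_nat_floor)
    have "cdf (distr (measure_pmf (embed_pmf \<pi>)) borel real) x = measure_pmf.prob (embed_pmf \<pi>) {k. real k \<le> x}"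
      unfolding cdf_def by (subst measure_distr) (auto intro!: arg_cong[where f="measure_pmf.prob (embed_pmf \<pi>)"])
    also have "\<dots> = (\<Sum>k | real k \<le> x. \<pi> k)"
      using fin by (simp add: measure_measure_pmf_finite pmf_\<pi>)
    finally have cdf: "cdf (distr (measure_pmf (embed_pmf \<pi>)) borel real) x = (\<Sum>k | real k \<le> x. \<pi> k)" .
    have "(\<lambda>n. (?c n * record_prob n {k. real k \<le> x}) / (?c n * record_prob n UNIV)) \<longlonglongrightarrow> (\<Sum>k | real k \<le> x. \<pi> k) / 1"
      by (intro tendsto_divide finite_lim fin UNIV_lim) simp
    then have "(\<lambda>n. (?c n * record_prob n {k. real k \<le> x}) / (?c n * record_prob n UNIV)) \<longlonglongrightarrow> (\<Sum>k | real k \<le> x. \<pi> k)"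
      by simp
    then show "(\<lambda>n. cdf (distr (uniform_measure P {\<omega>\<in>space P. 0 \<le> kill_count (\<lambda>i. U i \<omega>) n}) borel
             (\<lambda>\<omega>. real_of_int (kill_count (\<lambda>i. U i \<omega>) n))) x) \<longlonglongrightarrow>
        cdf (distr (measure_pmf (embed_pmf \<pi>)) borel real) x"
      unfolding cdf
    proof (rule Lim_transform_eventually)
      show "eventually (\<lambda>n. (?c n * record_prob n {k. real k \<le> x}) / (?c n * record_prob n UNIV) =
          cdf (distr (uniform_measure P {\<omega>\<in>space P. 0 \<le> kill_count (\<lambda>i. U i \<omega>) n}) borel
             (\<lambda>\<omega>. real_of_int (kill_count (\<lambda>i. U i \<omega>) n))) x) sequentially"
        using eventually_ge_at_top[of 2]
      proof eventually_elim
        case (elim n)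
        \<comment> \<open>For \<open>n \<ge> 2\<close> the logarithm is nonzero, so the scale is
          nonzero and cancels in the quotient.\<close>
        then have "?c n \<noteq> 0" by (simp add: record_scale_def)
        then show ?case using elim by (simp add: kill_count_distr_cdf)
      qed
    qed
  qed
  show ?thesis
  proof (intro exI[of _ "embed_pmf \<pi>"] conjI allI weak)
    fix k
    show "set_integrable lborel {0<..}
        (\<lambda>w. measure (Q w) {\<omega>\<in>space (Q w). dominating_minima_count w (S w \<omega>) = enat k} * exp (- w))"
      using q_lim(1) unfolding q_def .
    show "pmf (embed_pmf \<pi>) k = (LBINT w:{0<..}.
        measure (Q w) {\<omega>\<in>space (Q w). dominating_minima_count w (S w \<omega>) = enat k} * exp (- w))"
      unfolding pmf_\<pi> \<pi>_def q_def ..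
  qed
qed

end
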